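(* Let $z,z',\xi\in\mathbb C$ with $\xi\ne1$, let $\mathfrak L_\nu$ be the Laguerre symmetric functions with parameters $(z,z')$, $\mathfrak M_\nu$ the Meixner symmetric functions with parameters $(z,z',\xi)$, and $\varphi^{\mathsf L}$, $\varphi^{\mathsf M}$ the corresponding formal moment functionals on $\mathrm{Sym}_{\mathbb C}$. For any $\mu,\nu\in\mathbb Y$, $$\varphi^{\mathsf L}(\mathfrak L_\mu\mathfrak L_\nu)=\delta_{\mu\nu}\,(z)_\nu(z')_\nu,\qquad \varphi^{\mathsf M}(\mathfrak M_\mu\mathfrak M_\nu)=\delta_{\mu\nu}\,\frac{\xi^{|\nu|}}{(1-\xi)^{2|\nu|}}(z)_\nu(z')_\nu .$$
   Context: $\mathbb Y$ is the set of all partitions, identified with Young diagrams; $|\nu|$ is the number of boxes and $\ell(\nu)$ the number of nonzero rows of $\nu$. $\mathrm{Sym}$ is the algebra of symmetric functions over $\mathbb R$, with power sums $p_k$ as free generators; $\mathrm{Sym}_{\mathbb C}=\mathrm{Sym}\otimes_{\mathbb R}\mathbb C$; $S_\nu$ are the Schur symmetric functions; $\delta$ is the Kronecker delta. For a box $\square=(i,j)$ (row $i$, column $j$) its content is $c(\square)=j-i$; for $\mu\subseteq\nu$, $(z)_{\nu/\mu}=\prod_{\square\in\nu/\mu}(z+c(\square))$, $(z)_\nu=(z)_{\nu/\varnothing}$; $\dim\nu/\mu$ is the number of standard tableaux of skew shape $\nu/\mu$ (equal to $1$ if $\mu=\nu$). Frobenius–Schur functions. Put $x^{\downarrow n}=x(x-1)\cdots(x-n+1)$.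 The factorial Schur polynomial is $S^{\mathsf f}_{\nu\mid N}(x_1,\dots,x_N)=\det[x_j^{\downarrow(\nu_i+N-i)}]_{i,j=1}^N/\prod_{i<j}(x_i-x_j)$ for $\ell(\nu)\le N$ (and $0$ if $\ell(\nu)>N$). The shifted Schur polynomial is $S^*_{\nu\mid N}(y_1,\dots,y_N)=S^{\mathsf f}_{\nu\mid N}(y_1+N-1,y_2+N-2,\dots,y_N)$; it satisfies $S^*_{\nu\mid N}|_{y_N=0}=S^*_{\nu\mid N-1}$. A polynomial in $y_1,\dots,y_N$ is shifted symmetric if it is symmetric in the variables $y_i+N-i$; $\mathrm{Sym}^*$ is the algebra of sequences $(f_N)_{N\ge1}$ of shifted symmetric polynomials in $N$ variables with $f_N|_{y_N=0}=f_{N-1}$ and $\sup_N\deg f_N<\infty$. Thus $S^*_\nu=(S^*_{\nu\mid N})_N\in\mathrm{Sym}^*$. The algebra $\mathrm{Sym}^*$ is freely generated by $p_k^*=\sum_{i\ge1}[(y_i-i+\frac12)^k-(-i+\frac12)^k]$, $k\ge1$, and $FS_\nu\in\mathrm{Sym}$ is the image of $S^*_\nu$ under the algebra isomorphism $\mathrm{Sym}^*\to\mathrm{Sym}$, $p^*_k\mapsto p_k$. The $FS_\nu$ form a basis of $\mathrm{Sym}$. Laguerre and Meixner symmetric functions (each family is a basis of $\mathrm{Sym}_{\mathbb C}$): $$\mathfrak L_\nu=\sum_{\mu\subseteq\nu}(-1)^{|\nu|-|\mu|}\frac{\dim\nu/\mu}{(|\nu|-|\mu|)!}(z)_{\nu/\mu}(z')_{\nu/\mu}S_\mu,$$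 $$\mathfrak M_\nu=\sum_{\mu\subseteq\nu}(-1)^{|\nu|-|\mu|}\left(\frac{\xi}{1-\xi}\right)^{|\nu|-|\mu|}\frac{\dim\nu/\mu}{(|\nu|-|\mu|)!}(z)_{\nu/\mu}(z')_{\nu/\mu}FS_\mu .$$ The formal moment functionals are the linear functionals $\varphi^{\mathsf L},\varphi^{\mathsf M}:\mathrm{Sym}_{\mathbb C}\to\mathbb C$ defined by $\varphi^{\mathsf L}(\mathfrak L_\nu)=\delta_{\nu\varnothing}$ and $\varphi^{\mathsf M}(\mathfrak M_\nu)=\delta_{\nu\varnothing}$ for all $\nu\in\mathbb Y$. *)

theory Defs
  imports
    Complex_Main
    "HOL-Library.Poly_Mapping"
    "HOL-Library.Function_Algebras"
    "HOL-Library.FuncSet"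
    "HOL-Combinatorics.Permutations"
    "Jordan_Normal_Form.Determinant"
begin

section \<open>Partitions and skew diagrams\<close>

text \<open>A partition is the list of its nonzero rows, so that equality of partitions is equality
  of lists, and \<^term>\<open>length \<nu>\<close> and \<^term>\<open>sum_list \<nu>\<close> are the number of rows and of boxes.
  Rows and columns are numbered from 1.\<close>

definition partitions :: "nat list set" where
  "partitions = {\<nu>. sorted_wrt (\<ge>) \<nu> \<and> 0 \<notin> set \<nu>}"

definition row :: "nat list \<Rightarrow> nat \<Rightarrow> nat" where
  "row \<nu> i = (if 1 \<le> i \<and> i \<le> length \<nu> then \<nu> ! (i - 1) else 0)"

definition diagram :: "nat list \<Rightarrow> (nat \<times> nat) set" where
  "diagram \<nu> = {(i, j). 1 \<le> i \<and> 1 \<le> j \<and> j \<le> row \<nu> i}"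

definition subpartitions :: "nat list \<Rightarrow> nat list set" where
  "subpartitions \<nu> = {\<mu> \<in> partitions. diagram \<mu> \<subseteq> diagram \<nu>}"

lemma finite_subpartitions: "finite (subpartitions \<nu>)"
proof (rule finite_subset)
  show "subpartitions \<nu> \<subseteq> {\<mu>. set \<mu> \<subseteq> {..sum_list \<nu>} \<and> length \<mu> \<le> length \<nu>}"
  proof
    fix \<mu> assume "\<mu> \<in> subpartitions \<nu>"
    then have pos: "0 \<notin> set \<mu>" and sub: "diagram \<mu> \<subseteq> diagram \<nu>"
      by (auto simp: subpartitions_def partitions_def)
    have box: "k < length \<nu> \<and> \<mu> ! k \<le> \<nu> ! k" if "k < length \<mu>" for k
    proof -
      have "\<mu> ! k \<noteq> 0" using that pos by (metis nth_mem)
      then have "(Suc k, \<mu> ! k) \<in> diagram \<mu>"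
        using that by (auto simp: diagram_def row_def)
      then have "(Suc k, \<mu> ! k) \<in> diagram \<nu>" using sub by blast
      then show ?thesis by (auto simp: diagram_def row_def split: if_splits)
    qed
    have "length \<mu> \<le> length \<nu>"
    proof (rule ccontr)
      assume "\<not> length \<mu> \<le> length \<nu>"
      then have "length \<nu> < length \<mu>" by (simp only: not_le)
      from box[OF this] show False by simp
    qed
    moreover have "x \<le> sum_list \<nu>" if x: "x \<in> set \<mu>" for x
    proof -
      obtain k where k: "k < length \<mu>" "\<mu> ! k = x"
        using x unfolding in_set_conv_nth by blast
      have "x \<le> \<nu> ! k" using box[OF k(1)] k(2) by simp
      also have "\<nu> ! k \<le> sum_list \<nu>" using box[OF k(1)] by (simp add: elem_le_sum_list)
      finally show ?thesis .
    qed
    ultimately show "\<mu> \<in> {\<mu>. set \<mu> \<subseteq> {..sum_list \<nu>} \<and> length \<mu> \<le> length \<nu>}"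
      by (simp add: subset_iff)
  qed
  show "finite {\<mu>. set \<mu> \<subseteq> {..sum_list \<nu>} \<and> length \<mu> \<le> length \<nu>}"
    by (rule finite_lists_length_le) simp
qed

definition content :: "nat \<times> nat \<Rightarrow> int" where
  "content b = int (snd b) - int (fst b)"

definition skew_pochhammer :: "'a::comm_ring_1 \<Rightarrow> nat list \<Rightarrow> nat list \<Rightarrow> 'a" where
  "skew_pochhammer z \<nu> \<mu> = (\<Prod>b\<in>diagram \<nu> - diagram \<mu>. z + of_int (content b))"

text \<open>Tableaux are extensional functions, hence each is counted once. In a skew diagram it
  suffices to compare neighbouring boxes.\<close>

definition skew_standard_tableaux :: "nat list \<Rightarrow> nat list \<Rightarrow> (nat \<times> nat \<Rightarrow> nat) set" where
  "skew_standard_tableaux \<nu> \<mu> =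
    (let D = diagram \<nu> - diagram \<mu> in
     {T \<in> D \<rightarrow>\<^sub>E {1..card D}. bij_betw T D {1..card D} \<and>
        (\<forall>i j. (i, j) \<in> D \<and> (i, Suc j) \<in> D \<longrightarrow> T (i, j) < T (i, Suc j)) \<and>
        (\<forall>i j. (i, j) \<in> D \<and> (Suc i, j) \<in> D \<longrightarrow> T (i, j) < T (Suc i, j))})"

definition skew_dim :: "nat list \<Rightarrow> nat list \<Rightarrow> nat" where
  "skew_dim \<nu> \<mu> = card (skew_standard_tableaux \<nu> \<mu>)"

section \<open>Polynomials in countably many variables\<close>

text \<open>A polynomial maps exponent vectors to coefficients; multiplication is the convolution
  product of \<^theory>\<open>HOL-Library.Poly_Mapping\<close>.\<close>

type_synonym 'a mpoly = "(nat \<Rightarrow>\<^sub>0 nat) \<Rightarrow>\<^sub>0 'a"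

definition Const :: "'a::zero \<Rightarrow> 'a mpoly" where
  "Const c = Poly_Mapping.single 0 c"

definition Var :: "nat \<Rightarrow> 'a::zero_neq_one mpoly" where
  "Var i = Poly_Mapping.single (Poly_Mapping.single i 1) 1"

definition substitute :: "(nat \<Rightarrow> 'a mpoly) \<Rightarrow> 'a mpoly \<Rightarrow> 'a::comm_ring_1 mpoly" where
  "substitute \<sigma> p = (\<Sum>m\<in>Poly_Mapping.keys p.
     Const (Poly_Mapping.lookup p m) *
     (\<Prod>i\<in>Poly_Mapping.keys m. \<sigma> i ^ Poly_Mapping.lookup m i))"

definition polynomials_in :: "nat \<Rightarrow> 'a::zero mpoly set" where
  "polynomials_in N = {p. \<forall>m\<in>Poly_Mapping.keys p. Poly_Mapping.keys m \<subseteq> {1..N}}"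

definition degree_le :: "nat \<Rightarrow> 'a::zero mpoly \<Rightarrow> bool" where
  "degree_le d p \<longleftrightarrow>
    (\<forall>m\<in>Poly_Mapping.keys p. (\<Sum>i\<in>Poly_Mapping.keys m. Poly_Mapping.lookup m i) \<le> d)"

definition symmetric_polys :: "nat \<Rightarrow> 'a::comm_ring_1 mpoly set" where
  "symmetric_polys N = {p \<in> polynomials_in N.
     \<forall>\<pi>. \<pi> permutes {1..N} \<longrightarrow> substitute (\<lambda>i. Var (\<pi> i)) p = p}"

definition unshift :: "nat \<Rightarrow> nat \<Rightarrow> 'a::comm_ring_1 mpoly" where
  "unshift N i = Var i + of_nat (N - i)"

definition shifted_symmetric_polys :: "nat \<Rightarrow> 'a::comm_ring_1 mpoly set" where
  "shifted_symmetric_polys N = substitute (unshift N) ` symmetric_polys N"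

section \<open>The algebras of symmetric and shifted symmetric functions\<close>

text \<open>An element is the sequence of its specializations to \<open>N\<close> variables, with the pointwise
  operations of \<^theory>\<open>HOL-Library.Function_Algebras\<close>. Sequences start at \<open>N = 0\<close>; the term at 0
  is a constant determined by the term at 1, so nothing is added to sequences that start at 1.\<close>

type_synonym 'a mpoly_seq = "nat \<Rightarrow> 'a mpoly"

definition stable_sequences :: "(nat \<Rightarrow> 'a::comm_ring_1 mpoly set) \<Rightarrow> 'a mpoly_seq set" where
  "stable_sequences P = {f.
     (\<forall>N. f N \<in> P N) \<and>
     (\<forall>N. substitute (Var(Suc N := 0)) (f (Suc N)) = f N) \<and>
     (\<exists>d. \<forall>N. degree_le d (f N))}"

definition Sym :: "'a::comm_ring_1 mpoly_seq set" where
  "Sym = stable_sequences symmetric_polys"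

definition Sym_star :: "'a::comm_ring_1 mpoly_seq set" where
  "Sym_star = stable_sequences shifted_symmetric_polys"

definition scale :: "'a \<Rightarrow> 'a mpoly_seq \<Rightarrow> 'a::comm_ring_1 mpoly_seq" where
  "scale c f = (\<lambda>N. Const c * f N)"

definition power_sum :: "nat \<Rightarrow> 'a::comm_ring_1 mpoly_seq" where
  "power_sum k = (\<lambda>N. \<Sum>i=1..N. Var i ^ k)"

text \<open>The terms of \<open>p\<^sub>k\<^sup>*\<close> with \<open>i > N\<close> vanish when \<open>y\<^sub>i = 0\<close> for \<open>i > N\<close>.\<close>

definition power_sum_star :: "nat \<Rightarrow> 'a::field_char_0 mpoly_seq" where
  "power_sum_star k = (\<lambda>N. \<Sum>i=1..N.
     (Var i - of_nat i + Const (1/2)) ^ k - (- of_nat i + Const (1/2)) ^ k)"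

definition algebra_iso ::
  "'a mpoly_seq set \<Rightarrow> 'a mpoly_seq set \<Rightarrow> ('a mpoly_seq \<Rightarrow> 'a::comm_ring_1 mpoly_seq) \<Rightarrow> bool"
where
  "algebra_iso A B \<Phi> \<longleftrightarrow>
     bij_betw \<Phi> A B \<and> \<Phi> 1 = 1 \<and>
     (\<forall>f\<in>A. \<forall>g\<in>A. \<Phi> (f + g) = \<Phi> f + \<Phi> g \<and> \<Phi> (f * g) = \<Phi> f * \<Phi> g) \<and>
     (\<forall>c. \<forall>f\<in>A. \<Phi> (scale c f) = scale c (\<Phi> f))"

text \<open>Such an isomorphism is unique on \<open>Sym_star\<close> because the \<open>p\<^sub>k\<^sup>*\<close> generate. The coefficient
  field is arbitrary: over the complex numbers this is the complexification of the
  isomorphism over the reals.\<close>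

definition star_iso :: "'a mpoly_seq \<Rightarrow> 'a::field_char_0 mpoly_seq" where
  "star_iso = (SOME \<Phi>. algebra_iso Sym_star Sym \<Phi> \<and>
                 (\<forall>k\<ge>1. \<Phi> (power_sum_star k) = power_sum k))"

section \<open>Schur and Frobenius--Schur functions\<close>

text \<open>Quotient of polynomials for exact division; unique when \<open>b \<noteq> 0\<close> and the coefficients form
  an integral domain.\<close>

definition exact_quotient :: "'a mpoly \<Rightarrow> 'a mpoly \<Rightarrow> 'a::idom mpoly" where
  "exact_quotient a b = (THE q. a = q * b)"

definition vandermonde :: "nat \<Rightarrow> 'a::comm_ring_1 mpoly" where
  "vandermonde N = (\<Prod>(i, j)\<in>{(i, j). 1 \<le> i \<and> i < j \<and> j \<le> N}. Var i - Var j)"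

definition falling_power :: "'a::comm_ring_1 \<Rightarrow> nat \<Rightarrow> 'a" where
  "falling_power x n = (\<Prod>k<n. x - of_nat k)"

text \<open>The bialternant \<open>det[h(x\<^sub>j, \<nu>\<^sub>i + N - i)] / \<Prod>\<^bsub>i<j\<^esub>(x\<^sub>i - x\<^sub>j)\<close>. Matrix
  indices of the library start at 0, whence the successors.\<close>

definition bialternant ::
  "('a mpoly \<Rightarrow> nat \<Rightarrow> 'a mpoly) \<Rightarrow> nat list \<Rightarrow> nat \<Rightarrow> 'a::idom mpoly" where
  "bialternant h \<nu> N =
    (if length \<nu> \<le> N
     then exact_quotient
       (det (mat N N (\<lambda>(i, j). h (Var (Suc j)) (row \<nu> (Suc i) + N - Suc i))))
       (vandermonde N)
     else 0)"

definition schur :: "nat list \<Rightarrow> 'a::idom mpoly_seq" where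
  "schur \<nu> = bialternant (\<lambda>x n. x ^ n) \<nu>"

definition factorial_schur :: "nat list \<Rightarrow> nat \<Rightarrow> 'a::idom mpoly" where
  "factorial_schur \<nu> N = bialternant falling_power \<nu> N"

definition shifted_schur :: "nat list \<Rightarrow> 'a::idom mpoly_seq" where
  "shifted_schur \<nu> = (\<lambda>N. substitute (unshift N) (factorial_schur \<nu> N))"

definition frobenius_schur :: "nat list \<Rightarrow> 'a::field_char_0 mpoly_seq" where
  "frobenius_schur \<nu> = star_iso (shifted_schur \<nu>)"

section \<open>Laguerre and Meixner symmetric functions\<close>

definition laguerre :: "complex \<Rightarrow> complex \<Rightarrow> nat list \<Rightarrow> complex mpoly_seq" where
  "laguerre z z' \<nu> = (\<Sum>\<mu>\<in>subpartitions \<nu>.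
     scale ((-1) ^ (sum_list \<nu> - sum_list \<mu>)
            * (of_nat (skew_dim \<nu> \<mu>) / fact (sum_list \<nu> - sum_list \<mu>))
            * skew_pochhammer z \<nu> \<mu> * skew_pochhammer z' \<nu> \<mu>)
       (schur \<mu>))"

definition meixner :: "complex \<Rightarrow> complex \<Rightarrow> complex \<Rightarrow> nat list \<Rightarrow> complex mpoly_seq" where
  "meixner z z' \<xi> \<nu> = (\<Sum>\<mu>\<in>subpartitions \<nu>.
     scale ((-1) ^ (sum_list \<nu> - sum_list \<mu>)
            * (\<xi> / (1 - \<xi>)) ^ (sum_list \<nu> - sum_list \<mu>)
            * (of_nat (skew_dim \<nu> \<mu>) / fact (sum_list \<nu> - sum_list \<mu>))
            * skew_pochhammer z \<nu> \<mu> * skew_pochhammer z' \<nu> \<mu>)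
       (frobenius_schur \<mu>))"

text \<open>\<open>\<phi>\<close> is the linear functional on \<open>Sym\<close> over the complex numbers with
  \<open>\<phi>(F\<^sub>\<nu>) = \<delta>\<^bsub>\<nu>\<emptyset>\<^esub>\<close>, where \<open>(F\<^sub>\<nu>)\<close> is a basis; values outside \<open>Sym\<close> are irrelevant.\<close>

definition formal_moment_functional ::
  "(nat list \<Rightarrow> complex mpoly_seq) \<Rightarrow> (complex mpoly_seq \<Rightarrow> complex) \<Rightarrow> bool" where
  "formal_moment_functional F \<phi> \<longleftrightarrow>
     (\<forall>f\<in>Sym. \<forall>g\<in>Sym. \<phi> (f + g) = \<phi> f + \<phi> g) \<and>
     (\<forall>c. \<forall>f\<in>Sym. \<phi> (scale c f) = c * \<phi> f) \<and>
     (\<forall>\<nu>\<in>partitions. \<phi> (F \<nu>) = (if \<nu> = [] then 1 else 0))"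

end

theory Submission
  imports Defs
begin

text \<open>Both identities are instances of one statement with parameters \<open>s\<close> and \<open>\<eta>\<close>: the ordinary powers are
  replaced by the step powers \<open>x (x - s) \<cdots> (x - (n - 1) s)\<close>, and \<open>\<eta>\<close> takes the place of \<open>\<xi> / (1 - \<xi>)\<close>.
  The Laguerre case is \<open>s = 0\<close>, \<open>\<eta> = 1\<close>; the Meixner case is \<open>s = 1\<close>, transported along the
  isomorphism of \<open>Sym_star\<close> with \<open>Sym\<close>. If \<open>z = N\<close> and \<open>z' = N + c - 1\<close>, specialization to \<open>N\<close>
  variables turns the family into \<open>det[\<ell>\<^bsub>\<nu>\<^sub>i+N-i\<^esub>(x\<^sub>j)] / \<Prod>\<^bsub>i<j\<^esub>(x\<^sub>i - x\<^sub>j)\<close> with monic orthogonal polynomials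
  \<open>\<ell>\<^sub>n\<close> in one variable, and orthogonality follows by expanding the determinants. The structure
  constants of the Schur basis do not depend on \<open>z, z', \<eta>\<close>, so the quantity in question is polynomial in
  these parameters and the general case follows by interpolation.\<close>


text \<open>For general complex parameters no measure represents \<phi>; all that is known of it is
  a unitriangular system for its values on the (shifted) Schur basis. Forward substitution in that
  system needs no division, so the values are polynomials in the parameters, and every functional
  satisfying the equations at other parameters takes the values of the same polynomials there. At z
  = N the functional of an orthogonal polynomial ensemble in N variables satisfies the equations for
  partitions with at most N rows. A product of two basis elements involves finitely many partitions,
  so all large N qualify. The choice z = N comes from the contents: z + content of the box ending
  row i is then the exponent of that row, so the weight vanishes at exponent 0 and the lowering
  stops there. The norms carry the factor \<eta> (\<eta> + s) of the three-term recurrence: 1 for s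
  = 0, \<eta> = 1, and \<xi> / (1 - \<xi>)^2 for s = 1, \<eta> = \<xi> / (1 - \<xi>). Since
  \<open>star_iso\<close> is only chosen, its existence must be proved too; this rests on
  triangularity of the products of power sums.\<close>

abbreviation "lookup \<equiv> Poly_Mapping.lookup"
abbreviation "keys \<equiv> Poly_Mapping.keys"
abbreviation "single \<equiv> Poly_Mapping.single"

section \<open>Polynomials and substitution\<close>

lemma Const_0 [simp]: "Const 0 = 0" and Const_1 [simp]: "Const 1 = 1"
  by (simp_all add: Const_def)

lemma Const_add: "Const (a + b) = Const a + Const b"
  by (simp add: Const_def single_add)

lemma Const_diff: "Const (a - b) = Const a - Const (b::'a::ab_group_add)"
  by (simp add: Const_def single_diff)

lemma Const_uminus: "Const (- a) = - Const (a::'a::ab_group_add)"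
  by (simp add: Const_def single_uminus)

lemma Const_mult: "Const (a * b) = Const a * Const (b::'a::comm_ring_1)"
  by (simp add: Const_def mult_single)

lemma Const_power: "Const (a ^ n) = Const (a::'a::comm_ring_1) ^ n"
  by (induction n) (simp_all add: Const_mult)

lemma Const_sum: "Const (sum f A) = (\<Sum>a\<in>A. Const (f a :: 'a::comm_ring_1))"
  by (induction A rule: infinite_finite_induct) (simp_all add: Const_add)

lemma Const_of_nat: "Const (of_nat n) = (of_nat n :: 'a::comm_ring_1 mpoly)"
  by (simp add: Const_def)

lemma Const_inject [simp]: "Const a = Const b \<longleftrightarrow> a = b"
  by (metis Const_def lookup_single_eq)

lemma Const_eq_0_iff [simp]: "Const a = 0 \<longleftrightarrow> a = 0"
  using Const_inject[of a 0] by simp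

lemma lookup_Const_mult [simp]: "lookup (Const c * p) m = c * lookup (p::'a::comm_ring_1 mpoly) m"
  unfolding Const_def mult_map_scale_conv_mult[symmetric] by (simp add: Poly_Mapping.map.rep_eq when_def)

lemma mpoly_expand: "(p::'a::comm_ring_1 mpoly) = (\<Sum>m\<in>keys p. single m (lookup p m))"
  by (rule poly_mapping_eqI)
    (simp add: lookup_sum lookup_single when_def in_keys_iff)

lemma exponent_expand: "(m::nat \<Rightarrow>\<^sub>0 nat) = (\<Sum>i\<in>keys m. single i (lookup m i))"
  by (rule poly_mapping_eqI)
    (simp add: lookup_sum lookup_single when_def in_keys_iff)

lemma Var_power: "Var i ^ n = (single (single i n) 1 :: 'a::comm_ring_1 mpoly)"
  by (induction n) (simp_all add: Var_def mult_single single_add[symmetric])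

lemma prod_single: "(\<Prod>i\<in>A. single (f i) (g i)) = (single (\<Sum>i\<in>A. f i) (\<Prod>i\<in>A. g i) :: 'a::comm_ring_1 mpoly)"
  by (induction A rule: infinite_finite_induct) (simp_all add: mult_single)

lemma single_eq_prod: "single m c = Const c * (\<Prod>i\<in>keys m. Var i ^ lookup m i :: 'a::comm_ring_1 mpoly)"
proof -
  have "(\<Prod>i\<in>keys m. Var i ^ lookup m i) = (single m 1 :: 'a mpoly)"
    by (simp add: Var_power prod_single exponent_expand[symmetric])
  then show ?thesis by (simp add: Const_def mult_single)
qed

text \<open>Arbitrary index sets are allowed because several occur: \<open>{1..N}\<close> for the
  actual variables, \<open>{1..}\<close> for polynomials in the power sums, \<open>{0}\<close> for
  one-variable templates that are renamed later.\<close>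

definition vars_in :: "nat set \<Rightarrow> 'a::zero mpoly \<Rightarrow> bool" where
  "vars_in X p \<longleftrightarrow> (\<forall>m\<in>keys p. keys m \<subseteq> X)"

lemma polynomials_in_iff: "p \<in> polynomials_in N \<longleftrightarrow> vars_in {1..N} p"
  by (simp add: polynomials_in_def vars_in_def)

lemma vars_in_UNIV [simp]: "vars_in UNIV p"
  by (simp add: vars_in_def)

lemma vars_in_Const [simp]: "vars_in X (Const c)"
  by (simp add: vars_in_def Const_def)

lemma vars_in_0 [simp]: "vars_in X 0" and vars_in_1 [simp]: "vars_in X (1::'a::comm_ring_1 mpoly)"
  using vars_in_Const[of X 0] vars_in_Const[of X "1::'a"] by simp_all

lemma vars_in_Var [simp]: "i \<in> X \<Longrightarrow> vars_in X (Var i)"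
  by (simp add: vars_in_def Var_def)

lemma vars_in_add [intro]: "vars_in X p \<Longrightarrow> vars_in X q \<Longrightarrow> vars_in X (p + q)"
  using keys_add[of p q] by (fastforce simp: vars_in_def)

lemma keys_uminus: "keys (- p) = keys (p::'a::comm_ring_1 mpoly)"
  by (auto simp: in_keys_iff)

lemma vars_in_diff [intro]:
  "vars_in X p \<Longrightarrow> vars_in X q \<Longrightarrow> vars_in X (p - q :: 'a::comm_ring_1 mpoly)"
  using vars_in_add[of X p "- q"] by (simp add: vars_in_def keys_uminus)

lemma keys_add_exponent: "keys (m + n :: nat \<Rightarrow>\<^sub>0 nat) = keys m \<union> keys n"
  by (auto simp: in_keys_iff lookup_add)

lemma vars_in_mult [intro]:
  "vars_in X p \<Longrightarrow> vars_in X q \<Longrightarrow> vars_in X (p * q :: 'a::comm_ring_1 mpoly)"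
  using keys_mult[of p q] by (fastforce simp: vars_in_def keys_add_exponent)

lemma vars_in_sum: "(\<And>a. a \<in> A \<Longrightarrow> vars_in X (f a)) \<Longrightarrow> vars_in X (sum f A)"
  by (induction A rule: infinite_finite_induct) auto

lemma vars_in_prod:
  "(\<And>a. a \<in> A \<Longrightarrow> vars_in X (f a)) \<Longrightarrow> vars_in X (prod f A :: 'a::comm_ring_1 mpoly)"
  by (induction A rule: infinite_finite_induct) auto

lemma vars_in_power: "vars_in X p \<Longrightarrow> vars_in X (p ^ n :: 'a::comm_ring_1 mpoly)"
  by (induction n) auto

text \<open>Each monomial is a constant times a product of variables from \<open>X\<close>.
  Identities between ring homomorphisms then need checking only on constants and variables.\<close>

lemma mpoly_induct [consumes 1, case_names Const Var add mult]:
  fixes p :: "'a::comm_ring_1 mpoly"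
  assumes "vars_in X p"
    and C: "\<And>c. P (Const c)" and V: "\<And>i. i \<in> X \<Longrightarrow> P (Var i)"
    and A: "\<And>p q. P p \<Longrightarrow> P q \<Longrightarrow> P (p + q)" and M: "\<And>p q. P p \<Longrightarrow> P q \<Longrightarrow> P (p * q)"
  shows "P p"
proof -
  have 1: "P 1" "P 0" using C[of 1] C[of 0] by simp_all
  have pow: "P (q ^ n)" if "P q" for q n
    by (induction n) (simp_all add: 1 M that)
  have prod: "P (prod f B)" if "\<And>b. b \<in> B \<Longrightarrow> P (f b)" for f :: "nat \<Rightarrow> 'a mpoly" and B
    using that by (induction B rule: infinite_finite_induct) (auto simp: 1 intro: M)
  have sum: "P (sum f B)" if "\<And>b. b \<in> B \<Longrightarrow> P (f b)" for f :: "(nat \<Rightarrow>\<^sub>0 nat) \<Rightarrow> 'a mpoly" and B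
    using that by (induction B rule: infinite_finite_induct) (auto simp: 1 intro: A)
  have "P (single m c)" if "keys m \<subseteq> X" for m c
    unfolding single_eq_prod using that by (intro M C prod pow V) auto
  then show ?thesis
    using assms(1) by (subst mpoly_expand, intro sum) (auto simp: vars_in_def)
qed

section \<open>Substitution as a ring homomorphism\<close>

lemma substitute_add: "substitute \<sigma> (p + q) = substitute \<sigma> p + substitute \<sigma> q"
  unfolding substitute_def
  by (rule setsum_keys_plus_distrib) (simp_all add: Const_add distrib_right)

lemma substitute_single:
  "substitute \<sigma> (single m c) = Const c * (\<Prod>i\<in>keys m. \<sigma> i ^ lookup m i)"
  by (cases "c = 0") (simp_all add: substitute_def)

lemma substitute_0 [simp]: "substitute \<sigma> 0 = 0"
  by (simp add: substitute_def)

lemma substitute_Const [simp]: "substitute \<sigma> (Const c) = Const c"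
  by (simp add: Const_def[of c] substitute_single)

lemma substitute_1 [simp]: "substitute \<sigma> 1 = 1"
  using substitute_Const[of \<sigma> 1] by simp

lemma substitute_Var [simp]: "substitute \<sigma> (Var i) = \<sigma> i"
  by (simp add: Var_def substitute_single)

lemma substitute_sum: "substitute \<sigma> (sum f A) = (\<Sum>a\<in>A. substitute \<sigma> (f a))"
  by (induction A rule: infinite_finite_induct) (simp_all add: substitute_add)

lemma substitute_mult: "substitute \<sigma> (p * q) = substitute \<sigma> p * substitute \<sigma> q"
proof -
  have ss: "substitute \<sigma> (single m a * single n b) = substitute \<sigma> (single m a) * substitute \<sigma> (single n b)"
    for m n a b
  proof -
    let ?K = "keys m \<union> keys n"
    \<comment> \<open>A variable absent from an exponent contributes a zeroth power, so all three
      products may run over the common set \<open>?K\<close>.\<close>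
    have ext: "(\<Prod>i\<in>keys k. \<sigma> i ^ lookup k i) = (\<Prod>i\<in>?K. \<sigma> i ^ lookup k i)" if "keys k \<subseteq> ?K" for k
      using that by (intro prod.mono_neutral_left) (auto simp: in_keys_iff)
    have "(\<Prod>i\<in>keys (m + n). \<sigma> i ^ lookup (m + n) i)
        = (\<Prod>i\<in>keys m. \<sigma> i ^ lookup m i) * (\<Prod>i\<in>keys n. \<sigma> i ^ lookup n i)"
      by (simp add: ext keys_add_exponent lookup_add power_add prod.distrib)
    then show ?thesis
      by (simp add: mult_single substitute_single Const_mult mult_ac)
  qed
  have "substitute \<sigma> (p * q) = substitute \<sigma> ((\<Sum>m\<in>keys p. single m (lookup p m)) * (\<Sum>n\<in>keys q. single n (lookup q n)))"
    by (simp flip: mpoly_expand)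
  also have "\<dots> = (\<Sum>m\<in>keys p. substitute \<sigma> (single m (lookup p m))) * (\<Sum>n\<in>keys q. substitute \<sigma> (single n (lookup q n)))"
    by (simp only: sum_product substitute_sum ss)
  also have "\<dots> = substitute \<sigma> p * substitute \<sigma> q"
    by (simp flip: substitute_sum mpoly_expand)
  finally show ?thesis .
qed

lemma substitute_uminus: "substitute \<sigma> (- p) = - substitute \<sigma> p"
  by (metis add_eq_0_iff substitute_0 substitute_add add.right_inverse)

lemma substitute_diff: "substitute \<sigma> (p - q) = substitute \<sigma> p - substitute \<sigma> q"
  using substitute_add[of \<sigma> p "- q"] by (simp add: substitute_uminus)

lemma substitute_prod: "substitute \<sigma> (prod f A) = (\<Prod>a\<in>A. substitute \<sigma> (f a))"
  by (induction A rule: infinite_finite_induct) (simp_all add: substitute_mult)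

lemma substitute_power: "substitute \<sigma> (p ^ n) = substitute \<sigma> p ^ n"
  by (induction n) (simp_all add: substitute_mult)

lemmas substitute_simps = substitute_add substitute_diff substitute_uminus substitute_mult
  substitute_sum substitute_prod substitute_power

lemma comm_ring_hom_substitute: "comm_ring_hom (substitute \<sigma>)"
  by unfold_locales (simp_all add: substitute_simps)

lemma substitute_cong:
  assumes "vars_in X p" "\<And>i. i \<in> X \<Longrightarrow> \<sigma> i = \<tau> i"
  shows "substitute \<sigma> p = substitute \<tau> p"
  using assms(1) by (induction rule: mpoly_induct) (simp_all add: substitute_simps assms(2))

lemma substitute_substitute:
  "substitute \<tau> (substitute \<sigma> p) = substitute (\<lambda>i. substitute \<tau> (\<sigma> i)) p"
  using vars_in_UNIV[of p] by (induction rule: mpoly_induct) (simp_all add: substitute_simps)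

lemma substitute_Var_id [simp]: "substitute Var p = p"
  using vars_in_UNIV[of p] by (induction rule: mpoly_induct) (simp_all add: substitute_simps)

lemma vars_in_substitute:
  assumes "vars_in X p" "\<And>i. i \<in> X \<Longrightarrow> vars_in Y (\<sigma> i)"
  shows "vars_in Y (substitute \<sigma> p)"
  using assms(1) by (induction rule: mpoly_induct) (auto simp: substitute_simps assms(2))

lemma Var_eq_iff [simp]: "Var i = (Var j :: 'a::comm_ring_1 mpoly) \<longleftrightarrow> i = j"
proof
  assume "Var i = (Var j :: 'a mpoly)"
  then have "single i (1::nat) = single j 1"
    by (metis Var_def keys_single singleton_inject zero_neq_one)
  then show "i = j" by (metis keys_single singleton_inject zero_neq_one)
qed simp

lemma Var_neq_Const [simp]: "Var i \<noteq> (Const c :: 'a::comm_ring_1 mpoly)"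
proof
  assume "Var i = (Const c :: 'a mpoly)"
  from arg_cong[OF this, of "substitute (\<lambda>_. 0)"] arg_cong[OF this, of "substitute (\<lambda>_. 1)"]
  show False by simp
qed

subsection \<open>Degrees\<close>

definition mdeg :: "(nat \<Rightarrow>\<^sub>0 nat) \<Rightarrow> nat" where
  "mdeg m = (\<Sum>i\<in>keys m. lookup m i)"

lemma mdeg_superset: "finite X \<Longrightarrow> keys m \<subseteq> X \<Longrightarrow> mdeg m = (\<Sum>i\<in>X. lookup m i)"
  unfolding mdeg_def by (intro sum.mono_neutral_left) (auto simp: in_keys_iff)

lemma mdeg_0 [simp]: "mdeg 0 = 0"
  by (simp add: mdeg_def)

lemma mdeg_single [simp]: "mdeg (single i n) = n"
  by (cases "n = 0") (simp_all add: mdeg_def)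

lemma mdeg_add: "mdeg (m + n) = mdeg m + mdeg n"
  by (simp add: mdeg_superset[of "keys m \<union> keys n"] keys_add_exponent lookup_add sum.distrib)

lemma mdeg_sum: "mdeg (sum f A) = (\<Sum>a\<in>A. mdeg (f a))"
  by (induction A rule: infinite_finite_induct) (simp_all add: mdeg_add)

lemma mdeg_eq_0_iff [simp]: "mdeg m = 0 \<longleftrightarrow> m = 0"
  by (auto simp: mdeg_def in_keys_iff intro: poly_mapping_eqI)

text \<open>The bound is strict so that \<open>degree_lt 0\<close> singles out the zero polynomial;
  an induction on the degree can then end at 0 rather than at the constants.\<close>

definition degree_lt :: "nat \<Rightarrow> 'a::zero mpoly \<Rightarrow> bool" where
  "degree_lt d p \<longleftrightarrow> (\<forall>m\<in>keys p. mdeg m < d)"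

lemma degree_le_iff: "degree_le d p \<longleftrightarrow> degree_lt (Suc d) p"
  by (simp add: degree_le_def degree_lt_def mdeg_def less_Suc_eq_le)

lemma degree_lt_iff: "degree_lt d p \<longleftrightarrow> (\<forall>m. mdeg m \<ge> d \<longrightarrow> lookup p m = 0)"
  by (force simp: degree_lt_def in_keys_iff not_le)

lemma degree_lt_mono: "degree_lt d p \<Longrightarrow> d \<le> d' \<Longrightarrow> degree_lt d' p"
  by (fastforce simp: degree_lt_def)

lemma degree_lt_zero [simp]: "degree_lt d 0"
  by (simp add: degree_lt_def)

lemma degree_lt_0 [simp]: "degree_lt 0 p \<longleftrightarrow> p = 0"
  by (auto simp: degree_lt_iff intro: poly_mapping_eqI)

lemma degree_lt_add: "degree_lt d p \<Longrightarrow> degree_lt d q \<Longrightarrow> degree_lt d (p + q)"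
  by (auto simp: degree_lt_iff lookup_add)

lemma degree_lt_diff:
  "degree_lt d p \<Longrightarrow> degree_lt d q \<Longrightarrow> degree_lt d (p - q :: 'a::comm_ring_1 mpoly)"
  by (auto simp: degree_lt_iff lookup_minus)

lemma degree_lt_sum: "(\<And>a. a \<in> A \<Longrightarrow> degree_lt d (f a)) \<Longrightarrow> degree_lt d (sum f A)"
  by (induction A rule: infinite_finite_induct) (auto intro: degree_lt_add)

lemma degree_lt_Const_mult: "degree_lt d p \<Longrightarrow> degree_lt d (Const c * p :: 'a::comm_ring_1 mpoly)"
  by (simp add: degree_lt_iff)

lemma degree_lt_Const: "0 < d \<Longrightarrow> degree_lt d (Const c)"
  by (simp add: degree_lt_def Const_def)

lemma degree_lt_Var: "1 < d \<Longrightarrow> degree_lt d (Var i)"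
  by (simp add: degree_lt_def Var_def)

lemma degree_lt_mult:
  assumes "degree_lt d p" "degree_lt d' q"
  shows "degree_lt (d + d' - 1) (p * q :: 'a::comm_ring_1 mpoly)"
  using assms keys_mult[of p q] by (fastforce simp: degree_lt_def mdeg_add)

lemma degree_lt_mult_Suc:
  "degree_lt d p \<Longrightarrow> degree_lt (Suc d') q \<Longrightarrow> degree_lt (d + d') (p * q :: 'a::comm_ring_1 mpoly)"
  "degree_lt (Suc d) p \<Longrightarrow> degree_lt d' q \<Longrightarrow> degree_lt (d + d') (p * q)"
  using degree_lt_mult[of d p "Suc d'" q] degree_lt_mult[of "Suc d" p d' q] by simp_all

lemma degree_lt_prod:
  "(\<And>a. a \<in> A \<Longrightarrow> degree_lt (Suc (d a)) (f a)) \<Longrightarrow>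
   degree_lt (Suc (\<Sum>a\<in>A. d a)) (\<Prod>a\<in>A. f a :: 'a::comm_ring_1 mpoly)"
proof (induction A rule: infinite_finite_induct)
  case (insert a A)
  then show ?case using degree_lt_mult[of "Suc (d a)" "f a" "Suc (sum d A)" "prod f A"]
    by simp
qed (simp_all add: degree_lt_Const flip: Const_1)

lemma degree_lt_power:
  "degree_lt (Suc d) p \<Longrightarrow> degree_lt (Suc (d * n)) (p ^ n :: 'a::comm_ring_1 mpoly)"
  using degree_lt_prod[of "{..<n}" "\<lambda>_. d" "\<lambda>_. p"] by (simp add: mult.commute)

text \<open>Telescoping: replacing the factors \<open>f a\<close> by \<open>g a\<close> one at a
  time costs only terms below the total degree. This is the source of the facts that shifts of
  variables leave top components unchanged.\<close>

lemma degree_lt_prod_diff: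
  fixes f g :: "'b \<Rightarrow> 'a::comm_ring_1 mpoly"
  assumes "\<And>a. a \<in> A \<Longrightarrow> degree_lt (Suc (d a)) (f a)"
    and "\<And>a. a \<in> A \<Longrightarrow> degree_lt (d a) (f a - g a)"
  shows "degree_lt (\<Sum>a\<in>A. d a) ((\<Prod>a\<in>A. f a) - (\<Prod>a\<in>A. g a))"
  using assms
proof (induction A rule: infinite_finite_induct)
  case (insert a A)
  have g: "degree_lt (Suc (d b)) (g b)" if "b \<in> insert a A" for b
    using degree_lt_diff[OF insert.prems(1)[OF that] degree_lt_mono[OF insert.prems(2)[OF that]]] by simp
  have eq: "prod f (insert a A) - prod g (insert a A)
      = f a * (prod f A - prod g A) + (f a - g a) * prod g A"
    using insert.hyps by (simp add: algebra_simps)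
  show ?case unfolding eq sum.insert[OF insert.hyps]
    by (intro degree_lt_add degree_lt_mult_Suc degree_lt_prod insert g) auto
qed simp_all

text \<open>By additivity the claim reduces to monomials, where every power of a variable changes
  only in degrees below its exponent.\<close>

lemma degree_lt_substitute_shift_diff:
  fixes p :: "'a::comm_ring_1 mpoly"
  assumes p: "degree_lt (Suc d) p"
  shows "degree_lt d (substitute (\<lambda>i. Var i + Const (c i)) p - p)"
proof -
  have *: "degree_lt (mdeg m) (substitute (\<lambda>i. Var i + Const (c i)) (single m a) - single m a)" for m a
  proof -
    have pow: "degree_lt n ((Var i + Const (c i)) ^ n - Var i ^ n)" for i n
      using degree_lt_prod_diff[of "{..<n}" "\<lambda>_. 1" "\<lambda>_. Var i + Const (c i)" "\<lambda>_. Var i"]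
      by (simp add: degree_lt_add degree_lt_Var degree_lt_Const)
    have deg: "degree_lt (Suc n) ((Var i + Const (c i)) ^ n)" for i n
      using degree_lt_power[of 1 "Var i + Const (c i)" n]
      by (simp add: degree_lt_add degree_lt_Var degree_lt_Const)
    show ?thesis
      unfolding single_eq_prod[of m a] mdeg_def substitute_mult substitute_prod substitute_power
        substitute_Const substitute_Var right_diff_distrib[symmetric]
      by (intro degree_lt_Const_mult degree_lt_prod_diff pow deg)
  qed
  have "substitute (\<lambda>i. Var i + Const (c i)) p - p
      = (\<Sum>m\<in>keys p. substitute (\<lambda>i. Var i + Const (c i)) (single m (lookup p m)) - single m (lookup p m))"
    by (simp add: sum_subtractf flip: substitute_sum mpoly_expand)
  also have "degree_lt d \<dots>"
    using p by (intro degree_lt_sum degree_lt_mono[OF *]) (auto simp: degree_lt_def less_Suc_eq_le)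
  finally show ?thesis .
qed

lemma degree_lt_substitute_shift:
  fixes p :: "'a::comm_ring_1 mpoly"
  assumes p: "degree_lt d p"
  shows "degree_lt d (substitute (\<lambda>i. Var i + Const (c i)) p)"
proof -
  have "degree_lt d (substitute (\<lambda>i. Var i + Const (c i)) p - p)"
    by (rule degree_lt_substitute_shift_diff) (rule degree_lt_mono[OF p], simp)
  from degree_lt_add[OF this p] show ?thesis by simp
qed

subsection \<open>Leading monomials\<close>

text \<open>The grading makes shifts of variables harmless, as they alter lower degrees only. Within
  a degree the library order compares at the smallest index where the exponents differ, so
  \<open>Var i\<close> outranks \<open>Var j\<close> for i < j.\<close>

definition grlex_less :: "(nat \<Rightarrow>\<^sub>0 nat) \<Rightarrow> (nat \<Rightarrow>\<^sub>0 nat) \<Rightarrow> bool" where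
  "grlex_less m n \<longleftrightarrow> mdeg m < mdeg n \<or> mdeg m = mdeg n \<and> m < n"

lemma grlex_less_trans: "grlex_less a b \<Longrightarrow> grlex_less b c \<Longrightarrow> grlex_less a c"
  by (auto simp: grlex_less_def)

lemma grlex_less_irrefl [simp]: "\<not> grlex_less a a"
  by (simp add: grlex_less_def)

lemma grlex_less_linear: "grlex_less a b \<or> a = b \<or> grlex_less b a"
  by (auto simp: grlex_less_def)

lemma grlex_less_add: "grlex_less a b \<Longrightarrow> grlex_less (a + c) (b + c)"
  by (auto simp: grlex_less_def mdeg_add)

lemma grlex_less_add':
  assumes "grlex_less a b \<or> a = b" "grlex_less c d \<or> c = d" "a \<noteq> b \<or> c \<noteq> d"
  shows "grlex_less (a + c) (b + d)"
  using assms grlex_less_add[of a b c] grlex_less_add[of c d b] grlex_less_trans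
  by (metis add.commute)

definition lead :: "'a::zero mpoly \<Rightarrow> (nat \<Rightarrow>\<^sub>0 nat) \<Rightarrow> 'a \<Rightarrow> bool" where
  "lead p m c \<longleftrightarrow> lookup p m = c \<and> c \<noteq> 0 \<and> (\<forall>n\<in>keys p. n = m \<or> grlex_less n m)"

lemma lead_unique: "lead p m c \<Longrightarrow> lead p n d \<Longrightarrow> m = n \<and> c = d"
  unfolding lead_def by (metis grlex_less_irrefl grlex_less_trans in_keys_iff)

lemma lead_exists:
  assumes "p \<noteq> 0"
  obtains m c where "lead p m c"
proof -
  have "\<exists>m\<in>A. \<forall>n\<in>A. n = m \<or> grlex_less n m" if "finite A" "A \<noteq> {}" for A
    using that
  proof (induction rule: finite_ne_induct)
    case (insert x F)
    then obtain m where "m \<in> F" "\<forall>n\<in>F. n = m \<or> grlex_less n m" by blast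
    then show ?case
      using grlex_less_linear[of x m] grlex_less_trans[of _ m x] by (metis insert_iff)
  qed auto
  moreover have "keys p \<noteq> {}" using assms by (auto intro: poly_mapping_eqI simp: in_keys_iff)
  ultimately obtain m where "m \<in> keys p" "\<forall>n\<in>keys p. n = m \<or> grlex_less n m"
    by (metis finite_keys)
  then have "lead p m (lookup p m)" by (simp add: lead_def in_keys_iff)
  then show thesis by (rule that)
qed

lemma lead_Const: "c \<noteq> 0 \<Longrightarrow> lead (Const c) 0 c"
  by (simp add: lead_def Const_def)

lemma lead_Var: "lead (Var i) (single i 1) (1::'a::comm_ring_1)"
  by (simp add: lead_def Var_def)

lemma lead_add:
  assumes "lead p m c" "\<And>n. n \<in> keys q \<Longrightarrow> grlex_less n m"
  shows "lead (p + q) m (c::'a::comm_ring_1)"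
proof -
  have "m \<notin> keys q" using assms(2) grlex_less_irrefl by blast
  then have "lookup (p + q) m = c"
    using assms(1) by (simp add: lead_def lookup_add in_keys_iff)
  then show ?thesis
    using assms keys_add[of p q] unfolding lead_def by blast
qed

text \<open>The order is compatible with addition, so among all pairs of exponents only the two
  leading ones add up to \<open>m + n\<close>; in an integral domain their coefficients cannot
  cancel.\<close>

lemma lead_mult:
  fixes p q :: "'a::idom mpoly"
  assumes p: "lead p m a" and q: "lead q n b"
  shows "lead (p * q) (m + n) (a * b)"
proof -
  have less: "grlex_less (k + l) (m + n)"
    if "k \<in> keys p" "l \<in> keys q" "k \<noteq> m \<or> l \<noteq> n" for k l
    using p q that by (intro grlex_less_add') (auto simp: lead_def)
  have "p * q = (\<Sum>k\<in>keys p. \<Sum>l\<in>keys q. single (k + l) (lookup p k * lookup q l))"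
    by (subst mpoly_expand[of p], subst mpoly_expand[of q]) (simp add: sum_product mult_single)
  then have "lookup (p * q) (m + n)
      = (\<Sum>k\<in>keys p. \<Sum>l\<in>keys q. lookup (single (k + l) (lookup p k * lookup q l)) (m + n))"
    by (simp only: lookup_sum)
  also have "\<dots> = (\<Sum>k\<in>keys p. \<Sum>l\<in>keys q. if k = m then if l = n then a * b else 0 else 0)"
  proof (intro sum.cong refl)
    fix k l assume kl: "k \<in> keys p" "l \<in> keys q"
    show "lookup (single (k + l) (lookup p k * lookup q l)) (m + n)
        = (if k = m then if l = n then a * b else 0 else 0)"
    proof (cases "k = m \<and> l = n")
      case True
      then show ?thesis using p q by (simp add: lead_def)
    next
      case False
      then have "k + l \<noteq> m + n" using less[OF kl] by (metis grlex_less_irrefl)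
      then show ?thesis using False by (auto simp: lookup_single when_def)
    qed
  qed
  also have "\<dots> = (\<Sum>k\<in>keys p. if k = m then (\<Sum>l\<in>keys q. if l = n then a * b else 0) else 0)"
    by (intro sum.cong) simp_all
  also have "\<dots> = a * b"
    using p q by (auto simp: lead_def in_keys_iff)
  finally have "lookup (p * q) (m + n) = a * b" .
  moreover have "k = m + n \<or> grlex_less k (m + n)" if "k \<in> keys (p * q)" for k
    using that keys_mult[of p q] less by fastforce
  moreover have "a * b \<noteq> 0" using p q by (simp add: lead_def)
  ultimately show ?thesis unfolding lead_def by blast
qed

lemma lead_1: "lead (1::'a::comm_ring_1 mpoly) 0 1"
  using lead_Const[of "1::'a"] by simp

lemma lead_prod:
  fixes c :: "'b \<Rightarrow> 'a::idom"
  assumes "\<And>a. a \<in> A \<Longrightarrow> lead (f a) (m a) (c a)"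
  shows "lead (\<Prod>a\<in>A. f a) (\<Sum>a\<in>A. m a) (\<Prod>a\<in>A. c a)"
  using assms by (induction A rule: infinite_finite_induct) (simp_all add: lead_1 lead_mult)

lemma degree_lt_iff_lead:
  assumes "lead p m c"
  shows "degree_lt d p \<longleftrightarrow> mdeg m < d"
proof -
  have "m \<in> keys p" "\<And>n. n \<in> keys p \<Longrightarrow> mdeg n \<le> mdeg m"
    using assms by (auto simp: lead_def grlex_less_def in_keys_iff)
  then show ?thesis unfolding degree_lt_def by (metis le_less_trans)
qed

text \<open>The shift adds only terms of degree below \<open>mdeg m\<close>, and these are smaller
  in a graded order.\<close>

lemma lead_substitute_shift:
  assumes "lead p m (c::'a::comm_ring_1)"
  shows "lead (substitute (\<lambda>i. Var i + Const (a i)) p) m c"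
proof -
  let ?q = "substitute (\<lambda>i. Var i + Const (a i)) p - p"
  have "degree_lt (mdeg m) ?q"
    using assms by (intro degree_lt_substitute_shift_diff) (simp add: degree_lt_iff_lead)
  then have "lead (p + ?q) m c"
    by (intro lead_add assms) (auto simp: degree_lt_def grlex_less_def)
  then show ?thesis by simp
qed


section \<open>Alternants\<close>

text \<open>The parameter \<open>s\<close> interpolates between the ordinary powers and symmetric polynomials
  (\<open>s = 0\<close>) and the falling powers and shifted symmetric polynomials (\<open>s = 1\<close>).\<close>

definition step_power :: "'a::comm_ring_1 \<Rightarrow> 'a mpoly \<Rightarrow> nat \<Rightarrow> 'a mpoly" where
  "step_power s x n = (\<Prod>k<n. x - Const (of_nat k * s))"

definition shift_var :: "'a::comm_ring_1 \<Rightarrow> nat \<Rightarrow> nat \<Rightarrow> 'a mpoly" where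
  "shift_var s N i = Var i + Const (of_nat (N - i) * s)"

definition alternant :: "'a::comm_ring_1 \<Rightarrow> nat \<Rightarrow> (nat \<Rightarrow> nat) \<Rightarrow> 'a mpoly" where
  "alternant s N n = det (mat N N (\<lambda>(i, j). step_power s (Var (Suc j)) (n i)))"

lemma step_power_0: "step_power 0 = (\<lambda>x n. x ^ n)"
  by (simp add: step_power_def fun_eq_iff)

lemma step_power_1: "step_power 1 = falling_power"
  by (simp add: step_power_def falling_power_def fun_eq_iff Const_of_nat)

lemma shift_var_0: "shift_var 0 N = Var"
  by (simp add: shift_var_def fun_eq_iff)

lemma shift_var_1: "shift_var 1 N = unshift N"
  by (simp add: shift_var_def unshift_def fun_eq_iff Const_of_nat)

lemma substitute_step_power: "substitute \<sigma> (step_power s x n) = step_power s (substitute \<sigma> x) n"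
  by (simp add: step_power_def substitute_simps)

lemma vars_in_step_power: "vars_in X x \<Longrightarrow> vars_in X (step_power s x n)"
  by (auto simp: step_power_def intro!: vars_in_prod)

lemma step_power_zero: "step_power s 0 n = (if n = 0 then 1 else 0)"
proof (cases n)
  case (Suc k)
  have "step_power s 0 n = 0"
    unfolding step_power_def by (rule prod_zero) (auto simp: Suc intro!: bexI[of _ 0])
  then show ?thesis by (simp add: Suc)
qed (simp add: step_power_def)

text \<open>The roots of a step power are spaced by \<open>s\<close>, so moving the argument by
  \<open>s\<close> leaves one extra linear factor. In the passage from N + 1 to N variables this is
  the factor pulled out of each column.\<close>

lemma step_power_shift: "step_power s (x + Const s) (Suc n) = (x + Const s) * step_power s x n"
proof -
  have "x + Const s - Const (of_nat (Suc k) * s) = x - Const (of_nat k * s)" for k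
    by (simp add: Const_add distrib_right)
  then show ?thesis unfolding step_power_def prod.lessThan_Suc_shift by (simp only:) simp
qed

lemma sum_single_one: "(\<Sum>a\<in>A. single i 1) = single i (card A)"
  by (induction A rule: infinite_finite_induct) (simp_all del: sum_constant flip: single_add)

lemma lead_step_power_Var: "lead (step_power s (Var i) n) (single i n) (1::'a::idom)"
proof -
  have "lead (Var i + - Const (of_nat k * s)) (single i 1) 1" for k
    by (rule lead_add[OF lead_Var]) (auto simp: grlex_less_def Const_def simp flip: single_uminus split: if_splits)
  then have "lead (Var i - Const (of_nat k * s)) (single i 1) 1" for k by simp
  from lead_prod[of "{..<n}", OF this]
  have "lead (step_power s (Var i) n) (\<Sum>k<n. single i 1) 1" by (simp add: step_power_def)
  moreover have "(\<Sum>k<n. single i 1) = single i n" by (simp only: sum_single_one card_lessThan)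
  ultimately show ?thesis by simp
qed

subsection \<open>Divisibility by the Vandermonde product\<close>

text \<open>A factor theorem proved without division: the polynomials with this property contain
  constants and variables and are closed under sums and products.\<close>

lemma dvd_diff_substitute:
  fixes p :: "'a::comm_ring_1 mpoly"
  shows "(Var i - Var j) dvd (p - substitute (Var(i := Var j)) p)"
  using vars_in_UNIV[of p]
proof (induction rule: mpoly_induct)
  case (add p q)
  from dvd_add[OF add.IH] show ?case by (simp add: substitute_add algebra_simps)
next
  case (mult p q)
  let ?S = "substitute (Var(i := Var j))"
  have "p * q - ?S (p * q) = (p - ?S p) * q + ?S p * (q - ?S q)"
    by (simp add: substitute_mult algebra_simps)
  then show ?case using mult.IH by (metis dvd_add dvd_mult dvd_mult2)
qed auto

text \<open>Differences are split off one at a time. Vanishing at x_i = x_j passes to the quotient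
  by the differences already split off, because none of these vanishes there.\<close>

lemma dvd_prod_differences:
  fixes f :: "'a::idom mpoly"
  assumes "finite S" "\<And>i j. (i, j) \<in> S \<Longrightarrow> i < j"
    and "\<And>i j. (i, j) \<in> S \<Longrightarrow> substitute (Var(i := Var j)) f = 0"
  shows "(\<Prod>(i, j)\<in>S. Var i - Var j) dvd f"
  using assms
proof (induction S)
  case (insert b S)
  obtain i j where b: "b = (i, j)" by force
  let ?S = "substitute (Var(i := Var j :: 'a mpoly))"
  have "(\<Prod>(i, j)\<in>S. Var i - Var j) dvd f" by (intro insert.IH insert.prems) auto
  then obtain q where q: "f = (\<Prod>(i, j)\<in>S. Var i - Var j) * q" by (elim dvdE)
  \<comment> \<open>Only the pair (i, j) or its reversal collapses under the substitution; the
    reversal is excluded by i < j and k < l.\<close>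
  have ne: "?S (Var k - Var l) \<noteq> 0" if kl: "(k, l) \<in> S" for k l
  proof -
    have "i < j" "k < l" "(k, l) \<noteq> (i, j)" using insert.prems insert.hyps b kl by auto
    then show ?thesis by (auto simp: substitute_diff)
  qed
  have "?S f = 0" by (rule insert.prems(2)) (simp add: b)
  moreover have "?S f = (\<Prod>(k, l)\<in>S. ?S (Var k - Var l)) * ?S q"
    by (simp add: q substitute_simps case_prod_unfold)
  moreover have "(\<Prod>(k, l)\<in>S. ?S (Var k - Var l)) \<noteq> 0"
    using ne insert.hyps(1) by (auto simp: case_prod_unfold simp del: substitute_Var)
  ultimately have "?S q = 0" by simp
  then have "(Var i - Var j) dvd q" using dvd_diff_substitute[of i j q] by simp
  then show ?case using insert.hyps by (auto simp: b q mult.commute intro: mult_dvd_mono)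
qed simp

lemma finite_vandermonde_pairs: "finite {(i, j). 1 \<le> i \<and> i < j \<and> j \<le> (N::nat)}"
  by (rule finite_subset[of _ "{1..N} \<times> {1..N}"]) auto

lemma vandermonde_dvdI:
  fixes f :: "'a::idom mpoly"
  assumes "\<And>i j. 1 \<le> i \<Longrightarrow> i < j \<Longrightarrow> j \<le> N \<Longrightarrow> substitute (Var(i := Var j)) f = 0"
  shows "vandermonde N dvd f"
  unfolding vandermonde_def by (rule dvd_prod_differences[OF finite_vandermonde_pairs]) (auto intro: assms)

lemma vandermonde_nonzero [simp]: "vandermonde N \<noteq> (0::'a::idom mpoly)"
  unfolding vandermonde_def prod_zero_iff[OF finite_vandermonde_pairs] by auto

lemma det_mat_hom:
  "substitute \<sigma> (det (mat N N A)) = det (mat N N (\<lambda>(i, j). substitute \<sigma> (A (i, j))))"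
proof -
  interpret comm_ring_hom "substitute \<sigma>" by (rule comm_ring_hom_substitute)
  have "map_mat (substitute \<sigma>) (mat N N A) = mat N N (\<lambda>(i, j). substitute \<sigma> (A (i, j)))"
    by (rule eq_matI) auto
  then show ?thesis using hom_det[of "mat N N A"] by simp
qed

lemma substitute_alternant:
  "substitute \<sigma> (alternant s N n) = det (mat N N (\<lambda>(i, j). step_power s (\<sigma> (Suc j)) (n i)))"
  by (simp add: alternant_def det_mat_hom substitute_step_power case_prod_unfold)

lemma det_mat_transpose: "det (mat N N (\<lambda>(i, j). A j i)) = det (mat N N (\<lambda>(i, j). A i j))"
proof -
  have "mat N N (\<lambda>(i, j). A j i) = transpose_mat (mat N N (\<lambda>(i, j). A i j))"
    by (rule eq_matI) auto
  then show ?thesis using det_transpose[of "mat N N (\<lambda>(i, j). A i j)" N] by simp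
qed

lemma det_mat_Leibniz_columns:
  "det (mat N N (\<lambda>(i, j). A i j)) = (\<Sum>p | p permutes {0..<N}. signof p * (\<Prod>j<N. A (p j) j))"
proof -
  have "(\<Prod>j<N. mat N N (\<lambda>(i, j). A i j) $$ (p j, j)) = (\<Prod>j<N. A (p j) j)" if "p permutes {0..<N}" for p
    using permutes_in_image[OF that] by (intro prod.cong) auto
  then show ?thesis by (subst det_col[of _ N]) auto
qed

text \<open>Equating two variables makes two columns equal; the transposed matrix then has two
  identical rows.\<close>

lemma alternant_dvd: "vandermonde N dvd (alternant s N n :: 'a::idom mpoly)"
proof (rule vandermonde_dvdI)
  fix i j assume ij: "1 \<le> i" "i < j" "j \<le> N"
  let ?\<sigma> = "Var(i := Var j)"
  have "det (mat N N (\<lambda>(k, l). step_power s (?\<sigma> (Suc k)) (n l))) = 0"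
    by (rule det_identical_rows[of _ N "i - 1" "j - 1"]) (use ij in \<open>auto intro!: eq_vecI\<close>)
  then show "substitute ?\<sigma> (alternant s N n) = 0"
    unfolding substitute_alternant by (subst det_mat_transpose[symmetric])
qed

lemma exact_quotient_mult:
  assumes "b dvd a" "b \<noteq> 0"
  shows "exact_quotient a b * b = a"
proof -
  obtain q where "a = q * b" using assms(1) by (metis dvdE mult.commute)
  then have "exact_quotient a b = q"
    unfolding exact_quotient_def using assms(2) by (intro the_equality) auto
  then show ?thesis by (simp add: \<open>a = q * b\<close>)
qed

text \<open>These are the strictly decreasing numbers \<nu>_i + N - i, with i counted from 0 in the
  code. For \<open>i < N\<close> the truncated subtraction is exact.\<close>

definition strict_exponents :: "nat list \<Rightarrow> nat \<Rightarrow> nat \<Rightarrow> nat" where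
  "strict_exponents \<nu> N i = Defs.row \<nu> (Suc i) + N - Suc i"

text \<open>From here on the quotient is handled through this product, with the definite description
  inside \<open>exact_quotient\<close> no longer in sight.\<close>

lemma bialternant_mult_vandermonde:
  assumes "length \<nu> \<le> N"
  shows "bialternant (step_power s) \<nu> N * vandermonde N = alternant s N (strict_exponents \<nu> N)"
  using assms exact_quotient_mult[OF alternant_dvd vandermonde_nonzero]
  by (simp add: bialternant_def alternant_def strict_exponents_def)

subsection \<open>Permutation of the variables\<close>

text \<open>The sign depends on \<pi> alone and not on \<open>s\<close> or \<open>n\<close>;
  numerator and denominator of a bialternant therefore acquire the same sign.\<close>

lemma alternant_permute:
  assumes "\<pi> permutes {1..N}"
  obtains \<epsilon> :: "'a::comm_ring_1 mpoly" where "\<epsilon> = 1 \<or> \<epsilon> = -1"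
    "\<And>s n. substitute (\<lambda>i. Var (\<pi> i)) (alternant s N n) = \<epsilon> * alternant s N n"
proof
  \<comment> \<open>\<rho> is \<pi> transported to the matrix indices, which start at 0.\<close>
  define \<rho> where "\<rho> i = (if i < N then \<pi> (Suc i) - 1 else i)" for i
  have S: "\<rho> i < N \<and> Suc (\<rho> i) = \<pi> (Suc i)" if "i < N" for i
    using permutes_in_image[OF assms, of "Suc i"] that by (auto simp: \<rho>_def)
  have "inj_on \<rho> {0..<N}"
    by (rule inj_onI) (metis S assms atLeastLessThan_iff nat.inject permutes_inj inj_eq)
  moreover have "\<rho> ` {0..<N} = {0..<N}"
    using calculation by (rule endo_inj_surj[rotated 2]) (use S in auto)
  ultimately have "bij_betw \<rho> {0..<N} {0..<N}" by (simp add: bij_betw_def)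
  then have \<rho>: "\<rho> permutes {0..<N}"
    by (rule bij_imp_permutes) (simp add: \<rho>_def)
  show "signof \<rho> = (1 :: 'a mpoly) \<or> signof \<rho> = (-1 :: 'a mpoly)"
    by (simp add: sign_def)
  fix s :: 'a and n :: "nat \<Rightarrow> nat"
  let ?A = "\<lambda>i j. step_power s (Var (Suc i)) (n j)"
  have "substitute (\<lambda>i. Var (\<pi> i)) (alternant s N n)
      = det (mat N N (\<lambda>(i, j). step_power s (Var (\<pi> (Suc i))) (n j)))"
    unfolding substitute_alternant by (subst det_mat_transpose[symmetric]) simp
  also have "mat N N (\<lambda>(i, j). step_power s (Var (\<pi> (Suc i))) (n j))
      = mat N N (\<lambda>(i, j). mat N N (\<lambda>(i, j). ?A i j) $$ (\<rho> i, j))"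
    by (rule eq_matI) (simp_all add: S)
  also have "det \<dots> = signof \<rho> * det (mat N N (\<lambda>(i, j). ?A i j))"
    by (rule det_permute_rows) (simp_all add: \<rho>)
  also have "det (mat N N (\<lambda>(i, j). ?A i j)) = alternant s N n"
    unfolding alternant_def by (subst det_mat_transpose[symmetric]) simp
  finally show "substitute (\<lambda>i. Var (\<pi> i)) (alternant s N n) = signof \<rho> * alternant s N n" .
qed

section \<open>Leading monomials of alternants and of the Vandermonde product\<close>

lemma alternant_Leibniz:
  "alternant s N n
    = (\<Sum>p | p permutes {0..<N}. signof p * (\<Prod>j<N. step_power s (Var (Suc j)) (n (p j))))"
  unfolding alternant_def by (rule det_mat_Leibniz_columns)

lemma lookup_exponent_sum:
  "lookup (\<Sum>i<N. single (Suc i) (n i)) k = (if 1 \<le> k \<and> k \<le> N then n (k - 1) else 0)"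
proof (cases k)
  case (Suc l)
  have "lookup (\<Sum>i<N. single (Suc i) (n i)) (Suc l) = (\<Sum>i<N. if i = l then n i else 0)"
    by (simp add: lookup_sum lookup_single when_def)
  then show ?thesis by (simp add: Suc less_eq_Suc_le)
qed (simp add: lookup_sum lookup_single when_def)

text \<open>The degrees agree. At the first position \<open>k\<close> moved by \<open>p\<close> all
  smaller positions are fixed, so \<open>p k\<close> exceeds \<open>k\<close> and the exponent there
  drops.\<close>

lemma grlex_less_permute:
  assumes n: "\<And>i j. i < j \<Longrightarrow> j < N \<Longrightarrow> n j < n i"
    and p: "p permutes {0..<N}" "p \<noteq> id"
  shows "grlex_less (\<Sum>i<N. single (Suc i) (n (p i))) (\<Sum>i<N. single (Suc i) (n i))"
proof -
  have "(\<Sum>i<N. n (p i)) = (\<Sum>i<N. n i)"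
    using sum.permute[OF p(1), of n] by (simp add: atLeast0LessThan o_def)
  then have "mdeg (\<Sum>i<N. single (Suc i) (n (p i))) = mdeg (\<Sum>i<N. single (Suc i) (n i))"
    by (simp add: mdeg_sum)
  moreover have "(\<Sum>i<N. single (Suc i) (n (p i))) < (\<Sum>i<N. single (Suc i) (n i))"
  proof -
    have "\<exists>k. p k \<noteq> k" using p(2) by auto
    define k where "k = (LEAST k. p k \<noteq> k)"
    have k: "p k \<noteq> k" unfolding k_def by (rule LeastI_ex) fact
    have j: "p j = j" if "j < k" for j using not_less_Least[of j "\<lambda>k. p k \<noteq> k"] that by (auto simp: k_def)
    have "k < N" using k p(1) by (metis permutes_not_in atLeastLessThan_iff le0)
    have "p k < N" using permutes_in_image[OF p(1), of k] \<open>k < N\<close> by simp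
    have "\<not> p k < k" using j k p(1) by (metis permutes_inj inj_eq)
    then have "n (p k) < n k" using k \<open>p k < N\<close> by (intro n) auto
    then show ?thesis
      unfolding less_poly_mapping.rep_eq less_fun_def lookup_exponent_sum
      using \<open>k < N\<close> j by (intro exI[of _ "Suc k"]) auto
  qed
  ultimately show ?thesis by (simp add: grlex_less_def)
qed

text \<open>In the Leibniz expansion the identity permutation contributes the largest monomial, and
  every other summand stays strictly below it.\<close>

lemma lead_alternant:
  assumes n: "\<And>i j. i < j \<Longrightarrow> j < N \<Longrightarrow> n j < n i"
  shows "lead (alternant s N n) (\<Sum>i<N. single (Suc i) (n i)) (1::'a::idom)"
proof -
  let ?P = "{p. p permutes {0..<N}}"
  let ?t = "\<lambda>p. \<Prod>j<N. step_power s (Var (Suc j)) (n (p j)) :: 'a mpoly"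
  let ?m = "\<lambda>p. \<Sum>i<N. single (Suc i) (n (p i))"
  have lead: "lead (?t p) (?m p) 1" for p
    using lead_prod[of "{..<N}" "\<lambda>j. step_power s (Var (Suc j)) (n (p j))" _ "\<lambda>_. 1", OF lead_step_power_Var]
    by simp
  have "grlex_less m (?m id)" if m: "m \<in> keys (\<Sum>p\<in>?P - {id}. signof p * ?t p)" for m
  proof -
    obtain p where p: "p permutes {0..<N}" "p \<noteq> id" "m \<in> keys (signof p * ?t p)"
      using m keys_sum[of "\<lambda>p. signof p * ?t p"] by blast
    then have "m \<in> keys (?t p)" by (auto simp: sign_def keys_uminus split: if_splits)
    then have "m = ?m p \<or> grlex_less m (?m p)" using lead[of p] by (auto simp: lead_def)
    moreover have "grlex_less (?m p) (?m id)"
      using grlex_less_permute[of N n p] n p(1,2) by simp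
    ultimately show ?thesis using grlex_less_trans by blast
  qed
  then have "lead (?t id + (\<Sum>p\<in>?P - {id}. signof p * ?t p)) (?m id) 1"
    by (intro lead_add lead)
  moreover have "alternant s N n = ?t id + (\<Sum>p\<in>?P - {id}. signof p * ?t p)"
    unfolding alternant_Leibniz
    by (subst sum.remove[of _ id]) (simp_all add: finite_permutations permutes_id)
  ultimately show ?thesis by simp
qed

lemma vars_in_det_mat:
  assumes "\<And>i j. i < N \<Longrightarrow> j < N \<Longrightarrow> vars_in X (A (i, j))"
  shows "vars_in X (det (mat N N A) :: 'a::comm_ring_1 mpoly)"
proof -
  have "vars_in X (signof p * (\<Prod>i = 0..<N. mat N N A $$ (i, p i)))" if "p permutes {0..<N}" for p
  proof (intro vars_in_mult vars_in_prod)
    have "signof p = (Const (signof p) :: 'a mpoly)"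
      by (simp add: sign_def Const_uminus)
    then show "vars_in X (signof p :: 'a mpoly)" by simp
    show "vars_in X (mat N N A $$ (i, p i))" if i: "i \<in> {0..<N}" for i
      using assms i permutes_in_image[OF \<open>p permutes {0..<N}\<close>, of i] by simp
  qed
  then show ?thesis
    unfolding det_def'[OF mat_carrier] by (intro vars_in_sum) simp
qed

lemma vars_in_alternant: "vars_in {1..N} (alternant s N n)"
  unfolding alternant_def by (intro vars_in_det_mat) (auto intro!: vars_in_step_power vars_in_Var)

lemma vandermonde_Sigma: "vandermonde N = (\<Prod>i\<in>{1..N}. \<Prod>j\<in>{i<..N}. Var i - Var j)"
proof -
  have "{(i, j). 1 \<le> i \<and> i < j \<and> j \<le> N} = Sigma {1..N} (\<lambda>i. {i<..N})" by auto
  then show ?thesis by (simp add: vandermonde_def prod.Sigma)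
qed

lemma vars_in_vandermonde: "vars_in {1..N} (vandermonde N :: 'a::comm_ring_1 mpoly)"
  unfolding vandermonde_Sigma by (intro vars_in_prod vars_in_diff vars_in_Var) auto

lemma vandermonde_Suc:
  "vandermonde (Suc N) = vandermonde N * (\<Prod>i\<in>{1..N}. Var i - Var (Suc N))"
proof -
  have "(\<Prod>j\<in>{i<..Suc N}. Var i - Var j) = (\<Prod>j\<in>{i<..N}. Var i - Var j) * (Var i - Var (Suc N) :: 'a mpoly)"
    if "i \<in> {1..N}" for i
  proof -
    have "{i<..Suc N} = insert (Suc N) {i<..N}" using that by auto
    then show ?thesis by (simp add: mult.commute)
  qed
  then show ?thesis by (simp add: vandermonde_Sigma prod.distrib)
qed

text \<open>A difference of variables is led by the one with the smaller index, and index i is the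
  smaller one in N - i pairs.\<close>

lemma lead_vandermonde:
  "lead (vandermonde N :: 'a::idom mpoly) (\<Sum>i<N. single (Suc i) (N - Suc i)) 1"
proof -
  have less: "grlex_less (single j 1) (single i 1)" if "i < j" for i j :: nat
    using that by (auto simp: grlex_less_def less_poly_mapping.rep_eq less_fun_def lookup_single when_def
        intro!: exI[of _ i])
  have "lead (Var i + - Var j :: 'a mpoly) (single i 1) 1" if "i < j" for i j
    using less[OF that] by (intro lead_add lead_Var) (simp add: Var_def keys_uminus)
  then have "lead (vandermonde N :: 'a mpoly) (\<Sum>i\<in>{1..N}. \<Sum>j\<in>{i<..N}. single i 1) (\<Prod>i\<in>{1..N}. \<Prod>j\<in>{i<..N}. 1)"
    unfolding vandermonde_Sigma by (intro lead_prod) auto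
  moreover have "(\<Sum>i\<in>{1..N}. \<Sum>j\<in>{i<..N}. single i (1::nat)) = (\<Sum>i<N. single (Suc i) (N - Suc i))"
  proof -
    have "(\<Sum>i\<in>{1..N}. single i (N - i)) = (\<Sum>i<N. single (Suc i) (N - Suc i))"
      by (simp add: sum.atLeast1_atMost_eq)
    then show ?thesis by (simp only: sum_single_one card_greaterThanAtMost)
  qed
  ultimately show ?thesis by simp
qed

text \<open>Both sides are led by the same monomial with coefficient 1, so their quotient has degree
  0 and equals 1. In particular the Vandermonde product is an alternant for every \<open>s\<close>
  and shares the sign rule of alternants.\<close>

lemma alternant_eq_vandermonde: "alternant s N (\<lambda>i. N - Suc i) = (vandermonde N :: 'a::idom mpoly)"
proof -
  obtain q where q: "alternant s N (\<lambda>i. N - Suc i) = vandermonde N * q"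
    by (metis alternant_dvd dvdE)
  have lead: "lead (alternant s N (\<lambda>i. N - Suc i)) (\<Sum>i<N. single (Suc i) (N - Suc i)) (1::'a)"
    by (rule lead_alternant) auto
  then have "q \<noteq> 0" by (auto simp: q lead_def)
  then obtain m c where "lead q m c" by (rule lead_exists)
  from lead_unique[OF lead_mult[OF lead_vandermonde this] lead[unfolded q]] \<open>lead q m c\<close> have "lead q 0 1"
    by simp
  then have "degree_lt 1 q" by (simp add: degree_lt_iff_lead)
  have "q = 1"
  proof (rule poly_mapping_eqI)
    fix m show "lookup q m = lookup 1 m"
    proof (cases "m = 0")
      case True
      with \<open>lead q 0 1\<close> show ?thesis by (simp add: lead_def)
    next
      case False
      then have "mdeg m \<ge> 1" by (metis mdeg_eq_0_iff less_one not_le)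
      with \<open>degree_lt 1 q\<close> False show ?thesis by (simp add: degree_lt_iff lookup_one)
    qed
  qed
  then show ?thesis by (simp add: q)
qed

subsection \<open>Interpolating Schur functions\<close>

definition partition_exponent :: "nat list \<Rightarrow> nat \<Rightarrow>\<^sub>0 nat" where
  "partition_exponent \<nu> = (\<Sum>i<length \<nu>. single (Suc i) (\<nu> ! i))"

lemma lookup_partition_exponent: "lookup (partition_exponent \<nu>) i = Defs.row \<nu> i"
  by (auto simp: partition_exponent_def lookup_exponent_sum row_def)

lemma mdeg_partition_exponent: "mdeg (partition_exponent \<nu>) = sum_list \<nu>"
  by (simp add: partition_exponent_def mdeg_sum sum_list_sum_nth atLeast0LessThan)

lemma keys_partition_exponent: "keys (partition_exponent \<nu>) \<subseteq> {1..length \<nu>}"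
  by (auto simp: in_keys_iff lookup_partition_exponent row_def split: if_splits)

lemma row_antimono: "\<nu> \<in> partitions \<Longrightarrow> 1 \<le> i \<Longrightarrow> i \<le> j \<Longrightarrow> Defs.row \<nu> j \<le> Defs.row \<nu> i"
  by (cases "i = j") (auto simp: partitions_def row_def sorted_wrt_iff_nth_less)

lemma row_eq_0_iff: "\<nu> \<in> partitions \<Longrightarrow> 1 \<le> i \<Longrightarrow> Defs.row \<nu> i = 0 \<longleftrightarrow> length \<nu> < i"
proof (cases "i \<le> length \<nu>")
  case True
  assume "\<nu> \<in> partitions" "1 \<le> i"
  then have "\<nu> ! (i - 1) \<in> set \<nu>" "0 \<notin> set \<nu>" using True by (simp_all add: partitions_def)
  then have "\<nu> ! (i - 1) \<noteq> 0" by metis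
  then show ?thesis using True \<open>1 \<le> i\<close> by (simp add: row_def)
qed (simp add: row_def)

lemma partition_eqI:
  assumes "\<mu> \<in> partitions" "\<nu> \<in> partitions" "\<And>i. 1 \<le> i \<Longrightarrow> Defs.row \<mu> i = Defs.row \<nu> i"
  shows "\<mu> = \<nu>"
proof (rule nth_equalityI)
  have "length \<kappa> < Suc (length \<tau>)"
    if "\<kappa> \<in> partitions" "\<tau> \<in> partitions" "\<And>i. 1 \<le> i \<Longrightarrow> Defs.row \<kappa> i = Defs.row \<tau> i" for \<kappa> \<tau>
    using row_eq_0_iff[OF that(2), of "Suc (length \<tau>)"] row_eq_0_iff[OF that(1), of "Suc (length \<tau>)"]
      that(3)[of "Suc (length \<tau>)"] by simp
  from this[of \<mu> \<nu>] this[of \<nu> \<mu>] show len: "length \<mu> = length \<nu>"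
    using assms by simp
  show "\<mu> ! i = \<nu> ! i" if "i < length \<mu>" for i
    using assms(3)[of "Suc i"] that len by (simp add: row_def)
qed

lemma partition_exponent_inject:
  "\<mu> \<in> partitions \<Longrightarrow> \<nu> \<in> partitions \<Longrightarrow> partition_exponent \<mu> = partition_exponent \<nu> \<Longrightarrow> \<mu> = \<nu>"
  by (rule partition_eqI) (simp_all add: lookup_partition_exponent[symmetric])

lemma strict_exponents_decreasing:
  assumes "\<nu> \<in> partitions" "i < j" "j < N"
  shows "strict_exponents \<nu> N j < strict_exponents \<nu> N i"
  using row_antimono[of \<nu> "Suc i" "Suc j"] assms by (simp add: strict_exponents_def)

lemma lead_bialternant:
  assumes "\<nu> \<in> partitions" "length \<nu> \<le> N"
  shows "lead (bialternant (step_power s) \<nu> N) (partition_exponent \<nu>) (1::'a::idom)"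
proof -
  let ?q = "bialternant (step_power s) \<nu> N :: 'a mpoly"
  let ?\<delta> = "\<Sum>i<N. single (Suc i) (N - Suc i)"
  have "(\<Sum>i<N. single (Suc i) (strict_exponents \<nu> N i)) = partition_exponent \<nu> + ?\<delta>"
    by (rule poly_mapping_eqI)
      (use assms(2) in \<open>auto simp: lookup_add lookup_exponent_sum lookup_partition_exponent strict_exponents_def row_def\<close>)
  then have lead: "lead (?q * vandermonde N) (partition_exponent \<nu> + ?\<delta>) 1"
    using lead_alternant[of N "strict_exponents \<nu> N" s] strict_exponents_decreasing[OF assms(1)]
    by (simp add: bialternant_mult_vandermonde[OF assms(2)])
  then have "?q \<noteq> 0" by (auto simp: lead_def)
  then obtain m c where "lead ?q m c" by (rule lead_exists)
  from lead_unique[OF lead_mult[OF this lead_vandermonde] lead] \<open>lead ?q m c\<close> show ?thesis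
    by simp
qed

lemma bialternant_symmetric: "bialternant (step_power s) \<nu> N \<in> (symmetric_polys N :: 'a::idom mpoly set)"
proof (cases "length \<nu> \<le> N")
  case True
  let ?q = "bialternant (step_power s) \<nu> N :: 'a mpoly"
  note qV = bialternant_mult_vandermonde[OF True, of s]
  \<comment> \<open>\<sigma> kills all variables outside 1, ..., N. It fixes the numerator and the
    denominator, hence also the quotient, which therefore contains no other variable.\<close>
  define \<sigma> where "\<sigma> i = (if i \<in> {1..N} then Var i else (0 :: 'a mpoly))" for i
  have id: "substitute \<sigma> p = p" if "vars_in {1..N} p" for p
    using substitute_cong[OF that, of \<sigma> Var] by (simp add: \<sigma>_def)
  have "substitute \<sigma> (?q * vandermonde N) = ?q * vandermonde N"
    unfolding qV by (rule id[OF vars_in_alternant])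
  then have "substitute \<sigma> ?q * vandermonde N = ?q * vandermonde N"
    by (simp only: substitute_mult id[OF vars_in_vandermonde])
  then have "substitute \<sigma> ?q = ?q" by simp
  moreover have "vars_in {1..N} (substitute \<sigma> ?q)"
    by (rule vars_in_substitute[OF vars_in_UNIV]) (simp add: \<sigma>_def)
  ultimately have "?q \<in> polynomials_in N" by (simp add: polynomials_in_iff)
  moreover have "substitute (\<lambda>i. Var (\<pi> i)) ?q = ?q" if \<pi>: "\<pi> permutes {1..N}" for \<pi>
  proof -
    let ?P = "substitute (\<lambda>i. Var (\<pi> i)) :: 'a mpoly \<Rightarrow> _"
    obtain \<epsilon> :: "'a mpoly" where \<epsilon>: "\<epsilon> = 1 \<or> \<epsilon> = -1" "\<And>s n. ?P (alternant s N n) = \<epsilon> * alternant s N n"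
      using alternant_permute[OF \<pi>] by metis
    \<comment> \<open>Numerator and denominator change by the same sign \<epsilon>, which
      cancels.\<close>
    have "?P ?q * (\<epsilon> * vandermonde N) = \<epsilon> * (?q * vandermonde N)"
      using arg_cong[OF qV, of ?P] qV
      by (simp add: substitute_mult \<epsilon>(2) flip: alternant_eq_vandermonde[of s])
    then show ?thesis using \<epsilon>(1) by auto
  qed
  ultimately show ?thesis by (simp add: symmetric_polys_def)
qed (simp add: bialternant_def symmetric_polys_def polynomials_in_def)

definition step_schur :: "'a::idom \<Rightarrow> nat list \<Rightarrow> 'a mpoly_seq" where
  "step_schur s \<nu> = (\<lambda>N. substitute (shift_var s N) (bialternant (step_power s) \<nu> N))"

lemma step_schur_0: "step_schur 0 \<nu> = schur \<nu>"
  by (simp add: step_schur_def schur_def shift_var_0 step_power_0)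

lemma step_schur_1: "step_schur 1 \<nu> = shifted_schur \<nu>"
  by (simp add: step_schur_def shifted_schur_def factorial_schur_def shift_var_1 step_power_1)

lemma lead_step_schur:
  assumes "\<nu> \<in> partitions" "length \<nu> \<le> N"
  shows "lead (step_schur s \<nu> N) (partition_exponent \<nu>) 1"
  unfolding step_schur_def shift_var_def by (intro lead_substitute_shift lead_bialternant assms)

lemma substitute_shift_var_inverse:
  "substitute (\<lambda>i. Var i - Const (of_nat (N - i) * s)) (substitute (shift_var s N) p) = p"
  "substitute (shift_var s N) (substitute (\<lambda>i. Var i - Const (of_nat (N - i) * s)) p) = p"
  by (simp_all add: substitute_substitute shift_var_def substitute_simps)

lemma substitute_shift_var_eq_iff [simp]:
  "substitute (shift_var s N) p = substitute (shift_var s N) q \<longleftrightarrow> p = q"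
proof
  assume "substitute (shift_var s N) p = substitute (shift_var s N) q"
  from arg_cong[OF this, of "substitute (\<lambda>i. Var i - Const (of_nat (N - i) * s))"]
  show "p = q" by (simp only: substitute_shift_var_inverse)
qed simp

lemma det_mat_scale_columns:
  "det (mat N N (\<lambda>(i, j). c j * A i j)) = (\<Prod>j<N. c j) * det (mat N N (\<lambda>(i, j). A i j))"
  unfolding det_mat_Leibniz_columns sum_distrib_left by (simp only: prod.distrib mult.left_commute)

text \<open>Setting the last variable to 0 turns the last column into step powers of 0, which vanish
  unless the exponent is 0. That happens only in the last row, when row N + 1 of \<nu> is empty. The
  remaining minor is the alternant in N variables with column j multiplied by
  \<open>\<sigma> (Suc j)\<close>, and the Vandermonde product acquires exactly the same
  factors.\<close>

lemma step_schur_stable: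
  fixes s :: "'a::idom"
  assumes \<nu>: "\<nu> \<in> partitions"
  shows "substitute (Var(Suc N := 0)) (step_schur s \<nu> (Suc N)) = step_schur s \<nu> N"
proof (cases "length \<nu> \<le> Suc N")
  case len: True
  let ?n = "strict_exponents \<nu> (Suc N)"
  \<comment> \<open>The shift and the specialization are combined into one substitution; for
    \<open>i \<le> N\<close> it exceeds the shift for N variables by \<open>s\<close>.\<close>
  define \<sigma> where "\<sigma> i = substitute (Var(Suc N := 0)) (shift_var s (Suc N) i)" for i
  let ?T = "substitute \<sigma>" and ?U = "substitute (shift_var s N)"
  have \<sigma>_last: "\<sigma> (Suc N) = 0" by (simp add: \<sigma>_def shift_var_def substitute_simps)
  have \<sigma>: "\<sigma> i = shift_var s N i + Const s" if "i \<le> N" for i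
    using that by (simp add: \<sigma>_def shift_var_def substitute_simps Suc_diff_le distrib_right Const_add)
  have T_prod: "?T (vandermonde (Suc N)) = ?U (vandermonde N) * (\<Prod>i\<in>{1..N}. \<sigma> i)"
  proof -
    have "?T (vandermonde N) = ?U (vandermonde N)"
      by (auto simp: vandermonde_Sigma substitute_simps \<sigma> intro!: prod.cong)
    then show ?thesis by (simp add: vandermonde_Suc substitute_simps \<sigma>_last)
  qed
  have "\<sigma> i \<noteq> 0" if "i \<le> N" for i
  proof -
    have "\<sigma> i = Var i - Const (- (of_nat (N - i) * s + s))"
      by (simp add: \<sigma>[OF that] shift_var_def Const_add Const_uminus Const_diff)
    then show ?thesis by simp
  qed
  moreover have "?U (vandermonde N) \<noteq> 0"
    using substitute_shift_var_eq_iff[of s N "vandermonde N" 0] by simp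
  ultimately have ne: "?T (vandermonde (Suc N)) \<noteq> 0" by (simp add: T_prod)
  let ?A = "mat (Suc N) (Suc N) (\<lambda>(i, j). step_power s (\<sigma> (Suc j)) (?n i))"
  have "det ?A = (\<Sum>i<Suc N. ?A $$ (i, N) * cofactor ?A i N)"
    by (rule laplace_expansion_column) auto
  also have "\<dots> = (\<Sum>i<Suc N. if i = N then ?A $$ (N, N) * cofactor ?A N N else 0)"
    by (intro sum.cong) (auto simp: \<sigma>_last step_power_zero strict_exponents_def)
  also have "\<dots> = (if length \<nu> = Suc N then 0 else det (mat_delete ?A N N))"
    using row_eq_0_iff[OF \<nu>, of "Suc N"] len
    by (auto simp: \<sigma>_last step_power_zero strict_exponents_def cofactor_def)
  finally have det: "?T (alternant s (Suc N) ?n) = (if length \<nu> = Suc N then 0 else det (mat_delete ?A N N))"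
    by (simp add: substitute_alternant)
  have T_eq: "?T (bialternant (step_power s) \<nu> (Suc N)) * ?T (vandermonde (Suc N)) = ?T (alternant s (Suc N) ?n)"
    by (simp add: bialternant_mult_vandermonde[OF len] flip: substitute_mult)
  have "?T (bialternant (step_power s) \<nu> (Suc N)) = step_schur s \<nu> N"
  \<comment> \<open>With exactly N + 1 rows the numerator vanishes, in agreement with the value 0 of
    \<open>bialternant\<close> for a partition with more than N rows.\<close>
  proof (cases "length \<nu> = Suc N")
    case True
    with T_eq ne det show ?thesis by (simp add: step_schur_def bialternant_def)
  next
    case False
    have D: "mat_delete ?A N N
        = mat N N (\<lambda>(i, j). \<sigma> (Suc j) * step_power s (shift_var s N (Suc j)) (strict_exponents \<nu> N i))"
    proof (rule eq_matI, goal_cases)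
      case (1 i j)
      then have "?n i = Suc (strict_exponents \<nu> N i)" by (simp add: strict_exponents_def)
      then show ?case using 1 by (simp add: mat_delete_def \<sigma> step_power_shift)
    qed (simp_all add: mat_delete_def)
    have "?T (alternant s (Suc N) ?n) = det (mat_delete ?A N N)"
      using det False by (simp only: if_False)
    also have "\<dots> = (\<Prod>j<N. \<sigma> (Suc j)) * ?U (alternant s N (strict_exponents \<nu> N))"
      by (simp only: D det_mat_scale_columns substitute_alternant)
    also have "(\<Prod>j<N. \<sigma> (Suc j)) = (\<Prod>i\<in>{1..N}. \<sigma> i)"
      by (simp add: prod.atLeast1_atMost_eq)
    also have "?U (alternant s N (strict_exponents \<nu> N)) = step_schur s \<nu> N * ?U (vandermonde N)"
      using False len by (simp add: step_schur_def bialternant_mult_vandermonde flip: substitute_mult)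
    also have "(\<Prod>i\<in>{1..N}. \<sigma> i) * (step_schur s \<nu> N * ?U (vandermonde N))
        = step_schur s \<nu> N * ?T (vandermonde (Suc N))" by (simp add: T_prod)
    finally show ?thesis using T_eq ne by simp
  qed
  then show ?thesis by (simp add: step_schur_def substitute_substitute \<sigma>_def[abs_def])
qed (simp add: step_schur_def bialternant_def)


section \<open>The algebras of symmetric and shifted symmetric functions\<close>

definition Sym_step :: "'a::comm_ring_1 \<Rightarrow> 'a mpoly_seq set" where
  "Sym_step s = stable_sequences (\<lambda>N. substitute (shift_var s N) ` symmetric_polys N)"

lemma Sym_step_0: "Sym_step 0 = Sym"
  by (simp add: Sym_step_def Sym_def shift_var_0 substitute_Var_id[abs_def])

lemma Sym_step_1: "Sym_step 1 = Sym_star"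
  by (simp add: Sym_step_def Sym_star_def shifted_symmetric_polys_def[abs_def] shift_var_1)

lemma symmetric_polys_iff: "p \<in> symmetric_polys N \<longleftrightarrow>
    vars_in {1..N} p \<and> (\<forall>\<pi>. \<pi> permutes {1..N} \<longrightarrow> substitute (\<lambda>i. Var (\<pi> i)) p = p)"
  by (simp add: symmetric_polys_def polynomials_in_iff)

lemma symmetric_polys_closed:
  "Const c \<in> symmetric_polys N"
  "p \<in> symmetric_polys N \<Longrightarrow> q \<in> symmetric_polys N \<Longrightarrow> p + q \<in> symmetric_polys N"
  "p \<in> symmetric_polys N \<Longrightarrow> q \<in> symmetric_polys N \<Longrightarrow> p * q \<in> symmetric_polys N"
  by (auto simp: symmetric_polys_iff substitute_simps)

lemma Sym_stepI:
  assumes "\<And>N. \<exists>g\<in>symmetric_polys N. f N = substitute (shift_var s N) g"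
    and "\<And>N. substitute (Var(Suc N := 0)) (f (Suc N)) = f N"
    and "\<And>N. degree_lt (Suc d) (f N)"
  shows "f \<in> Sym_step s"
  using assms unfolding Sym_step_def stable_sequences_def degree_le_iff by blast

lemma Sym_stepE:
  assumes "f \<in> Sym_step s"
  obtains d where "\<And>N. \<exists>g\<in>symmetric_polys N. f N = substitute (shift_var s N) g"
    and "\<And>N. substitute (Var(Suc N := 0)) (f (Suc N)) = f N"
    and "\<And>N. degree_lt (Suc d) (f N)"
  using assms unfolding Sym_step_def stable_sequences_def degree_le_iff by blast

lemma Sym_step_Const: "(\<lambda>N. Const c) \<in> Sym_step s"
  by (rule Sym_stepI[where d = 0])
    (auto intro!: bexI[of _ "Const c"] symmetric_polys_closed degree_lt_Const)

lemma Sym_step_1_mem: "1 \<in> Sym_step s"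
  using Sym_step_Const[of 1 s] by (simp add: one_fun_def)

lemma Sym_step_0_mem: "0 \<in> Sym_step s"
  using Sym_step_Const[of 0 s] by (simp add: zero_fun_def)

lemma Sym_step_add:
  assumes "f \<in> Sym_step s" "g \<in> Sym_step s"
  shows "f + g \<in> Sym_step s"
proof -
  obtain d where f: "\<And>N. \<exists>h\<in>symmetric_polys N. f N = substitute (shift_var s N) h"
    "\<And>N. substitute (Var(Suc N := 0)) (f (Suc N)) = f N" "\<And>N. degree_lt (Suc d) (f N)"
    using Sym_stepE[OF assms(1)] by metis
  obtain e where g: "\<And>N. \<exists>h\<in>symmetric_polys N. g N = substitute (shift_var s N) h"
    "\<And>N. substitute (Var(Suc N := 0)) (g (Suc N)) = g N" "\<And>N. degree_lt (Suc e) (g N)"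
    using Sym_stepE[OF assms(2)] by metis
  show ?thesis
  proof (rule Sym_stepI)
    show "\<exists>h\<in>symmetric_polys N. (f + g) N = substitute (shift_var s N) h" for N
      using f(1)[of N] g(1)[of N] by (metis plus_fun_apply substitute_add symmetric_polys_closed(2))
    show "substitute (Var(Suc N := 0)) ((f + g) (Suc N)) = (f + g) N" for N
      by (simp add: substitute_add f g)
    show "degree_lt (Suc (max d e)) ((f + g) N)" for N
      unfolding plus_fun_apply
      by (rule degree_lt_add) (rule degree_lt_mono[OF f(3)] degree_lt_mono[OF g(3)], simp)+
  qed
qed

lemma Sym_step_mult:
  assumes "f \<in> Sym_step s" "g \<in> Sym_step s"
  shows "f * g \<in> Sym_step s"
proof -
  obtain d where f: "\<And>N. \<exists>h\<in>symmetric_polys N. f N = substitute (shift_var s N) h"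
    "\<And>N. substitute (Var(Suc N := 0)) (f (Suc N)) = f N" "\<And>N. degree_lt (Suc d) (f N)"
    using Sym_stepE[OF assms(1)] by metis
  obtain e where g: "\<And>N. \<exists>h\<in>symmetric_polys N. g N = substitute (shift_var s N) h"
    "\<And>N. substitute (Var(Suc N := 0)) (g (Suc N)) = g N" "\<And>N. degree_lt (Suc e) (g N)"
    using Sym_stepE[OF assms(2)] by metis
  show ?thesis
  proof (rule Sym_stepI)
    show "\<exists>h\<in>symmetric_polys N. (f * g) N = substitute (shift_var s N) h" for N
      using f(1)[of N] g(1)[of N] by (metis times_fun_apply substitute_mult symmetric_polys_closed(3))
    show "substitute (Var(Suc N := 0)) ((f * g) (Suc N)) = (f * g) N" for N
      by (simp add: substitute_mult f g)
    show "degree_lt (Suc (d + e)) ((f * g) N)" for N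
      using degree_lt_mult[OF f(3)[of N] g(3)[of N]] by simp
  qed
qed

lemma scale_eq: "scale c f = (\<lambda>N. Const c) * f"
  by (simp add: scale_def fun_eq_iff)

lemma scale_apply [simp]: "scale c f N = Const c * f N"
  by (simp add: scale_def)

lemma Sym_step_scale: "f \<in> Sym_step s \<Longrightarrow> scale c f \<in> Sym_step s"
  by (simp add: scale_eq Sym_step_mult Sym_step_Const)

lemma Sym_step_diff: "f \<in> Sym_step s \<Longrightarrow> g \<in> Sym_step s \<Longrightarrow> f - g \<in> Sym_step s"
proof -
  assume f: "f \<in> Sym_step s" and g: "g \<in> Sym_step s"
  have "f - g = f + scale (-1) g" by (simp add: fun_eq_iff Const_uminus)
  then show ?thesis using f g by (metis Sym_step_add Sym_step_scale)
qed

lemma sum_seq_apply: "(sum F A) N = (\<Sum>a\<in>A. F a N)" for F :: "'b \<Rightarrow> 'a::comm_ring_1 mpoly_seq"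
  by (induction A rule: infinite_finite_induct) simp_all

lemma prod_seq_apply: "(prod F A) N = (\<Prod>a\<in>A. F a N)" for F :: "'b \<Rightarrow> 'a::comm_ring_1 mpoly_seq"
  by (induction A rule: infinite_finite_induct) simp_all

lemma Sym_step_sum: "(\<And>a. a \<in> A \<Longrightarrow> F a \<in> Sym_step s) \<Longrightarrow> sum F A \<in> Sym_step s"
  by (induction A rule: infinite_finite_induct) (simp_all add: Sym_step_0_mem Sym_step_add)

lemma Sym_step_prod: "(\<And>a. a \<in> A \<Longrightarrow> F a \<in> Sym_step s) \<Longrightarrow> prod F A \<in> Sym_step s"
  by (induction A rule: infinite_finite_induct) (simp_all add: Sym_step_1_mem Sym_step_mult)

lemma degree_lt_step_schur: "\<nu> \<in> partitions \<Longrightarrow> degree_lt (Suc (sum_list \<nu>)) (step_schur s \<nu> N)"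
proof (cases "length \<nu> \<le> N")
  case True
  assume "\<nu> \<in> partitions"
  from lead_step_schur[OF this True, of s] show ?thesis
    by (simp add: degree_lt_iff_lead mdeg_partition_exponent)
qed (simp add: step_schur_def bialternant_def)

lemma step_schur_mem: "\<nu> \<in> partitions \<Longrightarrow> step_schur s \<nu> \<in> Sym_step s"
  by (rule Sym_stepI[OF _ step_schur_stable degree_lt_step_schur])
    (auto simp: step_schur_def intro: bialternant_symmetric)

subsection \<open>Coefficients at partitions\<close>

text \<open>The coefficient is read in the smallest number of variables that accommodates the
  monomial; by stability more variables give the same value.\<close>

definition partition_coeff :: "'a::zero mpoly_seq \<Rightarrow> nat list \<Rightarrow> 'a" where
  "partition_coeff f \<tau> = lookup (f (length \<tau>)) (partition_exponent \<tau>)"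

text \<open>Setting \<open>Var k\<close> to 0 kills the monomials that contain it and fixes all
  others.\<close>

lemma lookup_substitute_zero:
  assumes "k \<notin> keys e"
  shows "lookup (substitute (Var(k := 0)) p) e = lookup (p::'a::comm_ring_1 mpoly) e"
proof -
  have "substitute (Var(k := 0)) (single m c) = (if k \<in> keys m then 0 else single m c)" for m and c :: 'a
  proof (cases "k \<in> keys m")
    case True
    then have "(\<Prod>i\<in>keys m. (Var(k := 0)) i ^ lookup m i) = (0 :: 'a mpoly)"
      by (intro prod_zero bexI[of _ k]) (auto simp: in_keys_iff zero_power)
    then show ?thesis using True by (simp add: substitute_single)
  next
    case False
    have "(\<Prod>i\<in>keys m. (Var(k := 0)) i ^ lookup m i) = (\<Prod>i\<in>keys m. Var i ^ lookup m i :: 'a mpoly)"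
      using False by (intro prod.cong) auto
    then show ?thesis using False by (simp only: substitute_single single_eq_prod[of m c, symmetric] if_False)
  qed
  then have "substitute (Var(k := 0)) p = (\<Sum>m\<in>keys p. if k \<in> keys m then 0 else single m (lookup p m))"
    by (subst mpoly_expand[of p]) (simp add: substitute_sum)
  also have "lookup \<dots> e = (\<Sum>m\<in>keys p. lookup (single m (lookup p m)) e)"
    unfolding lookup_sum using assms by (intro sum.cong) (auto simp: lookup_single when_def)
  also have "\<dots> = lookup (\<Sum>m\<in>keys p. single m (lookup p m)) e" by (simp add: lookup_sum)
  finally show ?thesis by (simp flip: mpoly_expand)
qed

lemma lookup_stable:
  assumes "f \<in> Sym_step s" "keys e \<subseteq> {1..M}" "M \<le> N"
  shows "lookup (f N) e = lookup (f M) e"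
  using assms(3)
proof (induction N rule: dec_induct)
  case (step n)
  have "Suc n \<notin> keys e" using assms(2) step.hyps by auto
  then have "lookup (f (Suc n)) e = lookup (f n) e"
    using lookup_substitute_zero[of "Suc n" e "f (Suc n)"] Sym_stepE[OF assms(1)] by metis
  then show ?case using step.IH by simp
qed simp

lemma lookup_stable_partition:
  assumes "f \<in> Sym_step s" "length \<tau> \<le> N"
  shows "lookup (f N) (partition_exponent \<tau>) = partition_coeff f \<tau>"
  using lookup_stable[OF assms(1) keys_partition_exponent assms(2)] by (simp add: partition_coeff_def)

text \<open>An injective renaming acts injectively on exponents, so only the monomial
  \<open>m\<close> can land on \<open>e\<close>.\<close>

lemma lookup_substitute_permute:
  fixes \<pi> :: "nat \<Rightarrow> nat"
  assumes inj: "inj \<pi>" and em: "\<And>i. lookup e (\<pi> i) = lookup m i" "keys e \<subseteq> range \<pi>"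
  shows "lookup (substitute (\<lambda>i. Var (\<pi> i)) p) e = lookup (p::'a::comm_ring_1 mpoly) m"
proof -
  let ?P = "\<lambda>m::nat \<Rightarrow>\<^sub>0 nat. \<Sum>i\<in>keys m. single (\<pi> i) (lookup m i)"
  have P: "lookup (?P m) (\<pi> j) = lookup m j" for m j
    using inj by (simp add: lookup_sum lookup_single when_def inj_eq in_keys_iff)
  have "?P m = e"
  proof (rule poly_mapping_eqI)
    fix k show "lookup (?P m) k = lookup e k"
    proof (cases "k \<in> range \<pi>")
      case False
      then have "lookup (?P m) k = 0" by (auto simp: lookup_sum lookup_single when_def intro!: sum.neutral)
      moreover have "lookup e k = 0" using False em(2) by (auto simp: in_keys_iff)
      ultimately show ?thesis by simp
    qed (use P em in auto)
  qed
  moreover have "?P m' = ?P m \<longleftrightarrow> m' = m" for m'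
    by (metis P poly_mapping_eqI)
  moreover have "substitute (\<lambda>i. Var (\<pi> i)) p = (\<Sum>m\<in>keys p. single (?P m) (lookup p m))"
    by (subst mpoly_expand[of p])
      (simp add: substitute_sum substitute_single Var_power prod_single Const_def mult_single)
  ultimately show ?thesis
    by (simp add: lookup_sum lookup_single when_def in_keys_iff)
qed

text \<open>Partitions store nonzero rows only. This allows zeros to be dropped from a sorted list
  of exponents, or after the removal of a box, without moving any other row.\<close>

lemma sorted_filter_zeros:
  "sorted_wrt (\<ge>) ys \<Longrightarrow> \<exists>r. ys = filter (\<lambda>x. x \<noteq> 0) ys @ replicate r (0::nat)"
proof (induction ys)
  case (Cons y ys)
  show ?case
  proof (cases "y = 0")
    case True
    with Cons.prems have "\<forall>x\<in>set ys. x = 0" by auto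
    then have zero: "x = 0" if "x \<in> set (y # ys)" for x using that True by simp blast
    have "filter (\<lambda>x. x \<noteq> 0) (y # ys) = []" by (intro filter_False ballI) (simp only: zero not_not)
    moreover have "y # ys = replicate (length (y # ys)) 0"
      by (rule replicate_length_same[symmetric]) (use zero in blast)
    ultimately have "y # ys = filter (\<lambda>x. x \<noteq> 0) (y # ys) @ replicate (length (y # ys)) 0"
      by (simp only: append_Nil)
    then show ?thesis by blast
  next
    case False
    obtain r where "ys = filter (\<lambda>x. x \<noteq> 0) ys @ replicate r 0" using Cons by auto
    moreover have "filter (\<lambda>x. x \<noteq> 0) (y # ys) = y # filter (\<lambda>x. x \<noteq> 0) ys" using False by simp
    ultimately have "y # ys = filter (\<lambda>x. x \<noteq> 0) (y # ys) @ replicate r 0"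
      by (metis append_Cons)
    then show ?thesis by blast
  qed
qed simp

text \<open>Sorting the N exponents in decreasing order and cutting off the zeros gives a partition;
  the sorting permutation is the required \<pi>. Coefficients of symmetric polynomials are thereby
  reduced to those at partitions.\<close>

lemma exponent_sort:
  assumes "keys e \<subseteq> {1..N}"
  obtains \<pi> \<tau> where "\<pi> permutes {1..N}" "\<tau> \<in> partitions" "length \<tau> \<le> N"
    "\<And>i. lookup (partition_exponent \<tau>) (\<pi> i) = lookup e i"
proof -
  define xs where "xs = map (lookup e) [1..<Suc N]"
  define ys where "ys = rev (sort xs)"
  define \<tau> where "\<tau> = filter (\<lambda>x. x \<noteq> 0) ys"
  have sorted: "sorted_wrt (\<ge>) ys" by (simp add: ys_def sorted_wrt_rev)
  then obtain r where r: "ys = \<tau> @ replicate r 0" unfolding \<tau>_def using sorted_filter_zeros by blast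
  have len: "length ys = N" "length xs = N" by (simp_all add: ys_def xs_def)
  obtain p where p: "p permutes {..<N}" "permute_list p ys = xs"
    using mset_eq_permutation[of xs ys] len by (metis mset_rev mset_sort ys_def)
  have nth: "xs ! i = ys ! p i" if "i < N" for i
    using p that len by (metis permute_list_nth)
  \<comment> \<open>The permutation \<open>p\<close> of list positions starts at 0, that of the
    variables at 1.\<close>
  define \<pi> where "\<pi> i = (if i \<in> {1..N} then Suc (p (i - 1)) else i)" for i
  have "inj_on \<pi> {1..N}"
  proof (rule inj_onI)
    fix i j assume ij: "i \<in> {1..N}" "j \<in> {1..N}" "\<pi> i = \<pi> j"
    then have "p (i - 1) = p (j - 1)" unfolding \<pi>_def by simp
    then have "i - 1 = j - 1" using permutes_inj[OF p(1)] by (simp only: inj_eq)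
    then show "i = j" using ij by auto
  qed
  moreover have pi_in: "\<pi> i \<in> {1..N}" if "i \<in> {1..N}" for i
    using permutes_in_image[OF p(1), of "i - 1"] that by (auto simp: \<pi>_def)
  moreover have "\<pi> ` {1..N} = {1..N}"
    by (rule endo_inj_surj) (use calculation in auto)
  ultimately have "bij_betw \<pi> {1..N} {1..N}" by (simp add: bij_betw_def)
  then have "\<pi> permutes {1..N}" by (rule bij_imp_permutes) (auto simp: \<pi>_def)
  moreover have "\<tau> \<in> partitions"
    using sorted by (auto simp: partitions_def \<tau>_def sorted_wrt_filter)
  moreover have "length \<tau> \<le> N"
    using len length_filter_le[of "\<lambda>x. x \<noteq> 0" ys] by (simp add: \<tau>_def)
  moreover have "lookup (partition_exponent \<tau>) (\<pi> i) = lookup e i" for i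
  proof (cases "i \<in> {1..N}")
    case True
    have row: "Defs.row \<tau> (Suc k) = ys ! k" if "k < N" for k
      using that len(1) by (subst r) (auto simp: row_def nth_append r)
    have "lookup e i = xs ! (i - 1)" using True by (auto simp: xs_def simp del: upt_Suc)
    also have "\<dots> = ys ! p (i - 1)" using True by (intro nth) auto
    also have "\<dots> = Defs.row \<tau> (\<pi> i)"
      using row[of "p (i - 1)"] pi_in[OF True] True by (simp add: \<pi>_def)
    finally show ?thesis by (simp add: lookup_partition_exponent)
  next
    case False
    then have "i \<notin> keys e" using assms by auto
    moreover have "i \<notin> keys (partition_exponent \<tau>)"
      using keys_partition_exponent[of \<tau>] \<open>length \<tau> \<le> N\<close> False by force
    moreover have "\<pi> i = i" unfolding \<pi>_def using False by (rule if_not_P)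
    ultimately show ?thesis by (simp add: in_keys_iff)
  qed
  ultimately show thesis by (rule that)
qed

lemma degree_lt_substitute_shift_var_iff:
  "degree_lt d (substitute (shift_var s N) p) \<longleftrightarrow> degree_lt d p"
proof
  assume *: "degree_lt d (substitute (shift_var s N) p)"
  show "degree_lt d p"
    using degree_lt_substitute_shift[OF *, of "\<lambda>i. - (of_nat (N - i) * s)"]
    by (simp add: Const_uminus substitute_shift_var_inverse)
qed (simp add: shift_var_def[abs_def] degree_lt_substitute_shift)

text \<open>Since the shift only affects lower degrees, the top component of a shifted symmetric
  function is symmetric and hence determined by its coefficients at partitions.\<close>

lemma Sym_step_degree_ltI:
  assumes f: "f \<in> Sym_step s" and deg: "\<And>N. degree_lt (Suc d) (f N)"
    and zero: "\<And>\<tau>. \<tau> \<in> partitions \<Longrightarrow> sum_list \<tau> = d \<Longrightarrow> partition_coeff f \<tau> = 0"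
  shows "degree_lt d (f N)"
  unfolding degree_lt_iff
proof (intro allI impI)
  fix e assume e: "d \<le> mdeg e"
  obtain g where g: "g \<in> symmetric_polys N" "f N = substitute (shift_var s N) g"
    using Sym_stepE[OF f] by metis
  have "degree_lt (Suc d) g" using deg[of N] by (simp add: g degree_lt_substitute_shift_var_iff)
  then have "degree_lt d (f N - g)"
    unfolding g(2) shift_var_def by (rule degree_lt_substitute_shift_diff)
  then have top: "lookup (f N) m = lookup g m" if "d \<le> mdeg m" for m
    using that by (auto simp: degree_lt_iff lookup_minus)
  show "lookup (f N) e = 0"
  proof (cases "mdeg e = d \<and> keys e \<subseteq> {1..N}")
    case True
    then obtain \<pi> \<tau> where \<pi>: "\<pi> permutes {1..N}" "\<tau> \<in> partitions" "length \<tau> \<le> N"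
      "\<And>i. lookup (partition_exponent \<tau>) (\<pi> i) = lookup e i"
      using exponent_sort by metis
    have "lookup g e = lookup (substitute (\<lambda>i. Var (\<pi> i)) g) (partition_exponent \<tau>)"
      using permutes_inj[OF \<pi>(1)] permutes_surj[OF \<pi>(1)] \<pi>(4)
      by (intro lookup_substitute_permute[symmetric]) auto
    also have "\<dots> = lookup g (partition_exponent \<tau>)"
      using g(1) \<pi>(1) by (simp add: symmetric_polys_iff)
    finally have eq: "lookup g e = lookup g (partition_exponent \<tau>)" .
    have "mdeg (partition_exponent \<tau>) = d"
    proof -
      have "mdeg (partition_exponent \<tau>) = (\<Sum>i\<in>{1..N}. lookup (partition_exponent \<tau>) i)"
        using keys_partition_exponent[of \<tau>] \<pi>(3) by (intro mdeg_superset) fastforce+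
      also have "\<dots> = (\<Sum>i\<in>{1..N}. lookup e i)"
        using sum.permute[OF \<pi>(1), of "lookup (partition_exponent \<tau>)"] \<pi>(4) by (simp add: o_def)
      also have "\<dots> = mdeg e" using True by (intro mdeg_superset[symmetric]) auto
      finally show ?thesis using True by simp
    qed
    then show ?thesis
      using zero[OF \<pi>(2)] lookup_stable_partition[OF f \<pi>(3)] top[OF e] top[of "partition_exponent \<tau>"] eq
      by (simp add: mdeg_partition_exponent)
  next
    case False
    have "lookup g e = 0" if "\<not> keys e \<subseteq> {1..N}"
      using g(1) that by (auto simp: symmetric_polys_iff vars_in_def in_keys_iff)
    moreover have "lookup (f N) e = 0" if "mdeg e \<noteq> d"
      using deg[of N] e that by (auto simp: degree_lt_iff)
    ultimately show ?thesis using False top[OF e] by auto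
  qed
qed

subsection \<open>Triangular families\<close>

definition partition_span :: "(nat list \<Rightarrow> 'a::comm_ring_1 mpoly_seq) \<Rightarrow> 'a mpoly_seq set" where
  "partition_span B = {\<Sum>\<tau>\<in>A. scale (a \<tau>) (B \<tau>) | A a. finite A \<and> A \<subseteq> partitions}"

lemma scale_add_left: "scale (a + b) f = scale a f + scale b f"
  by (simp add: fun_eq_iff Const_add distrib_right)

lemma scale_0 [simp]: "scale 0 f = 0" and scale_one [simp]: "scale 1 f = f"
  by (simp_all add: fun_eq_iff)

lemma partition_span_0: "0 \<in> partition_span B"
  unfolding partition_span_def by (auto intro!: exI[of _ "{}"])

lemma partition_span_add:
  assumes "f \<in> partition_span B" "g \<in> partition_span B"
  shows "f + g \<in> partition_span B"
proof -
  obtain A a where A: "finite A" "A \<subseteq> partitions" "f = (\<Sum>\<tau>\<in>A. scale (a \<tau>) (B \<tau>))"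
    using assms(1) by (auto simp: partition_span_def)
  obtain A' a' where A': "finite A'" "A' \<subseteq> partitions" "g = (\<Sum>\<tau>\<in>A'. scale (a' \<tau>) (B \<tau>))"
    using assms(2) by (auto simp: partition_span_def)
  let ?a = "\<lambda>\<tau>. if \<tau> \<in> A then a \<tau> else 0" and ?a' = "\<lambda>\<tau>. if \<tau> \<in> A' then a' \<tau> else 0"
  have "f = (\<Sum>\<tau>\<in>A \<union> A'. scale (?a \<tau>) (B \<tau>))"
    unfolding A(3) by (intro sum.mono_neutral_cong_left) (use A(1) A'(1) in auto)
  moreover have "g = (\<Sum>\<tau>\<in>A \<union> A'. scale (?a' \<tau>) (B \<tau>))"
    unfolding A'(3) by (intro sum.mono_neutral_cong_left) (use A(1) A'(1) in auto)
  ultimately have "f + g = (\<Sum>\<tau>\<in>A \<union> A'. scale (?a \<tau> + ?a' \<tau>) (B \<tau>))"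
    by (simp only: scale_add_left sum.distrib)
  then show ?thesis
    unfolding partition_span_def mem_Collect_eq using A(1,2) A'(1,2)
    by (intro exI[of _ "A \<union> A'"] exI[of _ "\<lambda>\<tau>. ?a \<tau> + ?a' \<tau>"]) auto
qed

lemma partition_span_scale_mem: "\<tau> \<in> partitions \<Longrightarrow> scale c (B \<tau>) \<in> partition_span B"
  unfolding partition_span_def by (auto intro!: exI[of _ "{\<tau>}"] exI[of _ "\<lambda>_. c"])

lemma partition_coeff_diff: "partition_coeff (f - g) \<tau> = partition_coeff f \<tau> - partition_coeff g \<tau>"
  for f :: "'a::comm_ring_1 mpoly_seq"
  by (simp add: partition_coeff_def lookup_minus)

lemma partition_coeff_scale [simp]: "partition_coeff (scale c f) \<tau> = c * partition_coeff f \<tau>"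
  by (simp add: partition_coeff_def)

lemma partition_coeff_sum: "partition_coeff (sum F A) \<tau> = (\<Sum>a\<in>A. partition_coeff (F a) \<tau>)"
  for F :: "'b \<Rightarrow> 'a::comm_ring_1 mpoly_seq"
  by (simp add: partition_coeff_def sum_seq_apply lookup_sum)

lemma finite_partitions_of: "finite {\<tau>\<in>partitions. sum_list \<tau> = d}"
proof (rule finite_subset)
  show "{\<tau>\<in>partitions. sum_list \<tau> = d} \<subseteq> {\<tau>. set \<tau> \<subseteq> {..d} \<and> length \<tau> \<le> d}"
  proof
    fix \<tau> assume *: "\<tau> \<in> {\<tau>\<in>partitions. sum_list \<tau> = d}"
    have "length xs \<le> sum_list xs" if "0 \<notin> set xs" for xs :: "nat list"
      using that by (induction xs) auto
    then show "\<tau> \<in> {\<tau>. set \<tau> \<subseteq> {..d} \<and> length \<tau> \<le> d}"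
      using * member_le_sum_list[of _ \<tau>] by (auto simp: partitions_def)
  qed
qed (rule finite_lists_length_le, simp)

text \<open>Within each degree the matrix of coefficients at partitions is triangular with nonzero
  diagonal, ordered by the rank \<open>r\<close>; lower degrees are unrestricted. The locale is used
  with exponent vectors as ranks for Schur functions and with lengths as ranks for products of power
  sums.\<close>

locale triangular_family =
  fixes s :: "'a::field" and B :: "nat list \<Rightarrow> 'a mpoly_seq" and r :: "nat list \<Rightarrow> 'o::linorder"
  assumes mem: "\<tau> \<in> partitions \<Longrightarrow> B \<tau> \<in> Sym_step s"
    and degree: "\<tau> \<in> partitions \<Longrightarrow> degree_lt (Suc (sum_list \<tau>)) (B \<tau> N)"
    and diagonal: "\<tau> \<in> partitions \<Longrightarrow> partition_coeff (B \<tau>) \<tau> \<noteq> 0"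
    and triangular: "\<tau> \<in> partitions \<Longrightarrow> \<mu> \<in> partitions \<Longrightarrow> sum_list \<mu> = sum_list \<tau> \<Longrightarrow> \<mu> \<noteq> \<tau> \<Longrightarrow>
      partition_coeff (B \<tau>) \<mu> \<noteq> 0 \<Longrightarrow> r \<mu> < r \<tau>"
begin

text \<open>Gaussian elimination in degree \<open>d\<close>. The set \<open>S\<close> contains all
  partitions at which \<open>f\<close> has a nonzero coefficient and is closed under passing to
  smaller rank, so eliminating a member of maximal rank keeps both properties for the rest of
  \<open>S\<close>.\<close>

lemma reduce_degree:
  assumes "finite S" "S \<subseteq> {\<tau>\<in>partitions. sum_list \<tau> = d}"
    and "\<And>\<kappa> \<mu>. \<kappa> \<in> S \<Longrightarrow> \<mu> \<in> partitions \<Longrightarrow> sum_list \<mu> = d \<Longrightarrow> r \<mu> < r \<kappa> \<Longrightarrow> \<mu> \<in> S"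
    and "f \<in> Sym_step s" "\<And>N. degree_lt (Suc d) (f N)"
    and "\<And>\<tau>. \<tau> \<in> partitions \<Longrightarrow> sum_list \<tau> = d \<Longrightarrow> partition_coeff f \<tau> \<noteq> 0 \<Longrightarrow> \<tau> \<in> S"
  shows "\<exists>g\<in>partition_span B. f - g \<in> Sym_step s \<and> (\<forall>N. degree_lt d ((f - g) N))"
  using assms
proof (induction "card S" arbitrary: S f)
  case 0
  then have "degree_lt d (f N)" for N
    by (intro Sym_step_degree_ltI[of f s d]) auto
  then show ?case using 0 by (intro bexI[of _ 0] partition_span_0) auto
next
  case (Suc n)
  then have fin: "finite S" "S \<noteq> {}" by auto
  then obtain \<tau> where \<tau>: "\<tau> \<in> S" "\<And>\<kappa>. \<kappa> \<in> S \<Longrightarrow> r \<kappa> \<le> r \<tau>"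
    using Max_in[of "r ` S"] Max_ge[of "r ` S"] by (smt (verit) finite_imageI image_iff image_is_empty)
  then have \<tau>_part: "\<tau> \<in> partitions" "sum_list \<tau> = d" using Suc.prems(2) by auto
  \<comment> \<open>This multiple of \<open>B \<tau>\<close> cancels the coefficient at \<tau>; by
    triangularity it disturbs only coefficients of smaller rank.\<close>
  define c where "c = partition_coeff f \<tau> / partition_coeff (B \<tau>) \<tau>"
  let ?h = "scale c (B \<tau>)"
  have "\<exists>g\<in>partition_span B. f - ?h - g \<in> Sym_step s \<and> (\<forall>N. degree_lt d ((f - ?h - g) N))"
  proof (rule Suc.hyps(1)[of "S - {\<tau>}"])
    show "n = card (S - {\<tau>})" "finite (S - {\<tau>})" using Suc.hyps(2) fin \<tau>(1) by simp_all
    show "S - {\<tau>} \<subseteq> {\<tau>\<in>partitions. sum_list \<tau> = d}" using Suc.prems(2) by auto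
    show "\<mu> \<in> S - {\<tau>}" if "\<kappa> \<in> S - {\<tau>}" "\<mu> \<in> partitions" "sum_list \<mu> = d" "r \<mu> < r \<kappa>" for \<kappa> \<mu>
      using Suc.prems(3)[of \<kappa> \<mu>] that \<tau>(2)[of \<kappa>] by auto
    show "f - ?h \<in> Sym_step s" by (intro Sym_step_diff Sym_step_scale mem Suc.prems \<tau>_part)
    show "degree_lt (Suc d) ((f - ?h) N)" for N
      using degree[OF \<tau>_part(1)] Suc.prems(5) \<tau>_part(2) by (simp add: degree_lt_diff degree_lt_Const_mult)
    show "\<mu> \<in> S - {\<tau>}"
      if \<mu>: "\<mu> \<in> partitions" "sum_list \<mu> = d" "partition_coeff (f - ?h) \<mu> \<noteq> 0" for \<mu>
    proof -
      have "\<mu> \<noteq> \<tau>" using \<mu>(3) diagonal[OF \<tau>_part(1)] by (auto simp: partition_coeff_diff c_def)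
      moreover have "partition_coeff f \<mu> \<noteq> 0 \<or> partition_coeff (B \<tau>) \<mu> \<noteq> 0"
        using \<mu>(3) by (auto simp: partition_coeff_diff)
      ultimately show ?thesis
        using Suc.prems(6)[OF \<mu>(1,2)] triangular[OF \<tau>_part(1) \<mu>(1)] Suc.prems(3)[OF \<tau>(1) \<mu>(1,2)] \<mu>(2) \<tau>_part(2)
        by auto
    qed
  qed
  then obtain g where "g \<in> partition_span B" "f - ?h - g \<in> Sym_step s" "\<forall>N. degree_lt d ((f - ?h - g) N)"
    by blast
  moreover have "f - ?h - g = f - (?h + g)" by (simp add: algebra_simps)
  ultimately show ?case
    using partition_span_add[OF partition_span_scale_mem[OF \<tau>_part(1)]] by metis
qed

lemma spans: "f \<in> Sym_step s \<Longrightarrow> f \<in> partition_span B"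
proof -
  have *: "f \<in> partition_span B" if "f \<in> Sym_step s" "\<And>N. degree_lt d (f N)" for d f
    using that
  proof (induction d arbitrary: f)
    case 0
    then have "f = 0" by (intro ext) simp
    then show ?case by (simp only: partition_span_0)
  next
    case (Suc d)
    obtain g where g: "g \<in> partition_span B" "f - g \<in> Sym_step s" "\<And>N. degree_lt d ((f - g) N)"
      using reduce_degree[OF finite_partitions_of order.refl _ Suc.prems] by auto
    from partition_span_add[OF Suc.IH[OF g(2,3)] g(1)] show ?case by (simp only: diff_add_cancel)
  qed
  assume f: "f \<in> Sym_step s"
  show ?thesis by (rule Sym_stepE[OF f]) (rule *[OF f])
qed

text \<open>Among the members with nonzero coefficient, one of maximal degree and then of maximal
  rank is chosen. No other member contributes to the coefficient at its partition.\<close>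

lemma independent:
  assumes "finite A" "A \<subseteq> partitions" "(\<Sum>\<tau>\<in>A. scale (a \<tau>) (B \<tau>)) = 0" "\<tau> \<in> A"
  shows "a \<tau> = 0"
proof (rule ccontr)
  assume "a \<tau> \<noteq> 0"
  define A' where "A' = {\<tau>\<in>A. a \<tau> \<noteq> 0}"
  have A': "finite A'" "A' \<noteq> {}" "A' \<subseteq> partitions"
    using assms \<open>a \<tau> \<noteq> 0\<close> by (auto simp: A'_def)
  define d where "d = Max (sum_list ` A')"
  define A'' where "A'' = {\<tau>\<in>A'. sum_list \<tau> = d}"
  have "d \<in> sum_list ` A'" unfolding d_def using A' by (intro Max_in) auto
  then have A'': "finite A''" "A'' \<noteq> {}" using A' by (auto simp: A''_def)
  have "Max (r ` A'') \<in> r ` A''" using A'' by (intro Max_in) auto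
  then obtain \<kappa> where \<kappa>: "\<kappa> \<in> A''" "r \<kappa> = Max (r ` A'')" by auto
  have \<kappa>_part: "\<kappa> \<in> partitions" "sum_list \<kappa> = d" "\<kappa> \<in> A" "a \<kappa> \<noteq> 0"
    using \<kappa>(1) A' by (auto simp: A''_def A'_def)
  have zero: "a \<mu> * partition_coeff (B \<mu>) \<kappa> = 0" if \<mu>: "\<mu> \<in> A" "\<mu> \<noteq> \<kappa>" for \<mu>
  proof (rule ccontr)
    assume "\<not> ?thesis"
    then have ne: "a \<mu> \<noteq> 0" "partition_coeff (B \<mu>) \<kappa> \<noteq> 0" by auto
    have "\<mu> \<in> A'" using \<mu> ne by (simp add: A'_def)
    then have "sum_list \<mu> \<le> d" unfolding d_def using A' by simp
    moreover have "\<not> sum_list \<mu> < d"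
      using degree[of \<mu> "length \<kappa>"] ne(2) \<kappa>_part(2) \<open>\<mu> \<in> A'\<close> A'(3)
      by (auto simp: degree_lt_iff partition_coeff_def mdeg_partition_exponent)
    ultimately have "sum_list \<mu> = d" by simp
    then have "\<mu> \<in> A''" using \<open>\<mu> \<in> A'\<close> by (simp add: A''_def)
    then have "r \<mu> \<le> r \<kappa>" using A'' by (simp add: \<kappa>(2))
    moreover have "r \<kappa> < r \<mu>"
      using triangular[of \<mu> \<kappa>] \<mu> ne(2) \<kappa>_part \<open>sum_list \<mu> = d\<close> \<open>\<mu> \<in> A'\<close> A'(3) by auto
    ultimately show False by simp
  qed
  have "0 = partition_coeff (\<Sum>\<tau>\<in>A. scale (a \<tau>) (B \<tau>)) \<kappa>"
    unfolding assms(3) by (simp add: partition_coeff_def)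
  also have "\<dots> = (\<Sum>\<mu>\<in>A. if \<mu> = \<kappa> then a \<kappa> * partition_coeff (B \<kappa>) \<kappa> else 0)"
    unfolding partition_coeff_sum partition_coeff_scale using zero by (intro sum.cong) auto
  also have "\<dots> = a \<kappa> * partition_coeff (B \<kappa>) \<kappa>" using \<kappa>_part(3) assms(1) by simp
  finally show False using \<kappa>_part(4) diagonal[OF \<kappa>_part(1)] by simp
qed

end

text \<open>The function is led by the monomial of its own partition, so in the same degree all
  other partitions that occur have smaller exponent vectors.\<close>

lemma triangular_family_step_schur: "triangular_family s (step_schur s) partition_exponent"
proof
  fix \<tau> :: "nat list" assume \<tau>: "\<tau> \<in> partitions"
  show "step_schur s \<tau> \<in> Sym_step s" by (rule step_schur_mem[OF \<tau>])
  show "degree_lt (Suc (sum_list \<tau>)) (step_schur s \<tau> N)" for N by (rule degree_lt_step_schur[OF \<tau>])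
  show "partition_coeff (step_schur s \<tau>) \<tau> \<noteq> 0"
    using lead_step_schur[OF \<tau> order.refl, of s] by (simp add: lead_def partition_coeff_def)
  fix \<mu> assume \<mu>: "\<mu> \<in> partitions" "sum_list \<mu> = sum_list \<tau>" "\<mu> \<noteq> \<tau>" "partition_coeff (step_schur s \<tau>) \<mu> \<noteq> 0"
  \<comment> \<open>Enough variables to contain both monomials; stability allows the comparison to
    be made there.\<close>
  let ?N = "max (length \<mu>) (length \<tau>)"
  have "lookup (step_schur s \<tau> ?N) (partition_exponent \<mu>) \<noteq> 0"
    using lookup_stable_partition[OF step_schur_mem[OF \<tau>], of \<mu> ?N s] \<mu>(4) by simp
  then have "partition_exponent \<mu> = partition_exponent \<tau> \<or> grlex_less (partition_exponent \<mu>) (partition_exponent \<tau>)"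
    using lead_step_schur[OF \<tau>, of ?N s] by (auto simp: lead_def in_keys_iff)
  then show "partition_exponent \<mu> < partition_exponent \<tau>"
    using partition_exponent_inject[OF \<mu>(1) \<tau>] \<mu>(2,3) by (auto simp: grlex_less_def mdeg_partition_exponent)
qed


section \<open>Power sums and the isomorphism of the two algebras\<close>

text \<open>The half-integer shift of p_k^* is scaled by \<open>s\<close>. Subtracting the value at
  y_i = 0 makes the sequence stable; for s = 0 and k \<ge> 1 the subtracted term vanishes and p_k
  remains.\<close>

definition step_power_sum :: "'a::field_char_0 \<Rightarrow> nat \<Rightarrow> 'a mpoly_seq" where
  "step_power_sum s k = (\<lambda>N. \<Sum>i=1..N.
     (Var i + Const (s / 2 - of_nat i * s)) ^ k - Const (s / 2 - of_nat i * s) ^ k)"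

lemma step_power_sum_0: "1 \<le> k \<Longrightarrow> step_power_sum 0 k = power_sum k"
  by (simp add: step_power_sum_def power_sum_def fun_eq_iff zero_power)

lemma step_power_sum_1: "step_power_sum 1 k = power_sum_star k"
  by (simp add: step_power_sum_def power_sum_star_def fun_eq_iff Const_diff Const_of_nat algebra_simps)

lemma degree_lt_step_power_sum: "degree_lt (Suc k) (step_power_sum s k N)"
  unfolding step_power_sum_def
proof (intro degree_lt_sum degree_lt_diff)
  fix i and c :: 'a
  show "degree_lt (Suc k) ((Var i + Const c) ^ k)"
    using degree_lt_power[of 1 "Var i + Const c" k] by (simp add: degree_lt_add degree_lt_Var degree_lt_Const)
  show "degree_lt (Suc k) (Const c ^ k)" by (simp add: degree_lt_Const flip: Const_power)
qed

lemma step_power_sum_top: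
  assumes "1 \<le> k"
  shows "degree_lt k (step_power_sum s k N - step_power_sum 0 k N)"
proof -
  have "degree_lt k ((Var i + Const c) ^ k - Var i ^ k)" for i and c :: 'a
    using degree_lt_prod_diff[of "{..<k}" "\<lambda>_. 1" "\<lambda>_. Var i + Const c" "\<lambda>_. Var i"]
    by (simp add: degree_lt_add degree_lt_Var degree_lt_Const)
  moreover have "degree_lt k (Const c ^ k)" for c :: 'a
    using assms by (simp add: degree_lt_Const flip: Const_power)
  ultimately have "degree_lt k ((Var i + Const c) ^ k - Var i ^ k - Const c ^ k)" for i and c :: 'a
    by (rule degree_lt_diff)
  then have "degree_lt k (\<Sum>i=1..N. ((Var i + Const (s / 2 - of_nat i * s)) ^ k - Var i ^ k)
      - Const (s / 2 - of_nat i * s) ^ k)"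
    by (rule degree_lt_sum)
  moreover have "step_power_sum s k N - step_power_sum 0 k N
      = (\<Sum>i=1..N. ((Var i + Const (s / 2 - of_nat i * s)) ^ k - Var i ^ k) - Const (s / 2 - of_nat i * s) ^ k)"
    using assms by (simp add: step_power_sum_def zero_power algebra_simps flip: sum_subtractf)
  ultimately show ?thesis by simp
qed

lemma step_power_sum_mem: "step_power_sum s k \<in> Sym_step s"
proof (rule Sym_stepI[OF _ _ degree_lt_step_power_sum])
  fix N
  \<comment> \<open>Undoing the shift by (N - i) s turns y_i + s/2 - i s into x_i + s/2 - N s, whose
    constant no longer depends on i; the sum is then visibly symmetric.\<close>
  let ?g = "\<Sum>i\<in>{1..N}. (Var i + Const (s / 2 - of_nat N * s)) ^ k - Const (s / 2 - of_nat i * s) ^ k"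
  have "vars_in {1..N} ?g"
    by (intro vars_in_sum vars_in_diff vars_in_power vars_in_add vars_in_Var vars_in_Const) auto
  moreover have "substitute (\<lambda>i. Var (\<pi> i)) ?g = ?g" if "\<pi> permutes {1..N}" for \<pi>
    by (simp only: substitute_simps substitute_Var substitute_Const sum_subtractf
        sum.permute[OF that, of "\<lambda>i. (Var i + Const (s / 2 - of_nat N * s)) ^ k", unfolded o_def, symmetric])
  ultimately have "?g \<in> symmetric_polys N" unfolding symmetric_polys_iff by blast
  moreover have "step_power_sum s k N = substitute (shift_var s N) ?g"
    by (auto simp: step_power_sum_def substitute_simps shift_var_def of_nat_diff algebra_simps
        simp flip: Const_add intro!: sum.cong)
  ultimately show "\<exists>g\<in>symmetric_polys N. step_power_sum s k N = substitute (shift_var s N) g"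
    by (intro bexI[of _ ?g])
next
  fix N
  show "substitute (Var(Suc N := 0)) (step_power_sum s k (Suc N)) = step_power_sum s k N"
    by (auto simp: step_power_sum_def substitute_simps intro!: sum.cong)
qed

definition power_sum_product :: "'a::field_char_0 \<Rightarrow> nat list \<Rightarrow> 'a mpoly_seq" where
  "power_sum_product s \<tau> = (\<Prod>t<length \<tau>. step_power_sum s (\<tau> ! t))"

lemma sum_nth_lessThan: "(\<Sum>t<length xs. xs ! t) = sum_list (xs :: nat list)"
  by (simp add: sum_list_sum_nth atLeast0LessThan)

lemma partition_nth_pos: "\<tau> \<in> partitions \<Longrightarrow> t < length \<tau> \<Longrightarrow> 1 \<le> \<tau> ! t"
  by (metis (no_types, lifting) One_nat_def Suc_leI mem_Collect_eq not_gr_zero nth_mem partitions_def)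

lemma degree_lt_power_sum_product: "degree_lt (Suc (sum_list \<tau>)) (power_sum_product s \<tau> N)"
  using degree_lt_prod[of "{..<length \<tau>}" "\<lambda>t. \<tau> ! t", OF degree_lt_step_power_sum]
  by (simp add: power_sum_product_def prod_seq_apply sum_nth_lessThan)

lemma power_sum_product_top:
  assumes "\<tau> \<in> partitions"
  shows "degree_lt (sum_list \<tau>) (power_sum_product s \<tau> N - power_sum_product 0 \<tau> N)"
  using degree_lt_prod_diff[of "{..<length \<tau>}" "\<lambda>t. \<tau> ! t", OF degree_lt_step_power_sum step_power_sum_top]
    partition_nth_pos[OF assms]
  by (simp add: power_sum_product_def prod_seq_apply sum_nth_lessThan)

lemma power_sum_product_expand:
  assumes "\<tau> \<in> partitions"
  shows "power_sum_product 0 \<tau> N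
    = (\<Sum>i\<in>{..<length \<tau>} \<rightarrow>\<^sub>E {1..N}. single (\<Sum>t<length \<tau>. single (i t) (\<tau> ! t)) 1)"
proof -
  have "power_sum_product 0 \<tau> N = (\<Prod>t<length \<tau>. \<Sum>i\<in>{1..N}. single (single i (\<tau> ! t)) 1)"
    using partition_nth_pos[OF assms]
    by (auto simp: power_sum_product_def prod_seq_apply step_power_sum_0 power_sum_def Var_power intro!: prod.cong)
  then show ?thesis by (simp add: prod_sum_PiE prod_single)
qed

text \<open>From the top degree on, the coefficient counts the assignments of a variable to each
  factor that produce \<open>e\<close>. In characteristic 0 it is nonzero as soon as one assignment
  exists.\<close>

lemma lookup_power_sum_product:
  assumes "\<tau> \<in> partitions" "mdeg e \<ge> sum_list \<tau>"
  shows "lookup (power_sum_product s \<tau> N) e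
    = of_nat (card {i \<in> {..<length \<tau>} \<rightarrow>\<^sub>E {1..N}. (\<Sum>t<length \<tau>. single (i t) (\<tau> ! t)) = e})"
proof -
  have "lookup (power_sum_product s \<tau> N) e = lookup (power_sum_product 0 \<tau> N) e"
    using power_sum_product_top[OF assms(1)] assms(2) by (auto simp: degree_lt_iff lookup_minus)
  also have "\<dots> = (\<Sum>i\<in>{..<length \<tau>} \<rightarrow>\<^sub>E {1..N}. if (\<Sum>t<length \<tau>. single (i t) (\<tau> ! t)) = e then 1 else 0)"
    by (simp add: power_sum_product_expand[OF assms(1)] lookup_sum lookup_single when_def)
  also have "\<dots> = of_nat (card {i \<in> {..<length \<tau>} \<rightarrow>\<^sub>E {1..N}. (\<Sum>t<length \<tau>. single (i t) (\<tau> ! t)) = e})"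
    by (simp add: finite_PiE flip: sum.inter_filter)
  finally show ?thesis .
qed

lemma partitions_mset_eq:
  assumes "\<mu> \<in> partitions" "\<nu> \<in> partitions" "mset \<mu> = mset \<nu>"
  shows "\<mu> = \<nu>"
proof -
  have "sorted (rev \<mu>)" "sorted (rev \<nu>)" using assms by (simp_all add: partitions_def sorted_wrt_rev)
  then have "rev \<mu> = rev \<nu>" using assms(3) properties_for_sort by (metis mset_rev)
  then show ?thesis by simp
qed

text \<open>A monomial of partition \<mu> in top degree arises by distributing the parts of \<tau>
  over the rows of \<mu> and adding them up. Every row receives a part, so \<mu> has at most as many
  rows as \<tau>, and equally many only if \<mu> = \<tau>.\<close>

lemma triangular_family_power_sum_product: "triangular_family s (power_sum_product s) length"
proof
  fix \<tau> :: "nat list" assume \<tau>: "\<tau> \<in> partitions"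
  let ?l = "length \<tau>"
  let ?e = "\<lambda>i :: nat \<Rightarrow> nat. \<Sum>t<?l. single (i t) (\<tau> ! t)"
  show "power_sum_product s \<tau> \<in> Sym_step s"
    unfolding power_sum_product_def by (intro Sym_step_prod step_power_sum_mem)
  show "degree_lt (Suc (sum_list \<tau>)) (power_sum_product s \<tau> N)" for N
    by (rule degree_lt_power_sum_product)
  let ?S = "\<lambda>N e. {i \<in> {..<?l} \<rightarrow>\<^sub>E {1..N}. ?e i = e}"
  have fin: "finite (?S N e)" for N e
    by (rule finite_subset[OF _ finite_PiE[of "{..<?l}" "\<lambda>_. {1..N}"]]) auto
  \<comment> \<open>Giving part t (counted from 0) to the variable t + 1 yields the monomial of
    \<tau> itself.\<close>
  have "restrict Suc {..<?l} \<in> ?S ?l (partition_exponent \<tau>)"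
    by (auto simp: partition_exponent_def)
  then have "?S ?l (partition_exponent \<tau>) \<noteq> {}" using equals0D by fast
  then have "card (?S ?l (partition_exponent \<tau>)) \<noteq> 0" unfolding card_0_eq[OF fin] .
  then show "partition_coeff (power_sum_product s \<tau>) \<tau> \<noteq> 0"
    unfolding partition_coeff_def by (subst lookup_power_sum_product[OF \<tau>]) (simp_all add: mdeg_partition_exponent)
  fix \<mu> assume \<mu>: "\<mu> \<in> partitions" "sum_list \<mu> = sum_list \<tau>" "\<mu> \<noteq> \<tau>" "partition_coeff (power_sum_product s \<tau>) \<mu> \<noteq> 0"
  have "card (?S (length \<mu>) (partition_exponent \<mu>)) \<noteq> 0"
    using \<mu>(4) unfolding partition_coeff_def
    by (subst (asm) lookup_power_sum_product[OF \<tau>]) (simp_all add: mdeg_partition_exponent \<mu>(2))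
  then have "?S (length \<mu>) (partition_exponent \<mu>) \<noteq> {}" unfolding card_0_eq[OF fin] .
  then obtain i where i: "i \<in> {..<?l} \<rightarrow>\<^sub>E {1..length \<mu>}" "?e i = partition_exponent \<mu>" by blast
  have row: "Defs.row \<mu> k = (\<Sum>t<?l. if i t = k then \<tau> ! t else 0)" for k
    using arg_cong[OF i(2), of "\<lambda>e. lookup e k"]
    by (simp add: lookup_partition_exponent lookup_sum lookup_single when_def)
  have "{1..length \<mu>} \<subseteq> i ` {..<?l}"
  proof
    fix k assume k: "k \<in> {1..length \<mu>}"
    then have "Defs.row \<mu> k \<noteq> 0" using row_eq_0_iff[OF \<mu>(1), of k] by simp
    then have "\<exists>t<?l. i t = k" unfolding row by (rule contrapos_np) (auto intro: sum.neutral)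
    then show "k \<in> i ` {..<?l}" by auto
  qed
  then have img: "i ` {..<?l} = {1..length \<mu>}" using i(1) by (auto simp: PiE_iff)
  have "length \<mu> \<le> ?l" using card_image_le[of "{..<?l}" i] by (simp add: img)
  \<comment> \<open>With equal lengths the assignment of parts to rows is a bijection, so \<mu> and
    \<tau> have the same multiset of parts.\<close>
  moreover have "length \<mu> \<noteq> ?l"
  proof
    assume len: "length \<mu> = ?l"
    then have inj: "inj_on i {..<?l}" using img by (intro eq_card_imp_inj_on) auto
    define p where "p t = (if t < ?l then i t - 1 else t)" for t
    have p: "p t < ?l" "Suc (p t) = i t" if "t < ?l" for t
    proof -
      have "i t \<in> {1..?l}" using imageI[of t "{..<?l}" i] that unfolding img len by simp
      then show "p t < ?l" "Suc (p t) = i t" using that by (auto simp: p_def)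
    qed
    have "inj_on p {..<?l}"
    proof (rule inj_onI)
      fix t u assume tu: "t \<in> {..<?l}" "u \<in> {..<?l}" "p t = p u"
      then have "i t = i u" using p(2)[of t] p(2)[of u] by simp
      then show "t = u" using inj tu by (simp add: inj_on_eq_iff)
    qed
    moreover have "p ` {..<?l} = {..<?l}"
      by (rule endo_inj_surj) (use calculation p(1) in auto)
    ultimately have "bij_betw p {..<?l} {..<?l}" by (simp add: bij_betw_def)
    then have perm: "p permutes {..<?l}" by (rule bij_imp_permutes) (simp add: p_def)
    have "\<tau> ! t = \<mu> ! p t" if t: "t < ?l" for t
    proof -
      have "\<mu> ! p t = Defs.row \<mu> (i t)" using p[OF t] len by (simp add: row_def flip: p(2)[OF t])
      also have "\<dots> = (\<Sum>u<?l. if u = t then \<tau> ! t else 0)"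
        unfolding row using inj t by (intro sum.cong) (auto simp: inj_on_def)
      finally show ?thesis using t by simp
    qed
    then have \<tau>_perm: "\<tau> = permute_list p \<mu>"
      by (intro nth_equalityI) (simp_all add: len permute_list_nth perm)
    have "p permutes {..<length \<mu>}" using perm len by simp
    then have "mset \<tau> = mset \<mu>" by (subst \<tau>_perm) (rule mset_permute_list)
    then show False using partitions_mset_eq[OF \<mu>(1) \<tau>] \<mu>(3) by simp
  qed
  ultimately show "length \<mu> < length \<tau>" by simp
qed

subsection \<open>Polynomials in the power sums\<close>

text \<open>The variable \<open>k\<close> stands for the k-th power sum, so bijectivity on
  polynomials in the variables \<open>{1..}\<close> says that the power sums are free
  generators.\<close>

definition eval_power_sums :: "'a::field_char_0 \<Rightarrow> 'a mpoly \<Rightarrow> 'a mpoly_seq" where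
  "eval_power_sums s P = (\<lambda>N. substitute (\<lambda>k. step_power_sum s k N) P)"

lemma eval_power_sums_simps:
  "eval_power_sums s (P + Q) = eval_power_sums s P + eval_power_sums s Q"
  "eval_power_sums s (P * Q) = eval_power_sums s P * eval_power_sums s Q"
  "eval_power_sums s (Const c) = (\<lambda>N. Const c)"
  "eval_power_sums s (Var k) = step_power_sum s k"
  by (simp_all add: eval_power_sums_def fun_eq_iff substitute_simps)

lemma eval_power_sums_scale: "eval_power_sums s (Const c * P) = scale c (eval_power_sums s P)"
  by (simp add: eval_power_sums_simps scale_eq)

lemma eval_power_sums_sum: "eval_power_sums s (sum P A) = (\<Sum>a\<in>A. eval_power_sums s (P a))"
  by (simp add: eval_power_sums_def fun_eq_iff substitute_simps sum_seq_apply)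

lemma eval_power_sums_product:
  "eval_power_sums s (\<Prod>t<length \<tau>. Var (\<tau> ! t)) = power_sum_product s \<tau>"
  by (simp add: eval_power_sums_def fun_eq_iff substitute_simps power_sum_product_def prod_seq_apply)

lemma eval_power_sums_mem: "vars_in X P \<Longrightarrow> eval_power_sums s P \<in> Sym_step s"
  by (induction rule: mpoly_induct)
    (simp_all only: eval_power_sums_simps Sym_step_Const step_power_sum_mem Sym_step_add Sym_step_mult)

text \<open>The partition lists the indices of the variables with multiplicity; positivity of its
  parts is the condition that all indices are at least 1.\<close>

lemma monomial_as_partition:
  assumes "keys m \<subseteq> {1..}"
  obtains \<tau> where "\<tau> \<in> partitions" "single m 1 = (\<Prod>t<length \<tau>. Var (\<tau> ! t) :: 'a::comm_ring_1 mpoly)"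
proof -
  have "\<exists>xs. set xs \<subseteq> A \<and> (\<Prod>i\<in>A. Var i ^ f i) = (prod_list (map Var xs) :: 'a mpoly)"
    if "finite A" for A and f :: "nat \<Rightarrow> nat"
    using that
  proof (induction A)
    case (insert a A)
    then obtain xs where "set xs \<subseteq> A" "(\<Prod>i\<in>A. Var i ^ f i) = (prod_list (map Var xs) :: 'a mpoly)" by blast
    then show ?case using insert.hyps by (intro exI[of _ "replicate (f a) a @ xs"]) auto
  qed simp
  from this[of "keys m" "lookup m"] obtain xs where
    xs: "set xs \<subseteq> keys m" "single m 1 = (prod_list (map Var xs) :: 'a mpoly)"
    by (auto simp: single_eq_prod[of m])
  define \<tau> where "\<tau> = rev (sort xs)"
  have "\<tau> \<in> partitions" using xs(1) assms by (auto simp: partitions_def \<tau>_def sorted_wrt_rev)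
  moreover have "prod_list (map Var xs) = (prod_list (map Var \<tau>) :: 'a mpoly)"
    unfolding prod_mset_prod_list[symmetric] by (simp add: \<tau>_def)
  then have "single m 1 = (\<Prod>t<length \<tau>. Var (\<tau> ! t) :: 'a mpoly)"
    by (simp add: xs(2) prod.list_conv_set_nth atLeast0LessThan)
  ultimately show thesis by (rule that)
qed

text \<open>Distinct monomials correspond to distinct partitions, so a relation among power sums is
  a linear relation among products of power sums.\<close>

lemma eval_power_sums_eq_0D:
  fixes P :: "'a::field_char_0 mpoly"
  assumes P: "vars_in {1..} P" and zero: "eval_power_sums s P = 0"
  shows "P = 0"
proof -
  interpret triangular_family s "power_sum_product s" length by (rule triangular_family_power_sum_product)
  have "\<exists>\<tau>. \<tau> \<in> partitions \<and> single m 1 = (\<Prod>t<length \<tau>. Var (\<tau> ! t) :: 'a mpoly)" if "m \<in> keys P" for m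
    using monomial_as_partition[of m] P that unfolding vars_in_def by metis
  then obtain \<tau> where \<tau>: "\<And>m. m \<in> keys P \<Longrightarrow> \<tau> m \<in> partitions"
    "\<And>m. m \<in> keys P \<Longrightarrow> single m 1 = (\<Prod>t<length (\<tau> m). Var (\<tau> m ! t) :: 'a mpoly)" by metis
  have inj: "inj_on \<tau> (keys P)"
  proof (rule inj_onI)
    fix m n assume "m \<in> keys P" "n \<in> keys P" "\<tau> m = \<tau> n"
    then have "single m (1::'a) = single n 1" using \<tau>(2) by metis
    then show "m = n" by (metis keys_single singleton_inject zero_neq_one)
  qed
  have "P = (\<Sum>m\<in>keys P. Const (lookup P m) * single m 1)"
    by (subst mpoly_expand) (simp add: Const_def mult_single)
  also have "\<dots> = (\<Sum>m\<in>keys P. Const (lookup P m) * (\<Prod>t<length (\<tau> m). Var (\<tau> m ! t)))"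
    by (intro sum.cong) (simp_all add: \<tau>(2))
  finally have "eval_power_sums s P
      = eval_power_sums s (\<Sum>m\<in>keys P. Const (lookup P m) * (\<Prod>t<length (\<tau> m). Var (\<tau> m ! t)))"
    by (rule arg_cong)
  also have "\<dots> = (\<Sum>m\<in>keys P. scale (lookup P m) (power_sum_product s (\<tau> m)))"
    by (simp only: eval_power_sums_sum eval_power_sums_scale eval_power_sums_product)
  also have "\<dots> = (\<Sum>\<kappa>\<in>\<tau> ` keys P. scale (lookup P (inv_into (keys P) \<tau> \<kappa>)) (power_sum_product s \<kappa>))"
    using inj by (subst sum.reindex) (auto intro!: sum.cong)
  finally have "lookup P (inv_into (keys P) \<tau> \<kappa>) = 0" if "\<kappa> \<in> \<tau> ` keys P" for \<kappa>
    using independent[of "\<tau> ` keys P" "\<lambda>\<kappa>. lookup P (inv_into (keys P) \<tau> \<kappa>)" \<kappa>] zero \<tau>(1) that by auto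
  then have "lookup P m = 0" if "m \<in> keys P" for m using that inj by (metis imageI inv_into_f_f)
  then show ?thesis by (intro poly_mapping_eqI) (metis in_keys_iff lookup_zero)
qed

text \<open>Injectivity is the linear independence of the products of power sums, surjectivity the
  fact that they span.\<close>

lemma bij_betw_eval_power_sums: "bij_betw (eval_power_sums s) {P. vars_in {1..} P} (Sym_step s)"
  unfolding bij_betw_def
proof
  have minus: "P - Q = P + Const (-1) * Q" for P Q :: "'a mpoly" by (simp add: Const_uminus)
  show "inj_on (eval_power_sums s) {P. vars_in {1..} P}"
  proof (rule inj_onI)
    fix P Q assume PQ: "P \<in> {P. vars_in {1..} P}" "Q \<in> {P. vars_in {1..} P}" "eval_power_sums s P = eval_power_sums s Q"
    have "eval_power_sums s (P - Q) = 0"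
      unfolding minus eval_power_sums_simps(1) eval_power_sums_scale PQ(3) by (simp add: fun_eq_iff Const_uminus)
    then have "P - Q = 0" using PQ by (intro eval_power_sums_eq_0D) auto
    then show "P = Q" by simp
  qed
  show "eval_power_sums s ` {P. vars_in {1..} P} = Sym_step s"
  proof (intro equalityI subsetI)
    fix f assume "f \<in> Sym_step s"
    interpret triangular_family s "power_sum_product s" length by (rule triangular_family_power_sum_product)
    obtain A a where A: "finite A" "A \<subseteq> partitions" "f = (\<Sum>\<tau>\<in>A. scale (a \<tau>) (power_sum_product s \<tau>))"
      using spans[OF \<open>f \<in> Sym_step s\<close>] by (auto simp: partition_span_def)
    let ?P = "\<Sum>\<tau>\<in>A. Const (a \<tau>) * (\<Prod>t<length \<tau>. Var (\<tau> ! t))"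
    have "f = eval_power_sums s ?P"
      by (simp add: A(3) eval_power_sums_sum eval_power_sums_scale eval_power_sums_product)
    moreover have "vars_in {1..} ?P"
      using A(2) partition_nth_pos by (intro vars_in_sum vars_in_mult vars_in_prod vars_in_Var) auto
    ultimately show "f \<in> eval_power_sums s ` {P. vars_in {1..} P}" by blast
  qed (auto intro: eval_power_sums_mem)
qed

text \<open>Both algebras are polynomial algebras on their power sums, so the map writes an element
  as a polynomial in the p_k^* and evaluates the same polynomial at the p_k.\<close>

lemma star_iso_exists:
  "\<exists>\<Phi> :: 'a::field_char_0 mpoly_seq \<Rightarrow> 'a mpoly_seq.
     algebra_iso Sym_star Sym \<Phi> \<and> (\<forall>k\<ge>1. \<Phi> (power_sum_star k) = power_sum k)"
proof -
  let ?X = "{P :: 'a mpoly. vars_in {1..} P}"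
  let ?\<Phi> = "\<lambda>f. eval_power_sums 0 (inv_into ?X (eval_power_sums 1) f)"
  note bij = bij_betw_eval_power_sums[of "1::'a"] bij_betw_eval_power_sums[of "0::'a"]
  have \<Phi>: "?\<Phi> (eval_power_sums 1 P) = eval_power_sums 0 P" if "vars_in {1..} P" for P
    using bij_betw_inv_into_left[OF bij(1), of P] that by simp
  have ex: "\<exists>P. vars_in {1..} P \<and> f = eval_power_sums 1 P" if "f \<in> Sym_star" for f :: "'a mpoly_seq"
    using bij_betw_imp_surj_on[OF bij(1)] that unfolding Sym_step_1 by (metis imageE mem_Collect_eq)
  have one: "(1 :: 'a mpoly_seq) = eval_power_sums s 1" for s
    using eval_power_sums_simps(3)[of s 1] by (simp add: one_fun_def)
  have "bij_betw (eval_power_sums 0 \<circ> inv_into ?X (eval_power_sums 1)) (Sym_step 1) (Sym_step 0)"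
    using bij by (intro bij_betw_trans[OF bij_betw_inv_into])
  then have "bij_betw ?\<Phi> Sym_star Sym" by (simp add: Sym_step_0 Sym_step_1 o_def)
  moreover have "?\<Phi> 1 = 1" using \<Phi>[of 1] one by simp
  moreover have "?\<Phi> (f + g) = ?\<Phi> f + ?\<Phi> g \<and> ?\<Phi> (f * g) = ?\<Phi> f * ?\<Phi> g" if fg: "f \<in> Sym_star" "g \<in> Sym_star" for f g
  proof -
    obtain P where "vars_in {1..} P" "f = eval_power_sums 1 P" using ex[OF fg(1)] by blast
    moreover obtain Q where "vars_in {1..} Q" "g = eval_power_sums 1 Q" using ex[OF fg(2)] by blast
    ultimately
    show ?thesis
      using \<Phi>[of P] \<Phi>[of Q] \<Phi>[of "P + Q"] \<Phi>[of "P * Q"]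
      by (simp only: eval_power_sums_simps vars_in_add vars_in_mult)
  qed
  moreover have "?\<Phi> (scale c f) = scale c (?\<Phi> f)" if f: "f \<in> Sym_star" for c f
  proof -
    obtain P where "vars_in {1..} P" "f = eval_power_sums 1 P" using ex[OF f] by blast
    then show ?thesis
      using \<Phi>[of P] \<Phi>[of "Const c * P"] by (simp add: eval_power_sums_scale vars_in_mult)
  qed
  moreover have "?\<Phi> (power_sum_star k) = power_sum k" if "1 \<le> k" for k
    using \<Phi>[of "Var k"] that by (simp add: eval_power_sums_simps step_power_sum_0 step_power_sum_1)
  ultimately show ?thesis unfolding algebra_iso_def by (intro exI[of _ ?\<Phi>]) blast
qed

lemma star_iso_algebra_iso: "algebra_iso Sym_star Sym (star_iso :: 'a::field_char_0 mpoly_seq \<Rightarrow> _)"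
  unfolding star_iso_def using someI_ex[OF star_iso_exists] by blast


section \<open>Standard tableaux\<close>

definition standard_fillings :: "(nat \<times> nat) set \<Rightarrow> (nat \<times> nat \<Rightarrow> nat) set" where
  "standard_fillings D = {T \<in> D \<rightarrow>\<^sub>E {1..card D}. bij_betw T D {1..card D} \<and>
     (\<forall>i j. (i, j) \<in> D \<and> (i, Suc j) \<in> D \<longrightarrow> T (i, j) < T (i, Suc j)) \<and>
     (\<forall>i j. (i, j) \<in> D \<and> (Suc i, j) \<in> D \<longrightarrow> T (i, j) < T (Suc i, j))}"

definition corners :: "(nat \<times> nat) set \<Rightarrow> (nat \<times> nat) set" where
  "corners D = {(i, j) \<in> D. (i, Suc j) \<notin> D \<and> (Suc i, j) \<notin> D}"

lemma skew_dim_eq: "skew_dim \<nu> \<mu> = card (standard_fillings (diagram \<nu> - diagram \<mu>))"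
  by (simp add: skew_dim_def skew_standard_tableaux_def standard_fillings_def Let_def)

lemma finite_standard_fillings: "finite D \<Longrightarrow> finite (standard_fillings D)"
  by (rule finite_subset[of _ "D \<rightarrow>\<^sub>E {1..card D}"]) (auto simp: standard_fillings_def finite_PiE)

lemma card_standard_fillings_empty: "card (standard_fillings {}) = 1"
proof -
  have "standard_fillings {} = {\<lambda>_. undefined}"
    by (auto simp: standard_fillings_def bij_betw_def)
  then show ?thesis by simp
qed

lemma standard_fillings_less:
  assumes "T \<in> standard_fillings D" "(i, j) \<in> D" "x \<in> D" "x = (i, Suc j) \<or> x = (Suc i, j)"
  shows "T (i, j) < T x"
  using assms unfolding standard_fillings_def by blast

lemma standard_filling_max_corner:
  assumes T: "T \<in> standard_fillings D" and b: "b \<in> D" "T b = card D"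
  shows "b \<in> corners D"
proof -
  have le: "T x \<le> card D" if "x \<in> D" for x
    using T that by (auto simp: standard_fillings_def PiE_iff)
  obtain i j where ij: "b = (i, j)" by force
  have "(i, Suc j) \<notin> D"
  proof
    assume *: "(i, Suc j) \<in> D"
    then have "T (i, j) < T (i, Suc j)" using standard_fillings_less[OF T] b ij by blast
    with le[OF *] show False using b(2) ij by simp
  qed
  moreover have "(Suc i, j) \<notin> D"
  proof
    assume *: "(Suc i, j) \<in> D"
    then have "T (i, j) < T (Suc i, j)" using standard_fillings_less[OF T] b ij by blast
    with le[OF *] show False using b(2) ij by simp
  qed
  ultimately show ?thesis using b(1) ij by (simp add: corners_def)
qed

text \<open>The inverse map writes the largest entry back into \<open>b\<close>. A corner has no
  right or lower neighbour in \<open>D\<close>, so this violates no inequality.\<close>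

lemma standard_fillings_remove:
  assumes D: "finite D" and b: "b \<in> corners D"
  shows "bij_betw (\<lambda>T. restrict T (D - {b})) {T \<in> standard_fillings D. T b = card D} (standard_fillings (D - {b}))"
proof (rule bij_betw_byWitness[where f' = "\<lambda>T. T(b := card D)"])
  let ?n = "card D" and ?E = "D - {b}"
  have bD: "b \<in> D" using b by (auto simp: corners_def)
  then have card: "card ?E = ?n - 1" "?n > 0" using D by (auto simp: card_gt_0_iff)
  have ins: "insert ?n {1..?n - 1} = {1..?n}" "?n \<notin> {1..?n - 1}" using card(2) by auto
  show "\<forall>T\<in>{T \<in> standard_fillings D. T b = ?n}. (restrict T ?E)(b := ?n) = T"
  proof
    fix T assume T: "T \<in> {T \<in> standard_fillings D. T b = ?n}"
    then have "T \<in> D \<rightarrow>\<^sub>E {1..?n}" by (simp add: standard_fillings_def)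
    with T show "(restrict T ?E)(b := ?n) = T"
      by (auto simp: fun_eq_iff PiE_iff extensional_def)
  qed
  show "\<forall>T\<in>standard_fillings ?E. restrict (T(b := ?n)) ?E = T"
    by (auto simp: standard_fillings_def fun_eq_iff PiE_iff extensional_def)
  show "(\<lambda>T. restrict T ?E) ` {T \<in> standard_fillings D. T b = ?n} \<subseteq> standard_fillings ?E"
  proof (rule image_subsetI)
    fix T assume T: "T \<in> {T \<in> standard_fillings D. T b = ?n}"
    then have bij: "bij_betw T D {1..?n}" by (simp add: standard_fillings_def)
    have "bij_betw T ?E ({1..?n} - {T b})"
      using bij bD by (intro bij_betw_DiffI) (auto simp: bij_betw_def)
    moreover have "{1..?n} - {T b} = {1..card ?E}" using T card ins by auto
    ultimately have "bij_betw T ?E {1..card ?E}" by simp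
    then have "bij_betw (restrict T ?E) ?E {1..card ?E}"
      by (subst bij_betw_cong[of _ _ T]) auto
    moreover from this have "restrict T ?E \<in> ?E \<rightarrow>\<^sub>E {1..card ?E}"
      by (auto simp: bij_betw_def)
    ultimately show "restrict T ?E \<in> standard_fillings ?E"
      using T by (auto simp: standard_fillings_def)
  qed
  show "(\<lambda>T. T(b := ?n)) ` standard_fillings ?E \<subseteq> {T \<in> standard_fillings D. T b = ?n}"
  proof (rule image_subsetI)
    fix T assume T: "T \<in> standard_fillings ?E"
    then have bij: "bij_betw T ?E {1..?n - 1}" by (simp add: standard_fillings_def card)
    let ?T = "T(b := ?n)"
    have "bij_betw ?T ?E {1..?n - 1}" using bij by (subst bij_betw_cong[of _ _ T]) auto
    then have "bij_betw ?T (insert b ?E) (insert (?T b) {1..?n - 1})"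
      using notIn_Un_bij_betw[of b ?E ?T "{1..?n - 1}"] ins(2) by simp
    then have bijT: "bij_betw ?T D {1..?n}"
      using bD ins(1) by (simp add: insert_absorb)
    have "?T \<in> D \<rightarrow>\<^sub>E {1..?n}"
      using bijT T bD by (auto simp: bij_betw_def standard_fillings_def PiE_iff extensional_def)
    moreover have less: "T x < ?n" if "x \<in> ?E" for x
    proof -
      have "T x \<in> {1..?n - 1}" using bij_betwE[OF bij] that by blast
      then show ?thesis using card(2) by auto
    qed
    have "?T (i, j) < ?T x" if "(i, j) \<in> D" "x \<in> D" "x = (i, Suc j) \<or> x = (Suc i, j)" for i j x
    proof -
      have "(i, j) \<noteq> b" using b that by (auto simp: corners_def)
      then have ij: "(i, j) \<in> ?E" using that by simp
      show ?thesis
      proof (cases "x = b")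
        case True
        then show ?thesis using less[OF ij] \<open>(i, j) \<noteq> b\<close> by simp
      next
        case False
        then have "T (i, j) < T x" using standard_fillings_less[OF T ij] that by blast
        then show ?thesis using False \<open>(i, j) \<noteq> b\<close> by simp
      qed
    qed
    ultimately show "?T \<in> {T \<in> standard_fillings D. T b = ?n}"
      using bijT unfolding standard_fillings_def by simp
  qed
qed

text \<open>Fillings are sorted by the position of their largest entry, which is always a
  corner.\<close>

lemma card_standard_fillings_rec:
  assumes D: "finite D" "D \<noteq> {}"
  shows "card (standard_fillings D) = (\<Sum>b\<in>corners D. card (standard_fillings (D - {b})))"
proof -
  let ?S = "\<lambda>b. {T \<in> standard_fillings D. T b = card D}"
  have fin: "finite (corners D)" by (rule finite_subset[OF _ D(1)]) (auto simp: corners_def)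
  have pos: "card D \<in> {1..card D}" using D by (simp add: Suc_le_eq card_gt_0_iff)
  have "standard_fillings D = (\<Union>b\<in>corners D. ?S b)"
  proof (intro equalityI subsetI)
    fix T assume T: "T \<in> standard_fillings D"
    then have "bij_betw T D {1..card D}" by (simp add: standard_fillings_def)
    then have "card D \<in> T ` D" using pos by (simp add: bij_betw_def)
    then obtain b where b: "b \<in> D" "T b = card D" by auto
    then have "b \<in> corners D" by (rule standard_filling_max_corner[OF T])
    then show "T \<in> (\<Union>b\<in>corners D. ?S b)" using T b by blast
  qed auto
  also have "card \<dots> = (\<Sum>b\<in>corners D. card (?S b))"
  proof (rule card_UN_disjoint[OF fin])
    show "\<forall>b\<in>corners D. finite (?S b)" using finite_standard_fillings[OF D(1)] by simp
    have "b = b'" if "b \<in> corners D" "b' \<in> corners D" "T \<in> ?S b" "T \<in> ?S b'" for b b' T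
    proof -
      have "inj_on T D" using that(3) by (auto simp: standard_fillings_def bij_betw_def)
      moreover have "b \<in> D" "b' \<in> D" "T b = T b'" using that by (auto simp: corners_def)
      ultimately show ?thesis by (simp only: inj_on_eq_iff)
    qed
    then show "\<forall>b\<in>corners D. \<forall>b'\<in>corners D. b \<noteq> b' \<longrightarrow> ?S b \<inter> ?S b' = {}" by blast
  qed
  also have "\<dots> = (\<Sum>b\<in>corners D. card (standard_fillings (D - {b})))"
    using bij_betw_same_card[OF standard_fillings_remove[OF D(1)]] by simp
  finally show ?thesis .
qed

subsection \<open>Removing a box from a partition\<close>

lemma in_diagram: "(i, j) \<in> diagram \<nu> \<longleftrightarrow> 1 \<le> i \<and> 1 \<le> j \<and> j \<le> Defs.row \<nu> i"
  by (simp add: diagram_def)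

lemma diagram_eq_Sigma: "diagram \<nu> = Sigma {1..length \<nu>} (\<lambda>i. {1..Defs.row \<nu> i})"
  by (auto simp: diagram_def row_def split: if_splits)

lemma finite_diagram [simp]: "finite (diagram \<nu>)"
  by (simp add: diagram_eq_Sigma)

lemma card_diagram: "card (diagram \<nu>) = sum_list \<nu>"
proof -
  have "card (diagram \<nu>) = (\<Sum>i\<in>{1..length \<nu>}. Defs.row \<nu> i)" by (simp add: diagram_eq_Sigma)
  also have "\<dots> = (\<Sum>i<length \<nu>. \<nu> ! i)" by (simp add: sum.atLeast1_atMost_eq row_def)
  finally show ?thesis by (simp add: sum_nth_lessThan)
qed

lemma subpartitions_iff:
  "\<mu> \<in> subpartitions \<nu> \<longleftrightarrow> \<mu> \<in> partitions \<and> (\<forall>i\<ge>1. Defs.row \<mu> i \<le> Defs.row \<nu> i)"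
proof -
  have "diagram \<mu> \<subseteq> diagram \<nu> \<longleftrightarrow> (\<forall>i\<ge>1. Defs.row \<mu> i \<le> Defs.row \<nu> i)"
  proof
    assume sub: "diagram \<mu> \<subseteq> diagram \<nu>"
    show "\<forall>i\<ge>1. Defs.row \<mu> i \<le> Defs.row \<nu> i"
    proof (intro allI impI)
      fix i :: nat assume "1 \<le> i"
      then show "Defs.row \<mu> i \<le> Defs.row \<nu> i"
        using subsetD[OF sub, of "(i, Defs.row \<mu> i)"] by (cases "Defs.row \<mu> i = 0") (auto simp: in_diagram)
    qed
  qed (fastforce simp: diagram_def)
  then show ?thesis by (simp add: subpartitions_def)
qed

lemma subpartitions_self: "\<nu> \<in> partitions \<Longrightarrow> \<nu> \<in> subpartitions \<nu>"
  by (simp add: subpartitions_iff)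

lemma subpartitions_partitions: "\<mu> \<in> subpartitions \<nu> \<Longrightarrow> \<mu> \<in> partitions"
  by (simp add: subpartitions_iff)

lemma subpartitions_trans: "\<mu> \<in> subpartitions \<kappa> \<Longrightarrow> \<kappa> \<in> subpartitions \<nu> \<Longrightarrow> \<mu> \<in> subpartitions \<nu>"
  by (fastforce simp: subpartitions_iff intro: order_trans)

lemma length_subpartitions:
  assumes "\<mu> \<in> subpartitions \<nu>" "\<nu> \<in> partitions"
  shows "length \<mu> \<le> length \<nu>"
proof (rule ccontr)
  assume "\<not> length \<mu> \<le> length \<nu>"
  moreover have "Defs.row \<mu> (length \<mu>) \<le> Defs.row \<nu> (length \<mu>)"
    using assms(1) calculation by (simp add: subpartitions_iff)
  ultimately show False
    using row_eq_0_iff[OF assms(2), of "length \<mu>"] row_eq_0_iff[of \<mu> "length \<mu>"] assms(1)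
    by (simp add: subpartitions_iff)
qed

lemma card_skew_diagram:
  assumes "\<mu> \<in> subpartitions \<nu>"
  shows "card (diagram \<nu> - diagram \<mu>) = sum_list \<nu> - sum_list \<mu>" "sum_list \<mu> \<le> sum_list \<nu>"
  using assms card_Diff_subset[of "diagram \<mu>" "diagram \<nu>"] card_mono[of "diagram \<nu>" "diagram \<mu>"]
  by (simp_all add: subpartitions_def card_diagram)

lemma subpartition_eqI:
  assumes "\<mu> \<in> subpartitions \<nu>" "\<nu> \<in> partitions" "diagram \<nu> - diagram \<mu> = {}"
  shows "\<mu> = \<nu>"
proof (rule partition_eqI)
  have "\<nu> \<in> subpartitions \<mu>" using assms by (simp add: subpartitions_def)
  then show "Defs.row \<mu> i = Defs.row \<nu> i" if "1 \<le> i" for i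
    using assms(1) that by (simp add: subpartitions_iff antisym)
qed (use assms in \<open>simp_all add: subpartitions_iff\<close>)

definition removable_rows :: "nat list \<Rightarrow> nat set" where
  "removable_rows \<nu> = {i. 1 \<le> i \<and> Defs.row \<nu> (Suc i) < Defs.row \<nu> i}"

text \<open>The filter deletes a row whose only box is removed, so that the result again lists
  nonzero rows only.\<close>

definition remove_box :: "nat list \<Rightarrow> nat \<Rightarrow> nat list" where
  "remove_box \<nu> i = filter (\<lambda>x. x \<noteq> 0) (\<nu>[i - 1 := \<nu> ! (i - 1) - 1])"

lemma removable_rows_le: "i \<in> removable_rows \<nu> \<Longrightarrow> 1 \<le> i \<and> i \<le> length \<nu>"
  by (auto simp: removable_rows_def row_def split: if_splits)

lemma removable_rows_pos: "i \<in> removable_rows \<nu> \<Longrightarrow> 0 < i"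
  by (simp add: removable_rows_def)

lemma finite_removable_rows [simp]: "finite (removable_rows \<nu>)"
  by (rule finite_subset[of _ "{1..length \<nu>}"]) (auto dest: removable_rows_le)

lemma remove_box:
  assumes \<nu>: "\<nu> \<in> partitions" and i: "i \<in> removable_rows \<nu>"
  shows "remove_box \<nu> i \<in> partitions"
    and "Defs.row (remove_box \<nu> i) k = (if k = i then Defs.row \<nu> i - 1 else Defs.row \<nu> k)"
proof -
  note i' = removable_rows_le[OF i]
  let ?ys = "\<nu>[i - 1 := \<nu> ! (i - 1) - 1]"
  have row_ys: "Defs.row ?ys k = (if k = i then Defs.row \<nu> i - 1 else Defs.row \<nu> k)" for k
    using i' by (auto simp: row_def nth_list_update)
  have "Defs.row ?ys (Suc k) \<ge> Defs.row ?ys (Suc l)" if "k < l" for k l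
    unfolding row_ys
    using row_antimono[OF \<nu>, of "Suc k" "Suc l"] row_antimono[OF \<nu>, of "Suc i" "Suc l"] that i
    by (auto simp: removable_rows_def)
  then have "?ys ! l \<le> ?ys ! k" if "k < l" "l < length ?ys" for k l
    using that by (force simp: row_def)
  then have sorted: "sorted_wrt (\<ge>) ?ys" by (simp add: sorted_wrt_iff_nth_less)
  then show "remove_box \<nu> i \<in> partitions"
    by (auto simp: remove_box_def partitions_def sorted_wrt_filter)
  obtain m where m: "?ys = remove_box \<nu> i @ replicate m 0"
    unfolding remove_box_def using sorted_filter_zeros[OF sorted] by blast
  have "Defs.row (xs @ replicate m 0) k = Defs.row xs k" for xs :: "nat list"
    by (auto simp: row_def nth_append)
  from this[of "remove_box \<nu> i"]
  show "Defs.row (remove_box \<nu> i) k = (if k = i then Defs.row \<nu> i - 1 else Defs.row \<nu> k)"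
    by (simp only: m[symmetric] row_ys)
qed

lemma diagram_remove_box:
  assumes "\<nu> \<in> partitions" "i \<in> removable_rows \<nu>"
  shows "diagram (remove_box \<nu> i) = diagram \<nu> - {(i, Defs.row \<nu> i)}"
  using assms(2) by (auto simp: diagram_def remove_box(2)[OF assms] removable_rows_def split: if_splits)

lemma removed_box_in_diagram: "i \<in> removable_rows \<nu> \<Longrightarrow> (i, Defs.row \<nu> i) \<in> diagram \<nu>"
  by (auto simp: removable_rows_def diagram_def)

lemma sum_list_remove_box:
  assumes "\<nu> \<in> partitions" "i \<in> removable_rows \<nu>"
  shows "Suc (sum_list (remove_box \<nu> i)) = sum_list \<nu>"
  using card_Diff_singleton[OF removed_box_in_diagram[OF assms(2)]] card_gt_0_iff[of "diagram \<nu>"]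
    removed_box_in_diagram[OF assms(2)]
  by (auto simp: diagram_remove_box[OF assms] simp flip: card_diagram)

lemma subpartitions_remove_box:
  assumes "\<nu> \<in> partitions" "i \<in> removable_rows \<nu>"
  shows "\<mu> \<in> subpartitions (remove_box \<nu> i) \<longleftrightarrow> \<mu> \<in> subpartitions \<nu> \<and> (i, Defs.row \<nu> i) \<notin> diagram \<mu>"
  by (auto simp: subpartitions_def diagram_remove_box[OF assms])

text \<open>A box to the right of or below a box outside \<mu> is itself outside \<mu>, so whether a
  box of the skew diagram is a corner is decided by \<nu> alone.\<close>

lemma corners_skew_diagram:
  assumes \<nu>: "\<nu> \<in> partitions" and \<mu>: "\<mu> \<in> partitions"
  shows "corners (diagram \<nu> - diagram \<mu>)
    = (\<lambda>i. (i, Defs.row \<nu> i)) ` {i \<in> removable_rows \<nu>. (i, Defs.row \<nu> i) \<notin> diagram \<mu>}" (is "?L = ?R")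
proof (intro equalityI subsetI)
  fix b assume "b \<in> ?L"
  then obtain i j where b: "b = (i, j)" "(i, j) \<in> diagram \<nu>" "(i, j) \<notin> diagram \<mu>"
    "(i, Suc j) \<notin> diagram \<nu> - diagram \<mu>" "(Suc i, j) \<notin> diagram \<nu> - diagram \<mu>"
    by (auto simp: corners_def)
  have "(i, Suc j) \<notin> diagram \<nu>" "(Suc i, j) \<notin> diagram \<nu>"
    using b row_antimono[OF \<mu>, of i "Suc i"] by (auto simp: diagram_def)
  then have "j = Defs.row \<nu> i" "Defs.row \<nu> (Suc i) < Defs.row \<nu> i"
    using b(2) by (auto simp: diagram_def)
  then show "b \<in> ?R" using b by (auto simp: removable_rows_def diagram_def)
next
  fix b assume "b \<in> ?R"
  then show "b \<in> ?L" by (auto simp: corners_def removable_rows_def diagram_def)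
qed

lemma skew_dim_self: "skew_dim \<nu> \<nu> = 1"
  by (simp add: skew_dim_eq card_standard_fillings_empty)

lemma skew_dim_rec:
  assumes \<nu>: "\<nu> \<in> partitions" and \<mu>: "\<mu> \<in> subpartitions \<nu>" "\<mu> \<noteq> \<nu>"
  shows "skew_dim \<nu> \<mu>
    = (\<Sum>i | i \<in> removable_rows \<nu> \<and> \<mu> \<in> subpartitions (remove_box \<nu> i). skew_dim (remove_box \<nu> i) \<mu>)"
proof -
  let ?D = "diagram \<nu> - diagram \<mu>" and ?b = "\<lambda>i. (i, Defs.row \<nu> i)"
  let ?I = "{i \<in> removable_rows \<nu>. ?b i \<notin> diagram \<mu>}"
  have "?D \<noteq> {}" using subpartition_eqI[OF \<mu>(1) \<nu>] \<mu>(2) by blast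
  then have "skew_dim \<nu> \<mu> = (\<Sum>b\<in>?b ` ?I. card (standard_fillings (?D - {b})))"
    by (simp add: skew_dim_eq card_standard_fillings_rec
        flip: corners_skew_diagram[OF \<nu> subpartitions_partitions[OF \<mu>(1)]])
  also have "\<dots> = (\<Sum>i\<in>?I. card (standard_fillings (?D - {?b i})))"
    by (subst sum.reindex) (auto simp: inj_on_def)
  also have "\<dots> = (\<Sum>i\<in>?I. skew_dim (remove_box \<nu> i) \<mu>)"
  proof (rule sum.cong)
    fix i assume "i \<in> ?I"
    then have "?D - {?b i} = diagram (remove_box \<nu> i) - diagram \<mu>"
      using diagram_remove_box[OF \<nu>, of i] by blast
    then show "card (standard_fillings (?D - {?b i})) = skew_dim (remove_box \<nu> i) \<mu>"
      by (simp add: skew_dim_eq)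
  qed simp
  also have "?I = {i. i \<in> removable_rows \<nu> \<and> \<mu> \<in> subpartitions (remove_box \<nu> i)}"
    using subpartitions_remove_box[OF \<nu>] \<mu>(1) by auto
  finally show ?thesis .
qed

lemma skew_pochhammer_self [simp]: "skew_pochhammer z \<nu> \<nu> = 1"
  by (simp add: skew_pochhammer_def)

lemma skew_pochhammer_remove_box:
  assumes \<nu>: "\<nu> \<in> partitions" and i: "i \<in> removable_rows \<nu>" and \<mu>: "\<mu> \<in> subpartitions (remove_box \<nu> i)"
  shows "skew_pochhammer z \<nu> \<mu>
    = (z + of_int (int (Defs.row \<nu> i) - int i)) * skew_pochhammer z (remove_box \<nu> i) \<mu>"
proof -
  let ?b = "(i, Defs.row \<nu> i)"
  have b: "?b \<in> diagram \<nu> - diagram \<mu>"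
    using removed_box_in_diagram[OF i] subpartitions_remove_box[OF \<nu> i] \<mu> by blast
  have "diagram (remove_box \<nu> i) - diagram \<mu> = diagram \<nu> - diagram \<mu> - {?b}"
    using diagram_remove_box[OF \<nu> i] by blast
  then show ?thesis
    unfolding skew_pochhammer_def using b by (subst prod.remove[of _ ?b]) (simp_all add: content_def)
qed

section \<open>Determinants of monic polynomials\<close>

text \<open>On \<open>N\<close>-tuples of exponents, removing a box from the row \<open>i\<close> lowers the exponent \<open>n\<^sub>i\<close>. For
  \<open>z = N\<close> and \<open>z' = N + c - 1\<close> the attached weight \<open>(z + content) (z' + content)\<close> is
  \<open>n\<^sub>i (c + n\<^sub>i - 1)\<close>, hence depends on \<open>n\<^sub>i\<close> alone, and the expansion over subpartitions becomes
  a product of expansions in one variable. Both sides are compared as solutions of the same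
  differential equation in an auxiliary variable.\<close>

definition lowering_weight :: "'a::field_char_0 \<Rightarrow> nat \<Rightarrow> 'a" where
  "lowering_weight c n = of_nat n * (c + of_nat n - 1)"

text \<open>This is the binomial coefficient n over k times (c + k) (c + k + 1) ... (c + n - 1): up
  to sign, the coefficient of x^k in the monic Laguerre polynomial of degree n with parameter c -
  1.\<close>

definition lowering_coeff :: "'a::field_char_0 \<Rightarrow> nat \<Rightarrow> nat \<Rightarrow> 'a" where
  "lowering_coeff c n k = (\<Prod>m\<in>{k<..n}. lowering_weight c m) / fact (n - k)"

text \<open>The polynomial variable records the drop n - k; its specialization to
  \<open>Const (- \<eta>)\<close> gives \<open>monic_step\<close>.\<close>

definition monic_poly :: "'a::field_char_0 \<Rightarrow> 'a \<Rightarrow> nat \<Rightarrow> 'a mpoly \<Rightarrow> 'a mpoly poly" where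
  "monic_poly s c n x = (\<Sum>k\<le>n. monom (Const (lowering_coeff c n k) * step_power s x k) (n - k))"

definition branching_coeff :: "'a::field_char_0 \<Rightarrow> 'a \<Rightarrow> nat list \<Rightarrow> nat list \<Rightarrow> 'a" where
  "branching_coeff z z' \<nu> \<mu> = of_nat (skew_dim \<nu> \<mu>) / fact (sum_list \<nu> - sum_list \<mu>)
     * skew_pochhammer z \<nu> \<mu> * skew_pochhammer z' \<nu> \<mu>"

lemma lowering_coeff_self [simp]: "lowering_coeff c n n = 1"
  by (simp add: lowering_coeff_def)

lemma lowering_coeff_Suc:
  assumes "k \<le> n"
  shows "of_nat (Suc n - k) * lowering_coeff c (Suc n) k = lowering_weight c (Suc n) * lowering_coeff c n k"
proof -
  have "{k<..Suc n} = insert (Suc n) {k<..n}" using assms by auto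
  moreover have "Suc n - k = Suc (n - k)" using assms by simp
  ultimately show ?thesis
    by (simp add: lowering_coeff_def del: of_nat_Suc of_nat_add of_nat_diff)
qed

lemma pderiv_sum_set: "pderiv (sum f A) = (\<Sum>a\<in>A. pderiv (f a))"
  by (induction A rule: infinite_finite_induct) (simp_all add: pderiv_add)

lemma smult_sum_right: "smult c (sum f A) = (\<Sum>a\<in>A. smult c (f a))"
  by (induction A rule: infinite_finite_induct) (simp_all add: smult_add_right)

text \<open>Differentiation brings down n - k, which cancels against (n - k)! and turns the family
  into an Appell-type sequence. At \<open>n = 0\<close> the weight is 0, so the truncated
  \<open>n - 1\<close> does no harm.\<close>

lemma pderiv_monic_poly: "pderiv (monic_poly s c n x) = smult (Const (lowering_weight c n)) (monic_poly s c (n - 1) x)"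
proof (cases n)
  case 0
  then show ?thesis by (simp add: monic_poly_def pderiv_monom lowering_weight_def)
next
  case (Suc m)
  have "pderiv (monic_poly s c n x) = (\<Sum>k\<le>n. monom (of_nat (n - k) * (Const (lowering_coeff c n k) * step_power s x k)) (n - k - 1))"
    by (simp add: monic_poly_def pderiv_sum_set pderiv_monom)
  also have "\<dots> = (\<Sum>k\<le>m. monom (of_nat (n - k) * (Const (lowering_coeff c n k) * step_power s x k)) (n - k - 1))"
    by (simp add: Suc)
  also have "\<dots> = (\<Sum>k\<le>m. smult (Const (lowering_weight c n)) (monom (Const (lowering_coeff c m k) * step_power s x k) (m - k)))"
  proof (intro sum.cong refl)
    fix k assume "k \<in> {..m}"
    then have "Const (of_nat (n - k) * lowering_coeff c n k) = Const (lowering_weight c n * lowering_coeff c m k)"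
      using lowering_coeff_Suc[of k m c] by (simp add: Suc)
    then show "monom (of_nat (n - k) * (Const (lowering_coeff c n k) * step_power s x k)) (n - k - 1)
        = smult (Const (lowering_weight c n)) (monom (Const (lowering_coeff c m k) * step_power s x k) (m - k))"
      by (simp add: smult_monom Const_mult Const_of_nat mult.assoc[symmetric]) (simp add: Suc)
  qed
  finally show ?thesis by (simp add: monic_poly_def smult_sum_right Suc)
qed

definition monic_det :: "'a::field_char_0 \<Rightarrow> 'a \<Rightarrow> nat \<Rightarrow> (nat \<Rightarrow> nat) \<Rightarrow> 'a mpoly poly" where
  "monic_det s c N n = det (mat N N (\<lambda>(i, j). monic_poly s c (n i) (Var (Suc j))))"

lemma monic_det_Leibniz:
  "monic_det s c N n = (\<Sum>p | p permutes {0..<N}. signof p * (\<Prod>i<N. monic_poly s c (n i) (Var (Suc (p i)))))"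
  unfolding monic_det_def by (subst det_mat_transpose[symmetric]) (rule det_mat_Leibniz_columns)

lemma monic_det_cong: "(\<And>i. i < N \<Longrightarrow> n i = m i) \<Longrightarrow> monic_det s c N n = monic_det s c N m"
  unfolding monic_det_Leibniz by (intro sum.cong prod.cong arg_cong2[where f = "(*)"]) auto

lemma monic_det_eq_0:
  assumes "i < j" "j < N" "n i = n j"
  shows "monic_det s c N n = 0"
  unfolding monic_det_def
  by (rule det_identical_rows[of _ N i j]) (use assms in \<open>auto intro!: eq_vecI\<close>)

text \<open>The product rule in each Leibniz summand differentiates one row at a time, which lowers
  the exponent of that row.\<close>

lemma pderiv_monic_det:
  "pderiv (monic_det s c N n)
    = (\<Sum>i<N. smult (Const (lowering_weight c (n i))) (monic_det s c N (n(i := n i - 1))))"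
proof -
  let ?L = "\<lambda>m p i. monic_poly s c (m i) (Var (Suc (p i)))"
  have sgn: "pderiv (signof p * q) = signof p * pderiv q" for p :: "nat \<Rightarrow> nat" and q :: "'a mpoly poly"
    by (simp add: sign_def pderiv_minus)
  have row: "(\<Prod>l\<in>{..<N} - {i}. ?L n p l) * pderiv (?L n p i)
      = smult (Const (lowering_weight c (n i))) (\<Prod>l<N. ?L (n(i := n i - 1)) p l)" if "i < N" for p i
  proof -
    have "(\<Prod>l<N. ?L (n(i := n i - 1)) p l) = ?L (n(i := n i - 1)) p i * (\<Prod>l\<in>{..<N} - {i}. ?L (n(i := n i - 1)) p l)"
      using that by (subst prod.remove[of _ i]) auto
    also have "(\<Prod>l\<in>{..<N} - {i}. ?L (n(i := n i - 1)) p l) = (\<Prod>l\<in>{..<N} - {i}. ?L n p l)"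
      by (intro prod.cong) auto
    finally show ?thesis by (simp add: pderiv_monic_poly mult.commute)
  qed
  have "pderiv (monic_det s c N n) = (\<Sum>p | p permutes {0..<N}. \<Sum>i<N.
      signof p * smult (Const (lowering_weight c (n i))) (\<Prod>l<N. ?L (n(i := n i - 1)) p l))"
    unfolding monic_det_Leibniz pderiv_sum_set sgn pderiv_prod sum_distrib_left by (intro sum.cong refl) (simp add: row)
  also have "\<dots> = (\<Sum>i<N. \<Sum>p | p permutes {0..<N}.
      signof p * smult (Const (lowering_weight c (n i))) (\<Prod>l<N. ?L (n(i := n i - 1)) p l))"
    by (rule sum.swap)
  also have "\<dots> = (\<Sum>i<N. smult (Const (lowering_weight c (n i))) (monic_det s c N (n(i := n i - 1))))"
    unfolding monic_det_Leibniz smult_sum_right mult_smult_right ..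
  finally show ?thesis .
qed

lemma strict_exponents_remove_box:
  assumes "\<nu> \<in> partitions" "Suc i \<in> removable_rows \<nu>" "i < N" "l < N"
  shows "strict_exponents (remove_box \<nu> (Suc i)) N l = ((strict_exponents \<nu> N)(i := strict_exponents \<nu> N i - 1)) l"
  using assms(2-4) by (auto simp: strict_exponents_def remove_box(2)[OF assms(1,2)] removable_rows_def)

text \<open>Lowering a row that is not removable either makes two exponents equal, so the
  determinant vanishes, or meets exponent 0, where the weight vanishes. Only removable rows
  survive.\<close>

lemma pderiv_monic_det_partition:
  assumes \<nu>: "\<nu> \<in> partitions" and N: "length \<nu> \<le> N"
  shows "pderiv (monic_det s c N (strict_exponents \<nu> N))
    = (\<Sum>i\<in>removable_rows \<nu>. smult (Const (lowering_weight c (strict_exponents \<nu> N (i - 1))))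
        (monic_det s c N (strict_exponents (remove_box \<nu> i) N)))"
proof -
  let ?n = "strict_exponents \<nu> N"
  let ?t = "\<lambda>i. smult (Const (lowering_weight c (?n i))) (monic_det s c N (?n(i := ?n i - 1)))"
  have zero: "?t i = 0" if i: "i < N" "Suc i \<notin> removable_rows \<nu>" for i
  proof -
    have row: "Defs.row \<nu> (Suc i) = Defs.row \<nu> (Suc (Suc i))"
      using i(2) row_antimono[OF \<nu>, of "Suc i" "Suc (Suc i)"] by (auto simp: removable_rows_def)
    show ?thesis
    proof (cases "Suc i < N")
      case True
      then have "monic_det s c N (?n(i := ?n i - 1)) = 0"
        using row by (intro monic_det_eq_0[of i "Suc i"]) (auto simp: strict_exponents_def)
      then show ?thesis by simp
    next
      \<comment> \<open>This is row N. If it is not removable it is empty, so its exponent is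
        0.\<close>
      case False
      then have "?n i = 0" using row row_eq_0_iff[OF \<nu>, of "Suc (Suc i)"] N i(1)
        by (simp add: strict_exponents_def)
      then show ?thesis by (simp add: lowering_weight_def)
    qed
  qed
  have "pderiv (monic_det s c N ?n) = (\<Sum>i<N. ?t i)" by (rule pderiv_monic_det)
  also have "\<dots> = (\<Sum>i | i < N \<and> Suc i \<in> removable_rows \<nu>. ?t i)"
    using zero by (intro sum.mono_neutral_right) auto
  also have "\<dots> = (\<Sum>i\<in>removable_rows \<nu>. smult (Const (lowering_weight c (?n (i - 1))))
        (monic_det s c N (strict_exponents (remove_box \<nu> i) N)))"
  proof (rule sum.reindex_bij_witness[of _ "\<lambda>i. i - 1" Suc])
    fix i assume i: "i \<in> {i. i < N \<and> Suc i \<in> removable_rows \<nu>}"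
    then show "smult (Const (lowering_weight c (?n (Suc i - 1)))) (monic_det s c N (strict_exponents (remove_box \<nu> (Suc i)) N)) = ?t i"
      using strict_exponents_remove_box[OF \<nu>, of i N] by (simp cong: monic_det_cong)
  qed (use N removable_rows_pos in \<open>auto dest: removable_rows_le\<close>)
  finally show ?thesis .
qed

section \<open>The expansion over subpartitions as a polynomial in an auxiliary variable\<close>

lemma branching_coeff_self [simp]: "branching_coeff z z' \<nu> \<nu> = 1"
  by (simp add: branching_coeff_def skew_dim_self)

text \<open>The number of removed boxes cancels one factor of the factorial; the rest is the
  branching of standard tableaux, with the content factors of the removed box split off. For \<mu> =
  \<nu> both sides are 0.\<close>

lemma branching_coeff_rec:
  assumes \<nu>: "\<nu> \<in> partitions" and \<mu>: "\<mu> \<in> subpartitions \<nu>"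
  shows "of_nat (sum_list \<nu> - sum_list \<mu>) * branching_coeff z z' \<nu> \<mu>
    = (\<Sum>i | i \<in> removable_rows \<nu> \<and> \<mu> \<in> subpartitions (remove_box \<nu> i).
        (z + of_int (int (Defs.row \<nu> i) - int i)) * (z' + of_int (int (Defs.row \<nu> i) - int i))
        * branching_coeff z z' (remove_box \<nu> i) \<mu>)"
proof (cases "\<mu> = \<nu>")
  case True
  have "{i \<in> removable_rows \<nu>. \<nu> \<in> subpartitions (remove_box \<nu> i)} = {}"
    using subpartitions_remove_box[OF \<nu>] removed_box_in_diagram by blast
  then show ?thesis using True by (simp only: sum.empty diff_self_eq_0 of_nat_0 mult_zero_left)
next
  case False
  let ?I = "{i. i \<in> removable_rows \<nu> \<and> \<mu> \<in> subpartitions (remove_box \<nu> i)}"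
  let ?k = "sum_list \<nu> - sum_list \<mu>"
  have "?k \<noteq> 0"
    using card_skew_diagram[OF \<mu>] subpartition_eqI[OF \<mu> \<nu>] False by (metis card_0_eq finite_Diff finite_diagram)
  then have "of_nat ?k * branching_coeff z z' \<nu> \<mu>
      = of_nat (skew_dim \<nu> \<mu>) / fact (?k - 1) * skew_pochhammer z \<nu> \<mu> * skew_pochhammer z' \<nu> \<mu>"
    by (simp add: branching_coeff_def fact_reduce[of ?k] field_simps)
  also have "\<dots> = (\<Sum>i\<in>?I. of_nat (skew_dim (remove_box \<nu> i) \<mu>) / fact (?k - 1) * skew_pochhammer z \<nu> \<mu> * skew_pochhammer z' \<nu> \<mu>)"
    by (simp add: skew_dim_rec[OF \<nu> \<mu> False] sum_divide_distrib sum_distrib_right)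
  also have "\<dots> = (\<Sum>i\<in>?I. (z + of_int (int (Defs.row \<nu> i) - int i)) * (z' + of_int (int (Defs.row \<nu> i) - int i))
        * branching_coeff z z' (remove_box \<nu> i) \<mu>)"
  proof (rule sum.cong)
    fix i assume "i \<in> ?I"
    then have i: "i \<in> removable_rows \<nu>" "\<mu> \<in> subpartitions (remove_box \<nu> i)" by auto
    have "?k - 1 = sum_list (remove_box \<nu> i) - sum_list \<mu>" using sum_list_remove_box[OF \<nu> i(1)] by simp
    then show "of_nat (skew_dim (remove_box \<nu> i) \<mu>) / fact (?k - 1) * skew_pochhammer z \<nu> \<mu> * skew_pochhammer z' \<nu> \<mu>
        = (z + of_int (int (Defs.row \<nu> i) - int i)) * (z' + of_int (int (Defs.row \<nu> i) - int i)) * branching_coeff z z' (remove_box \<nu> i) \<mu>"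
      by (simp only: branching_coeff_def skew_pochhammer_remove_box[OF \<nu> i] mult_ac)
  qed simp
  finally show ?thesis .
qed

definition branching_poly :: "'a::field_char_0 \<Rightarrow> 'a \<Rightarrow> 'a \<Rightarrow> nat \<Rightarrow> nat list \<Rightarrow> 'a mpoly poly" where
  "branching_poly s z z' N \<nu> = (\<Sum>\<mu>\<in>subpartitions \<nu>.
     monom (Const (branching_coeff z z' \<nu> \<mu>) * alternant s N (strict_exponents \<mu> N)) (sum_list \<nu> - sum_list \<mu>))"

lemma pderiv_branching_poly:
  assumes \<nu>: "\<nu> \<in> partitions"
  shows "pderiv (branching_poly s z z' N \<nu>)
    = (\<Sum>i\<in>removable_rows \<nu>.
        smult (Const ((z + of_int (int (Defs.row \<nu> i) - int i)) * (z' + of_int (int (Defs.row \<nu> i) - int i))))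
          (branching_poly s z z' N (remove_box \<nu> i)))"
proof -
  let ?w = "\<lambda>i. (z + of_int (int (Defs.row \<nu> i) - int i)) * (z' + of_int (int (Defs.row \<nu> i) - int i))"
  let ?a = "\<lambda>\<mu>. alternant s N (strict_exponents \<mu> N)"
  let ?t = "\<lambda>\<mu> i. monom (Const (?w i * branching_coeff z z' (remove_box \<nu> i) \<mu>) * ?a \<mu>) (sum_list \<nu> - sum_list \<mu> - 1)"
  have "pderiv (branching_poly s z z' N \<nu>) = (\<Sum>\<mu>\<in>subpartitions \<nu>.
      monom (Const (of_nat (sum_list \<nu> - sum_list \<mu>) * branching_coeff z z' \<nu> \<mu>) * ?a \<mu>) (sum_list \<nu> - sum_list \<mu> - 1))"
    by (simp add: branching_poly_def pderiv_sum_set pderiv_monom Const_mult Const_of_nat mult.assoc)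
  also have "\<dots> = (\<Sum>\<mu>\<in>subpartitions \<nu>. \<Sum>i | i \<in> removable_rows \<nu> \<and> \<mu> \<in> subpartitions (remove_box \<nu> i). ?t \<mu> i)"
  proof (intro sum.cong refl)
    fix \<mu> assume \<mu>: "\<mu> \<in> subpartitions \<nu>"
    show "monom (Const (of_nat (sum_list \<nu> - sum_list \<mu>) * branching_coeff z z' \<nu> \<mu>) * ?a \<mu>) (sum_list \<nu> - sum_list \<mu> - 1)
        = (\<Sum>i | i \<in> removable_rows \<nu> \<and> \<mu> \<in> subpartitions (remove_box \<nu> i). ?t \<mu> i)"
      unfolding branching_coeff_rec[OF \<nu> \<mu>] Const_sum sum_distrib_right monom_sum ..
  qed
  also have "\<dots> = (\<Sum>i\<in>removable_rows \<nu>. \<Sum>\<mu> | \<mu> \<in> subpartitions \<nu> \<and> \<mu> \<in> subpartitions (remove_box \<nu> i). ?t \<mu> i)"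
    by (rule sum.swap_restrict) (simp_all add: finite_subpartitions)
  also have "\<dots> = (\<Sum>i\<in>removable_rows \<nu>. smult (Const (?w i)) (branching_poly s z z' N (remove_box \<nu> i)))"
  proof (intro sum.cong refl)
    fix i assume i: "i \<in> removable_rows \<nu>"
    have sub: "{\<mu>. \<mu> \<in> subpartitions \<nu> \<and> \<mu> \<in> subpartitions (remove_box \<nu> i)} = subpartitions (remove_box \<nu> i)"
      using subpartitions_remove_box[OF \<nu> i] by auto
    have "sum_list \<nu> - sum_list \<mu> - 1 = sum_list (remove_box \<nu> i) - sum_list \<mu>" for \<mu>
      using sum_list_remove_box[OF \<nu> i] by simp
    then show "(\<Sum>\<mu> | \<mu> \<in> subpartitions \<nu> \<and> \<mu> \<in> subpartitions (remove_box \<nu> i). ?t \<mu> i)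
        = smult (Const (?w i)) (branching_poly s z z' N (remove_box \<nu> i))"
      unfolding sub branching_poly_def smult_sum_right smult_monom Const_mult mult.assoc by simp
  qed
  finally show ?thesis .
qed

lemma coeff_0_branching_poly:
  assumes "\<nu> \<in> partitions"
  shows "coeff (branching_poly s z z' N \<nu>) 0 = alternant s N (strict_exponents \<nu> N)"
proof -
  have "sum_list \<nu> - sum_list \<mu> = 0 \<longleftrightarrow> \<mu> = \<nu>" if "\<mu> \<in> subpartitions \<nu>" for \<mu>
    using card_skew_diagram[OF that] subpartition_eqI[OF that assms]
    by (metis card_0_eq diff_self_eq_0 finite_Diff finite_diagram)
  then have "coeff (branching_poly s z z' N \<nu>) 0 = (\<Sum>\<mu>\<in>subpartitions \<nu>.
      if \<mu> = \<nu> then Const (branching_coeff z z' \<nu> \<nu>) * alternant s N (strict_exponents \<nu> N) else 0)"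
    unfolding branching_poly_def coeff_sum coeff_monom by (intro sum.cong) auto
  then show ?thesis using subpartitions_self[OF assms] by (simp add: finite_subpartitions)
qed

lemma poly_det_mat: "poly (det (mat N N A)) x = det (mat N N (\<lambda>(i, j). poly (A (i, j)) x))"
  for x :: "'a::comm_ring_1"
proof -
  interpret comm_ring_hom "\<lambda>p. poly p x" by unfold_locales simp_all
  have "map_mat (\<lambda>p. poly p x) (mat N N A) = mat N N (\<lambda>(i, j). poly (A (i, j)) x)"
    by (rule eq_matI) auto
  then show ?thesis using hom_det[of "mat N N A"] by simp
qed

lemma coeff_0_monic_det: "coeff (monic_det s c N n) 0 = alternant s N n"
proof -
  have "poly (monic_poly s c m x) 0 = step_power s x m" for m x
  proof -
    have "poly (monic_poly s c m x) 0 = (\<Sum>k\<le>m. if k = m then step_power s x m else 0)"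
      unfolding monic_poly_def poly_sum poly_monom by (intro sum.cong) (auto simp: zero_power)
    then show ?thesis by simp
  qed
  then show ?thesis by (simp add: monic_det_def alternant_def poly_det_mat flip: poly_0_coeff_0)
qed

text \<open>By induction on the number of boxes the derivatives agree, and both constant terms are
  the alternant of \<nu>. In characteristic 0 this determines the polynomial.\<close>

lemma branching_poly_eq_monic_det:
  assumes "\<nu> \<in> partitions" "length \<nu> \<le> N"
  shows "branching_poly s (of_nat N) (of_nat N + c - 1) N \<nu> = monic_det s c N (strict_exponents \<nu> N)"
  using assms
proof (induction "sum_list \<nu>" arbitrary: \<nu> rule: less_induct)
  case less
  let ?A = "branching_poly s (of_nat N) (of_nat N + c - 1) N" and ?B = "\<lambda>\<nu>. monic_det s c N (strict_exponents \<nu> N)"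
  note \<nu> = less.prems
  have "pderiv (?A \<nu>) = pderiv (?B \<nu>)"
    unfolding pderiv_branching_poly[OF \<nu>(1)] pderiv_monic_det_partition[OF \<nu>]
  proof (intro sum.cong refl arg_cong2[where f = smult] arg_cong[where f = Const])
    fix i assume i: "i \<in> removable_rows \<nu>"
    have "remove_box \<nu> i \<in> subpartitions \<nu>"
      using remove_box(1)[OF \<nu>(1) i] diagram_remove_box[OF \<nu>(1) i] by (auto simp: subpartitions_def)
    then show "?A (remove_box \<nu> i) = ?B (remove_box \<nu> i)"
      using sum_list_remove_box[OF \<nu>(1) i] length_subpartitions[OF _ \<nu>(1)] \<nu>(2)
      by (intro less.hyps remove_box(1)[OF \<nu>(1) i]) (auto intro: order_trans)
    have le: "1 \<le> i" "i \<le> N" using removable_rows_le[OF i] \<nu>(2) by auto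
    \<comment> \<open>The last box of row i has content \<nu>_i - i, so N + content is exactly the
      exponent of that row.\<close>
    then have n: "of_nat (strict_exponents \<nu> N (i - 1)) = (of_nat N + of_int (int (Defs.row \<nu> i) - int i) :: 'a)"
      by (simp add: strict_exponents_def of_nat_diff)
    show "(of_nat N + of_int (int (Defs.row \<nu> i) - int i)) * (of_nat N + c - 1 + of_int (int (Defs.row \<nu> i) - int i))
        = lowering_weight c (strict_exponents \<nu> N (i - 1))"
      unfolding lowering_weight_def n by (simp add: algebra_simps)
  qed
  then have "pderiv (?A \<nu> - ?B \<nu>) = 0" by (simp add: pderiv_diff)
  then have "degree (?A \<nu> - ?B \<nu>) = 0" by (simp only: pderiv_eq_0_iff)
  then obtain a where a: "?A \<nu> - ?B \<nu> = [:a:]" by (rule degree_eq_zeroE)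
  have "a = coeff (?A \<nu> - ?B \<nu>) 0" by (simp add: a)
  also have "\<dots> = 0" by (simp add: coeff_0_branching_poly[OF \<nu>(1)] coeff_0_monic_det)
  finally show ?case using a by simp
qed

text \<open>For s = 0 and \<eta> = 1 these are the monic Laguerre polynomials with parameter c - 1;
  for s = 1 and \<eta> = \<xi> / (1 - \<xi>) the monic Meixner polynomials, expanded in falling
  powers.\<close>

definition monic_step :: "'a::field_char_0 \<Rightarrow> 'a \<Rightarrow> 'a \<Rightarrow> nat \<Rightarrow> 'a mpoly \<Rightarrow> 'a mpoly" where
  "monic_step s c \<eta> n x = (\<Sum>k\<le>n. Const (lowering_coeff c n k * (- \<eta>) ^ (n - k)) * step_power s x k)"

lemma branching_sum_eq_det:
  assumes "\<nu> \<in> partitions" "length \<nu> \<le> N"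
  shows "(\<Sum>\<mu>\<in>subpartitions \<nu>. Const ((- \<eta>) ^ (sum_list \<nu> - sum_list \<mu>) * branching_coeff (of_nat N) (of_nat N + c - 1) \<nu> \<mu>)
      * alternant s N (strict_exponents \<mu> N))
    = det (mat N N (\<lambda>(i, j). monic_step s c \<eta> (strict_exponents \<nu> N i) (Var (Suc j))))"
proof -
  have "poly (monic_poly s c n x) (Const (- \<eta>)) = monic_step s c \<eta> n x" for n x
    unfolding monic_poly_def monic_step_def poly_sum poly_monom
    by (intro sum.cong refl) (simp add: Const_mult Const_power mult_ac)
  moreover have "poly (branching_poly s z z' N \<nu>) (Const (- \<eta>)) = (\<Sum>\<mu>\<in>subpartitions \<nu>.
      Const ((- \<eta>) ^ (sum_list \<nu> - sum_list \<mu>) * branching_coeff z z' \<nu> \<mu>) * alternant s N (strict_exponents \<mu> N))" for z z'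
    unfolding branching_poly_def poly_sum poly_monom
    by (intro sum.cong refl) (simp add: Const_mult Const_power mult_ac)
  ultimately show ?thesis
    using arg_cong[OF branching_poly_eq_monic_det[OF assms, of s c], of "\<lambda>p. poly p (Const (- \<eta>))"]
    by (simp add: monic_det_def poly_det_mat case_prod_unfold)
qed


section \<open>Orthogonality in finitely many variables\<close>

subsection \<open>Moment functionals\<close>

text \<open>A product functional given by its moments alone: every variable in \<open>X\<close> has
  moment sequence \<open>M\<close>. Being purely algebraic, it makes sense for complex parameters
  without positivity or convergence.\<close>

definition moment_functional :: "nat set \<Rightarrow> (nat \<Rightarrow> 'a::comm_ring_1) \<Rightarrow> 'a mpoly \<Rightarrow> 'a" where
  "moment_functional X M p = (\<Sum>e\<in>keys p. lookup p e * (\<Prod>i\<in>X. M (lookup e i)))"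

lemma moment_functional_superset:
  "finite K \<Longrightarrow> keys p \<subseteq> K \<Longrightarrow> moment_functional X M p = (\<Sum>e\<in>K. lookup p e * (\<Prod>i\<in>X. M (lookup e i)))"
  unfolding moment_functional_def by (intro sum.mono_neutral_left) (auto simp: in_keys_iff)

lemma moment_functional_add:
  "moment_functional X M (p + q) = moment_functional X M p + moment_functional X M q"
proof -
  have "keys (p + q) \<subseteq> keys p \<union> keys q" by (rule keys_add)
  then show ?thesis
    by (simp add: moment_functional_superset[of "keys p \<union> keys q"] lookup_add distrib_right sum.distrib)
qed

lemma moment_functional_0 [simp]: "moment_functional X M 0 = 0"
  by (simp add: moment_functional_def)

lemma moment_functional_Const_mult: "moment_functional X M (Const c * p) = c * moment_functional X M p"
proof -
  have "keys (Const c * p) \<subseteq> keys p" by (auto simp: in_keys_iff)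
  then show ?thesis
    by (simp add: moment_functional_superset[of "keys p"] sum_distrib_left mult.assoc)
qed

lemma moment_functional_sum: "moment_functional X M (sum f A) = (\<Sum>a\<in>A. moment_functional X M (f a))"
  by (induction A rule: infinite_finite_induct) (simp_all add: moment_functional_add)

lemma moment_functional_diff:
  "moment_functional X M (p - q) = moment_functional X M p - moment_functional X M q"
  using moment_functional_add[of X M "p - q" q] by simp

lemma moment_functional_single: "moment_functional X M (single e c) = c * (\<Prod>i\<in>X. M (lookup e i))"
  by (cases "c = 0") (simp_all add: moment_functional_def)

text \<open>Independence of disjoint sets of variables: for each \<open>i\<close> one of the two
  exponents is 0 and contributes \<open>M 0 = 1\<close>.\<close>

lemma moment_functional_mult:
  assumes M: "M 0 = 1" and p: "vars_in A p" and q: "vars_in B q" and AB: "A \<inter> B = {}"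
  shows "moment_functional X M (p * q) = moment_functional X M p * moment_functional X M q"
proof -
  have s: "moment_functional X M (single d a * single e b)
      = moment_functional X M (single d a) * moment_functional X M (single e b)"
    if "d \<in> keys p" "e \<in> keys q" for d e a b
  proof -
    have "M (lookup (d + e) i) = M (lookup d i) * M (lookup e i)" for i
    proof -
      have "i \<notin> keys d \<or> i \<notin> keys e" using that p q AB unfolding vars_in_def by blast
      then show ?thesis using M by (auto simp: in_keys_iff lookup_add)
    qed
    then show ?thesis by (simp add: mult_single moment_functional_single prod.distrib mult_ac)
  qed
  have "p * q = (\<Sum>d\<in>keys p. single d (lookup p d)) * (\<Sum>e\<in>keys q. single e (lookup q e))"
    by (simp flip: mpoly_expand)
  then have "moment_functional X M (p * q)
      = (\<Sum>d\<in>keys p. \<Sum>e\<in>keys q. moment_functional X M (single d (lookup p d)) * moment_functional X M (single e (lookup q e)))"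
    by (simp add: sum_product moment_functional_sum s)
  also have "\<dots> = moment_functional X M (\<Sum>d\<in>keys p. single d (lookup p d)) * moment_functional X M (\<Sum>e\<in>keys q. single e (lookup q e))"
    by (simp add: moment_functional_sum sum_product)
  finally show ?thesis by (simp flip: mpoly_expand)
qed

text \<open>One-variable computations are carried out in \<open>Var 0\<close>, which lies outside
  \<open>{1..N}\<close>, and are then transferred to every actual variable.\<close>

lemma moment_functional_rename:
  assumes M: "M 0 = 1" and p: "vars_in {0} p" and j: "finite X" "j \<in> X"
  shows "moment_functional X M (substitute (\<lambda>_. Var j) p) = moment_functional {0} M p"
proof -
  have "moment_functional X M (substitute (\<lambda>_. Var j) (single e c)) = moment_functional {0} M (single e c)"
    if "e \<in> keys p" for e c
  proof -
    have "keys e \<subseteq> {0}" using that p by (auto simp: vars_in_def)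
    then have "(\<Prod>i\<in>keys e. Var j ^ lookup e i :: 'a mpoly) = (\<Prod>i\<in>{0}. Var j ^ lookup e i)"
      by (intro prod.mono_neutral_left) (auto simp: in_keys_iff)
    then have "substitute (\<lambda>_. Var j) (single e c) = single (single j (lookup e 0)) c"
      by (simp add: substitute_single Var_power Const_def mult_single)
    moreover have "(\<Prod>i\<in>X. M (lookup (single j (lookup e 0)) i)) = (\<Prod>i\<in>X. if i = j then M (lookup e 0) else 1)"
      using M by (intro prod.cong) (auto simp: lookup_single when_def)
    ultimately show ?thesis using j by (simp add: moment_functional_single)
  qed
  then have "moment_functional X M (substitute (\<lambda>_. Var j) (\<Sum>e\<in>keys p. single e (lookup p e)))
      = moment_functional {0} M (\<Sum>e\<in>keys p. single e (lookup p e))"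
    by (simp add: substitute_sum moment_functional_sum)
  then show ?thesis by (simp flip: mpoly_expand)
qed

lemma moment_functional_prod:
  assumes M: "M 0 = 1" and p: "\<And>j. j \<in> {1..N} \<Longrightarrow> vars_in {0} (p j)"
  shows "moment_functional {1..N} M (\<Prod>j\<in>{1..N}. substitute (\<lambda>_. Var j) (p j))
    = (\<Prod>j\<in>{1..N}. moment_functional {0} M (p j))"
proof -
  have "moment_functional {1..N} M (\<Prod>j\<in>A. substitute (\<lambda>_. Var j) (p j)) = (\<Prod>j\<in>A. moment_functional {0} M (p j))"
    if "finite A" "A \<subseteq> {1..N}" for A
    using that
  proof (induction A)
    case empty
    have "moment_functional {1..N} M (single 0 1) = 1" using M by (simp only: moment_functional_single) simp
    then show ?case by simp
  next
    case (insert a A)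
    have "moment_functional {1..N} M (substitute (\<lambda>_. Var a) (p a) * (\<Prod>j\<in>A. substitute (\<lambda>_. Var j) (p j)))
        = moment_functional {1..N} M (substitute (\<lambda>_. Var a) (p a)) * moment_functional {1..N} M (\<Prod>j\<in>A. substitute (\<lambda>_. Var j) (p j))"
      using insert.hyps
      by (intro moment_functional_mult[of _ "{a}" _ A] M vars_in_prod vars_in_substitute[OF vars_in_UNIV]) auto
    also have "moment_functional {1..N} M (substitute (\<lambda>_. Var a) (p a)) = moment_functional {0} M (p a)"
      using insert.prems by (intro moment_functional_rename M p) auto
    finally show ?case using insert by simp
  qed
  from this[of "{1..N}"] show ?thesis by simp
qed

text \<open>\<open>step_moments s \<mu>\<close> is the sequence of power moments of the functional sending the \<open>n\<close>-th
  step power to \<open>\<mu> n\<close>: multiplying by \<open>x\<close> turns \<open>\<mu>\<close> into \<open>j \<mapsto> \<mu> (j + 1) + j s \<mu> j\<close>.\<close>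

fun step_moments :: "'a::comm_ring_1 \<Rightarrow> (nat \<Rightarrow> 'a) \<Rightarrow> nat \<Rightarrow> 'a" where
  "step_moments s \<mu> 0 = \<mu> 0"
| "step_moments s \<mu> (Suc k) = step_moments s (\<lambda>j. \<mu> (Suc j) + of_nat j * s * \<mu> j) k"

lemma moment_functional_Var_mult:
  "moment_functional {0} (step_moments s \<mu>) (Var 0 * p)
    = moment_functional {0} (step_moments s (\<lambda>j. \<mu> (Suc j) + of_nat j * s * \<mu> j)) p"
proof -
  have "moment_functional {0} (step_moments s \<mu>) (Var 0 * single e c)
      = moment_functional {0} (step_moments s (\<lambda>j. \<mu> (Suc j) + of_nat j * s * \<mu> j)) (single e c)" for e c
    by (simp add: Var_def mult_single moment_functional_single lookup_add)
  then have "moment_functional {0} (step_moments s \<mu>) (Var 0 * (\<Sum>e\<in>keys p. single e (lookup p e)))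
    = moment_functional {0} (step_moments s (\<lambda>j. \<mu> (Suc j) + of_nat j * s * \<mu> j)) (\<Sum>e\<in>keys p. single e (lookup p e))"
    by (simp add: sum_distrib_left moment_functional_sum)
  then show ?thesis by (simp flip: mpoly_expand)
qed

lemma moment_functional_step_power:
  "moment_functional {0} (step_moments s \<mu>) (step_power s (Var 0) n) = \<mu> n"
proof (induction n arbitrary: \<mu>)
  case 0
  have "moment_functional {0} (step_moments s \<mu>) (single 0 1) = \<mu> 0" by (simp only: moment_functional_single) simp
  then show ?case by (simp add: step_power_def)
next
  case (Suc n)
  have "step_power s (Var 0) (Suc n) = Var 0 * step_power s (Var 0) n - Const (of_nat n * s) * step_power s (Var 0) n"
    by (simp add: step_power_def algebra_simps)
  then show ?case
    by (simp add: moment_functional_diff moment_functional_Const_mult moment_functional_Var_mult Suc)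
qed

subsection \<open>The orthogonal polynomials in one variable\<close>

definition monic_coeff :: "'a::field_char_0 \<Rightarrow> 'a \<Rightarrow> nat \<Rightarrow> nat \<Rightarrow> 'a" where
  "monic_coeff c \<eta> n k = (if k \<le> n then lowering_coeff c n k * (- \<eta>) ^ (n - k) else 0)"

lemma monic_step_eq:
  assumes "n \<le> m"
  shows "monic_step s c \<eta> n x = (\<Sum>k\<le>m. Const (monic_coeff c \<eta> n k) * step_power s x k)"
  unfolding monic_step_def using assms
  by (intro sum.mono_neutral_cong_left) (auto simp: monic_coeff_def)

text \<open>The three-term recurrence, read off at the coefficient of the k-th step power. The cases
  at or above the diagonal are checked directly. For k < n, with n = k + d + 1, the identity is
  multiplied by d + 2, and every term is expressed through the coefficients for n and n - 1.\<close>

lemma monic_coeff_rec: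
  "(if k = 0 then 0 else monic_coeff c \<eta> n (k - 1)) + of_nat k * s * monic_coeff c \<eta> n k
    = monic_coeff c \<eta> (Suc n) k + (of_nat n * s + \<eta> * (c + 2 * of_nat n)) * monic_coeff c \<eta> n k
      + \<eta> * (\<eta> + s) * lowering_weight c n * monic_coeff c \<eta> (n - 1) k"
proof -
  have Suc_lower: "lowering_coeff c n k = lowering_weight c (Suc k) * lowering_coeff c n (Suc k) / of_nat (n - k)"
    if "k < n" for n k
  proof -
    have "{k<..n} = insert (Suc k) {Suc k<..n}" "n - k = Suc (n - Suc k)" using that by auto
    then show ?thesis by (simp add: lowering_coeff_def del: of_nat_Suc)
  qed
  consider "k > Suc n" | "k = Suc n" | "k = n" | d where "n = k + Suc d"
    by (metis Suc_lessI add_Suc_right less_imp_Suc_add linorder_neqE_nat not_less_eq)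
  then show ?thesis
  proof cases
    case 3
    have "of_nat (Suc n - n) * lowering_coeff c (Suc n) n = lowering_weight c (Suc n) * lowering_coeff c n n"
      by (rule lowering_coeff_Suc) simp
    then have 1: "lowering_coeff c (Suc n) n = lowering_weight c (Suc n)" by simp
    show ?thesis
    proof (cases n)
      case 0
      then show ?thesis using 3 1 by (simp add: monic_coeff_def lowering_weight_def)
    next
      case (Suc m)
      have "lowering_coeff c n m = lowering_weight c n" using Suc_lower[of m n] by (simp add: Suc)
      then show ?thesis using 3 1 Suc by (simp add: monic_coeff_def lowering_weight_def algebra_simps)
    qed
  next
    case (4 d)
    define P where "P = lowering_coeff c (k + d) k"
    have a: "of_nat (Suc d) * lowering_coeff c n k = lowering_weight c n * P"
      using lowering_coeff_Suc[of k "k + d" c] by (simp add: 4 P_def del: of_nat_Suc)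
    have b: "of_nat (Suc (Suc d)) * lowering_coeff c (Suc n) k = lowering_weight c (Suc n) * lowering_coeff c n k"
      using lowering_coeff_Suc[of k n c] by (simp add: 4 del: of_nat_Suc)
    define Q where "Q = (if k = 0 then 0 else monic_coeff c \<eta> n (k - 1))"
    have e: "of_nat (Suc (Suc d)) * Q = lowering_weight c k * lowering_coeff c n k * (- \<eta>) ^ Suc (Suc d)"
    proof (cases k)
      case (Suc l)
      have "lowering_coeff c n l = lowering_weight c k * lowering_coeff c n k / of_nat (Suc (Suc d))"
        using Suc_lower[of l n] by (simp add: 4 Suc del: of_nat_Suc)
      moreover have "Q = lowering_coeff c n l * (- \<eta>) ^ Suc (Suc d)"
        by (simp add: Q_def monic_coeff_def 4 Suc)
      ultimately show ?thesis by (simp del: of_nat_Suc power_Suc)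
    qed (simp add: Q_def lowering_weight_def)
    let ?L = "lowering_coeff c n k" and ?e = "(- \<eta>) ^ d" and ?D = "of_nat (Suc (Suc d)) :: 'a"
    have m: "monic_coeff c \<eta> n k = ?L * (- \<eta>) * ?e"
      "monic_coeff c \<eta> (Suc n) k = lowering_coeff c (Suc n) k * \<eta>\<^sup>2 * ?e"
      "monic_coeff c \<eta> (n - 1) k = P * ?e"
      using 4 by (simp_all add: monic_coeff_def P_def power2_eq_square)
    \<comment> \<open>The weight is quadratic, so its difference over the d + 2 steps from k to n +
      1 is divisible by d + 2.\<close>
    have w: "lowering_weight c k = lowering_weight c (Suc n) - ?D * (c + 2 * of_nat n) + of_nat (Suc d) * ?D"
      by (simp add: lowering_weight_def 4 algebra_simps)
    have "?D * (Q + of_nat k * s * monic_coeff c \<eta> n k)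
        = (lowering_weight c k * \<eta>\<^sup>2 - ?D * of_nat k * s * \<eta>) * ?L * ?e"
      unfolding distrib_left e m by (simp add: algebra_simps power2_eq_square)
    also have "\<dots> = (lowering_weight c (Suc n) * ?L) * \<eta>\<^sup>2 * ?e
        - ?D * (of_nat n * s + \<eta> * (c + 2 * of_nat n)) * \<eta> * ?L * ?e
        + ?D * \<eta> * (\<eta> + s) * (of_nat (Suc d) * ?L) * ?e"
      unfolding w by (simp add: 4 algebra_simps power2_eq_square)
    also have "\<dots> = ?D * (monic_coeff c \<eta> (Suc n) k + (of_nat n * s + \<eta> * (c + 2 * of_nat n)) * monic_coeff c \<eta> n k
        + \<eta> * (\<eta> + s) * lowering_weight c n * monic_coeff c \<eta> (n - 1) k)"
      unfolding b[symmetric] a m by (simp add: algebra_simps)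
    finally show ?thesis unfolding Q_def by (simp only: mult_cancel_left of_nat_eq_0_iff) simp
  qed (auto simp: monic_coeff_def)
qed

lemma step_power_mult_Var: "x * step_power s x k = step_power s x (Suc k) + Const (of_nat k * s) * step_power s x k"
  by (simp add: step_power_def algebra_simps)

text \<open>The recurrence of monic orthogonal polynomials. For \<open>n = 0\<close> the last
  coefficient vanishes together with the weight.\<close>

lemma monic_step_three_term:
  "x * monic_step s c \<eta> n x = monic_step s c \<eta> (Suc n) x
    + Const (of_nat n * s + \<eta> * (c + 2 * of_nat n)) * monic_step s c \<eta> n x
    + Const (\<eta> * (\<eta> + s) * lowering_weight c n) * monic_step s c \<eta> (n - 1) x"
proof -
  let ?h = "step_power s x" and ?T = "monic_coeff c \<eta>"
  have step: "x * (Const a * ?h k) = Const a * ?h (Suc k) + Const (of_nat k * s * a) * ?h k" for a k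
  proof -
    have "x * (Const a * ?h k) = Const a * (x * ?h k)" by (rule mult.left_commute)
    then show ?thesis unfolding step_power_mult_Var Const_mult by (simp only: distrib_left mult_ac)
  qed
  have "x * monic_step s c \<eta> n x = (\<Sum>k\<le>n. Const (?T n k) * ?h (Suc k)) + (\<Sum>k\<le>n. Const (of_nat k * s * ?T n k) * ?h k)"
    unfolding monic_step_eq[OF order.refl] sum_distrib_left sum.distrib[symmetric] step ..
  also have "(\<Sum>k\<le>n. Const (?T n k) * ?h (Suc k)) = (\<Sum>k\<le>Suc n. Const (if k = 0 then 0 else ?T n (k - 1)) * ?h k)"
    by (simp add: sum.atMost_Suc_shift del: sum.atMost_Suc)
  also have "(\<Sum>k\<le>n. Const (of_nat k * s * ?T n k) * ?h k) = (\<Sum>k\<le>Suc n. Const (of_nat k * s * ?T n k) * ?h k)"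
    by (simp add: monic_coeff_def)
  finally have "x * monic_step s c \<eta> n x
      = (\<Sum>k\<le>Suc n. Const ((if k = 0 then 0 else ?T n (k - 1)) + of_nat k * s * ?T n k) * ?h k)"
    by (simp only: sum.distrib[symmetric] Const_add distrib_right)
  then show ?thesis
    unfolding monic_coeff_rec monic_step_eq[of n "Suc n", OF le_SucI[OF order.refl]]
      monic_step_eq[of "Suc n" "Suc n", OF order.refl] monic_step_eq[of "n - 1" "Suc n", OF le_trans[OF diff_le_self le_SucI[OF order.refl]]]
    by (simp only: Const_add Const_mult distrib_right sum.distrib sum_distrib_left mult.assoc)
qed

text \<open>For s = 0, \<eta> = 1 these are the moments of the gamma distribution with density
  proportional to x^(c-1) e^(-x). For s = 1, \<eta> = \<xi> / (1 - \<xi>) the sequence inside lists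
  the factorial moments of the negative binomial distribution.\<close>

definition step_weight :: "'a::field_char_0 \<Rightarrow> 'a \<Rightarrow> 'a \<Rightarrow> nat \<Rightarrow> 'a" where
  "step_weight s c \<eta> = step_moments s (\<lambda>n. \<eta> ^ n * pochhammer c n)"

text \<open>As always for monic orthogonal polynomials, the squared norm is the product of the
  recurrence coefficients in front of the polynomials of index m - 1.\<close>

definition monic_norm :: "'a::field_char_0 \<Rightarrow> 'a \<Rightarrow> 'a \<Rightarrow> nat \<Rightarrow> 'a" where
  "monic_norm s c \<eta> n = (\<Prod>m\<in>{0<..n}. \<eta> * (\<eta> + s) * lowering_weight c m)"

text \<open>The factor \<open>pochhammer c k\<close> stays on the left because it may be 0.\<close>

lemma lowering_coeff_pochhammer:
  "k \<le> n \<Longrightarrow> lowering_coeff c n k * pochhammer c k = of_nat (n choose k) * pochhammer c n"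
proof (induction n rule: dec_induct)
  case (step n)
  have "of_nat (Suc n - k) * (lowering_coeff c (Suc n) k * pochhammer c k)
      = lowering_weight c (Suc n) * (of_nat (n choose k) * pochhammer c n)"
    unfolding mult.assoc[symmetric] lowering_coeff_Suc[OF step.hyps(1)]
    unfolding mult.assoc step.IH ..
  also have "\<dots> = of_nat (Suc n * (n choose k)) * pochhammer c (Suc n)"
    by (simp add: lowering_weight_def pochhammer_Suc algebra_simps)
  also have "Suc n * (n choose k) = (Suc n - k) * (Suc n choose k)"
    using step.hyps(1) binomial_absorb_comp[of "Suc n" k] by simp
  finally have "of_nat (Suc n - k) * (lowering_coeff c (Suc n) k * pochhammer c k)
      = of_nat (Suc n - k) * (of_nat (Suc n choose k) * pochhammer c (Suc n))"
    by (simp only: of_nat_mult mult.assoc)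
  then show ?case using step.hyps(1) by (simp only: mult_cancel_left of_nat_eq_0_iff) simp
qed simp

text \<open>The binomial theorem collapses the sum to (\<eta> - \<eta>)^n.\<close>

lemma moment_functional_monic_step:
  "moment_functional {0} (step_weight s c \<eta>) (monic_step s c \<eta> n (Var 0)) = (if n = 0 then 1 else 0)"
proof -
  have "moment_functional {0} (step_weight s c \<eta>) (monic_step s c \<eta> n (Var 0))
      = (\<Sum>k\<le>n. lowering_coeff c n k * (- \<eta>) ^ (n - k) * (\<eta> ^ k * pochhammer c k))"
    by (simp add: monic_step_def moment_functional_sum moment_functional_Const_mult step_weight_def
        moment_functional_step_power)
  also have "\<dots> = (\<Sum>k\<le>n. of_nat (n choose k) * \<eta> ^ k * (- \<eta>) ^ (n - k)) * pochhammer c n"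
    unfolding sum_distrib_right
  proof (intro sum.cong refl)
    fix k assume "k \<in> {..n}"
    then have "lowering_coeff c n k * pochhammer c k = of_nat (n choose k) * pochhammer c n"
      by (intro lowering_coeff_pochhammer) simp
    then show "lowering_coeff c n k * (- \<eta>) ^ (n - k) * (\<eta> ^ k * pochhammer c k)
        = of_nat (n choose k) * \<eta> ^ k * (- \<eta>) ^ (n - k) * pochhammer c n"
      by (metis (no_types, opaque_lifting) mult.assoc mult.commute)
  qed
  also have "\<dots> = (\<eta> + - \<eta>) ^ n * pochhammer c n" unfolding binomial_ring ..
  finally show ?thesis by (simp add: power_0_left)
qed

text \<open>Induction on the second index: the recurrence expresses the polynomial of index k
  through multiplication by x, and x is then moved to the other factor, where the recurrence is
  applied again.\<close>

lemma moment_functional_monic_step_mult: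
  "moment_functional {0} (step_weight s c \<eta>) (monic_step s c \<eta> n (Var 0) * monic_step s c \<eta> k (Var 0))
    = (if n = k then monic_norm s c \<eta> k else 0)"
proof (induction k arbitrary: n rule: less_induct)
  case (less k)
  let ?m = "moment_functional {0} (step_weight s c \<eta>)" and ?l = "\<lambda>n. monic_step s c \<eta> n (Var 0)"
  let ?a = "\<lambda>n. of_nat n * s + \<eta> * (c + 2 * of_nat n)" and ?b = "\<lambda>n. \<eta> * (\<eta> + s) * lowering_weight c n"
  show ?case
  proof (cases k)
    case 0
    have "?l 0 = 1" by (simp add: monic_step_def step_power_def)
    then show ?thesis using moment_functional_monic_step[of s c \<eta> n] by (simp add: 0 monic_norm_def)
  next
    case (Suc j)
    have norm: "monic_norm s c \<eta> (Suc i) = ?b (Suc i) * monic_norm s c \<eta> i" for i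
    proof -
      have "{0<..Suc i} = insert (Suc i) {0<..i}" by auto
      then show ?thesis by (simp add: monic_norm_def)
    qed
    have l: "?l (Suc j) = Var 0 * ?l j - Const (?a j) * ?l j - Const (?b j) * ?l (j - 1)"
      unfolding monic_step_three_term by simp
    have "?l n * ?l (Suc j) = (Var 0 * ?l n) * ?l j - Const (?a j) * (?l n * ?l j) - Const (?b j) * (?l n * ?l (j - 1))"
      unfolding l right_diff_distrib by (simp only: mult_ac)
    also have "(Var 0 * ?l n) * ?l j = ?l (Suc n) * ?l j + Const (?a n) * (?l n * ?l j) + Const (?b n) * (?l (n - 1) * ?l j)"
      unfolding monic_step_three_term by (simp only: distrib_right mult.assoc)
    finally have "?m (?l n * ?l (Suc j)) = ?m (?l (Suc n) * ?l j) + ?a n * ?m (?l n * ?l j) + ?b n * ?m (?l (n - 1) * ?l j)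
        - ?a j * ?m (?l n * ?l j) - ?b j * ?m (?l n * ?l (j - 1))"
      by (simp only: moment_functional_diff moment_functional_add moment_functional_Const_mult)
    also have "\<dots> = (if Suc n = j then monic_norm s c \<eta> j else 0) + ?a n * (if n = j then monic_norm s c \<eta> j else 0)
        + ?b n * (if n - 1 = j then monic_norm s c \<eta> j else 0) - ?a j * (if n = j then monic_norm s c \<eta> j else 0)
        - ?b j * (if n = j - 1 then monic_norm s c \<eta> (j - 1) else 0)"
      using less.IH[of j] less.IH[of "j - 1"] Suc by simp
    also have "\<dots> = (if n = Suc j then monic_norm s c \<eta> (Suc j) else 0)"
    proof -
      \<comment> \<open>For \<open>n = j\<close> the two diagonal terms cancel, for
        \<open>Suc n = j\<close> the first and the last by \<open>norm\<close>, and
        \<open>n = Suc j\<close> gives the result. \<open>b0\<close> covers the truncated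
        predecessors of 0.\<close>
      have b0: "lowering_weight c 0 = 0" by (simp add: lowering_weight_def)
      show ?thesis by (cases n; cases j) (auto simp: norm b0)
    qed
    finally show ?thesis by (simp add: Suc)
  qed
qed

subsection \<open>Orthogonality of determinants\<close>

lemma strictly_decreasing_eq:
  fixes n n' :: "nat \<Rightarrow> nat"
  assumes "\<And>i j. i < j \<Longrightarrow> j < N \<Longrightarrow> n j < n i" "\<And>i j. i < j \<Longrightarrow> j < N \<Longrightarrow> n' j < n' i"
    and "n ` {..<N} = n' ` {..<N}" and i: "i < N"
  shows "n i = n' i"
proof -
  have sorted: "sorted_wrt (<) (rev (map m [0..<N]))" if "\<And>i j. i < j \<Longrightarrow> j < N \<Longrightarrow> m j < m i" for m :: "nat \<Rightarrow> nat"
    unfolding sorted_wrt_iff_nth_less by (auto simp: rev_nth intro!: that)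
  have "rev (map n [0..<N]) = rev (map n' [0..<N])"
    using sorted[of n] sorted[of n'] assms by (intro strict_sorted_equal) (auto simp: atLeast0LessThan)
  then have "map n [0..<N] = map n' [0..<N]" by simp
  then show ?thesis using i by (auto simp: map_eq_conv)
qed

lemma monic_step_substitute: "substitute \<sigma> (monic_step s c \<eta> n x) = monic_step s c \<eta> n (substitute \<sigma> x)"
  by (simp add: monic_step_def substitute_simps substitute_step_power)

lemma vars_in_monic_step: "vars_in X x \<Longrightarrow> vars_in X (monic_step s c \<eta> n x)"
  unfolding monic_step_def by (intro vars_in_sum vars_in_mult vars_in_step_power) auto

text \<open>Both determinants are expanded, and the functional factorizes over the variables. A pair
  p, q survives only if n after p equals n' after q; since both sequences decrease strictly, this
  forces n = n' and p = q, which leaves N! equal terms.\<close>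

lemma moment_functional_det_mult:
  fixes s c \<eta> :: "'a::field_char_0"
  assumes n: "\<And>i j. i < j \<Longrightarrow> j < N \<Longrightarrow> n j < n i" and n': "\<And>i j. i < j \<Longrightarrow> j < N \<Longrightarrow> n' j < n' i"
  shows "moment_functional {1..N} (step_weight s c \<eta>)
      (det (mat N N (\<lambda>(i, j). monic_step s c \<eta> (n i) (Var (Suc j))))
        * det (mat N N (\<lambda>(i, j). monic_step s c \<eta> (n' i) (Var (Suc j)))))
    = (if \<forall>i<N. n i = n' i then fact N * (\<Prod>i<N. monic_norm s c \<eta> (n i)) else 0)"
proof -
  let ?P = "{p. p permutes {0..<N}}" and ?M = "step_weight s c \<eta>"
  let ?l = "\<lambda>m j. monic_step s c \<eta> m (Var j)"
  have M: "?M 0 = 1" by (simp add: step_weight_def)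
  have Const_sgn: "signof p * signof q = (Const (signof p * signof q) :: 'a mpoly)" for p q :: "nat \<Rightarrow> nat"
    by (simp add: sign_def Const_uminus)
  have summand: "moment_functional {1..N} ?M (\<Prod>j<N. ?l (n (p j)) (Suc j) * ?l (n' (q j)) (Suc j))
      = (\<Prod>j<N. if n (p j) = n' (q j) then monic_norm s c \<eta> (n (p j)) else 0)" for p q
  proof -
    let ?f = "\<lambda>j. monic_step s c \<eta> (n (p (j - 1))) (Var 0) * monic_step s c \<eta> (n' (q (j - 1))) (Var 0)"
    have "(\<Prod>j<N. ?l (n (p j)) (Suc j) * ?l (n' (q j)) (Suc j)) = (\<Prod>j\<in>{1..N}. substitute (\<lambda>_. Var j) (?f j))"
      by (simp add: prod.atLeast1_atMost_eq substitute_mult monic_step_substitute)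
    also have "moment_functional {1..N} ?M \<dots> = (\<Prod>j\<in>{1..N}. moment_functional {0} ?M (?f j))"
      by (intro moment_functional_prod M vars_in_mult vars_in_monic_step) auto
    also have "\<dots> = (\<Prod>j<N. if n (p j) = n' (q j) then monic_norm s c \<eta> (n (p j)) else 0)"
      by (auto simp: prod.atLeast1_atMost_eq moment_functional_monic_step_mult intro!: prod.cong)
    finally show ?thesis .
  qed
  have "moment_functional {1..N} ?M
      (det (mat N N (\<lambda>(i, j). ?l (n i) (Suc j))) * det (mat N N (\<lambda>(i, j). ?l (n' i) (Suc j))))
    = (\<Sum>p\<in>?P. \<Sum>q\<in>?P. signof p * signof q * (\<Prod>j<N. if n (p j) = n' (q j) then monic_norm s c \<eta> (n (p j)) else 0))"
  proof -
    have "det (mat N N (\<lambda>(i, j). ?l (n i) (Suc j))) * det (mat N N (\<lambda>(i, j). ?l (n' i) (Suc j)))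
      = (\<Sum>p\<in>?P. \<Sum>q\<in>?P. Const (signof p * signof q) * (\<Prod>j<N. ?l (n (p j)) (Suc j) * ?l (n' (q j)) (Suc j)))"
      unfolding det_mat_Leibniz_columns sum_product prod.distrib Const_sgn[symmetric] by (simp only: mult_ac)
    then show ?thesis by (simp only: moment_functional_sum moment_functional_Const_mult summand)
  qed
  also have "\<dots> = (\<Sum>p\<in>?P. \<Sum>q\<in>?P. if (\<forall>i<N. n i = n' i) \<and> p = q then (\<Prod>i<N. monic_norm s c \<eta> (n i)) else 0)"
  proof (intro sum.cong refl)
    fix p q assume "p \<in> ?P" "q \<in> ?P"
    then have p: "p permutes {..<N}" and q: "q permutes {..<N}" by (simp_all add: atLeast0LessThan)
    show "signof p * signof q * (\<Prod>j<N. if n (p j) = n' (q j) then monic_norm s c \<eta> (n (p j)) else 0)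
        = (if (\<forall>i<N. n i = n' i) \<and> p = q then (\<Prod>i<N. monic_norm s c \<eta> (n i)) else 0)"
    proof (cases "\<forall>j<N. n (p j) = n' (q j)")
      case True
      have img: "(\<lambda>j. f (r j)) ` {..<N} = f ` {..<N}" if "r permutes {..<N}" for f r :: "nat \<Rightarrow> nat"
        using permutes_image[OF that] by (metis image_image)
      have "n ` {..<N} = n' ` {..<N}"
        using True img[OF p, of n] img[OF q, of n'] by (metis (mono_tags, lifting) image_cong lessThan_iff)
      then have eq: "\<forall>i<N. n i = n' i" using strictly_decreasing_eq[of N n n'] n n' by blast
      have inj: "inj_on n {..<N}"
        using n by (intro linorder_inj_onI') (metis lessThan_iff less_irrefl)
      have "p j = q j" for j
      proof (cases "j < N")
        case True
        then have "p j < N" "q j < N" using permutes_in_image[OF p] permutes_in_image[OF q] by auto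
        then have "n (p j) = n (q j)" using \<open>\<forall>j<N. n (p j) = n' (q j)\<close> True eq by metis
        then show ?thesis using inj \<open>p j < N\<close> \<open>q j < N\<close> by (simp add: inj_on_eq_iff)
      next
        case False
        then show ?thesis using p q by (simp add: permutes_not_in)
      qed
      then have "p = q" by (rule ext)
      have "(\<Prod>j<N. if n (p j) = n' (q j) then monic_norm s c \<eta> (n (p j)) else 0) = (\<Prod>j<N. monic_norm s c \<eta> (n (p j)))"
        using True by (intro prod.cong) auto
      also have "\<dots> = (\<Prod>i<N. monic_norm s c \<eta> (n i))"
        using prod.permute[OF p, of "\<lambda>i. monic_norm s c \<eta> (n i)"] by (simp add: o_def)
      finally show ?thesis using eq \<open>p = q\<close> by (simp add: sign_def)
    next
      case False
      then obtain j where "j < N" "n (p j) \<noteq> n' (q j)" by blast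
      then have "(\<Prod>j<N. if n (p j) = n' (q j) then monic_norm s c \<eta> (n (p j)) else 0) = 0"
        by (intro prod_zero bexI[of _ j]) auto
      moreover have "\<not> ((\<forall>i<N. n i = n' i) \<and> p = q)"
        using \<open>j < N\<close> \<open>n (p j) \<noteq> n' (q j)\<close> permutes_in_image[OF p, of j] by auto
      ultimately show ?thesis by (simp only: if_False mult_zero_right)
    qed
  qed
  also have "\<dots> = (if \<forall>i<N. n i = n' i then fact N * (\<Prod>i<N. monic_norm s c \<eta> (n i)) else 0)"
  proof (cases "\<forall>i<N. n i = n' i")
    case True
    then show ?thesis using card_permutations[of "{0..<N}" N] by (simp add: finite_permutations)
  next
    case False
    then show ?thesis by (simp only: False simp_thms if_False sum.neutral_const)
  qed
  finally show ?thesis .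
qed


section \<open>Interpolation in the parameters\<close>

definition expansion_coeff :: "'a::field_char_0 \<Rightarrow> 'a \<Rightarrow> 'a \<Rightarrow> nat list \<Rightarrow> nat list \<Rightarrow> 'a" where
  "expansion_coeff z z' \<eta> \<nu> \<mu> = (- \<eta>) ^ (sum_list \<nu> - sum_list \<mu>) * branching_coeff z z' \<nu> \<mu>"

definition step_family :: "'a::field_char_0 \<Rightarrow> 'a \<Rightarrow> 'a \<Rightarrow> 'a \<Rightarrow> nat list \<Rightarrow> 'a mpoly_seq" where
  "step_family s z z' \<eta> \<nu> = (\<Sum>\<mu>\<in>subpartitions \<nu>. scale (expansion_coeff z z' \<eta> \<nu> \<mu>) (step_schur s \<mu>))"

definition finite_family :: "'a::field_char_0 \<Rightarrow> 'a \<Rightarrow> 'a \<Rightarrow> 'a \<Rightarrow> nat \<Rightarrow> nat list \<Rightarrow> 'a mpoly" where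
  "finite_family s z z' \<eta> N \<nu> = (\<Sum>\<mu>\<in>subpartitions \<nu>.
     Const (expansion_coeff z z' \<eta> \<nu> \<mu>) * bialternant (step_power s) \<mu> N)"

text \<open>The functional of an orthogonal polynomial ensemble. Each Vandermonde factor cancels the
  denominator of one of the two polynomials to be multiplied; the divisor, when nonzero, normalizes
  the value at 1 to 1.\<close>

definition finite_functional :: "'a::field_char_0 \<Rightarrow> 'a \<Rightarrow> 'a \<Rightarrow> nat \<Rightarrow> 'a mpoly \<Rightarrow> 'a" where
  "finite_functional s c \<eta> N f =
     moment_functional {1..N} (step_weight s c \<eta>) (f * (vandermonde N * vandermonde N))
       / (fact N * (\<Prod>i<N. monic_norm s c \<eta> (N - Suc i)))"

lemma finite_functional_sum:
  "finite_functional s c \<eta> N (\<Sum>a\<in>A. Const (u a) * f a) = (\<Sum>a\<in>A. u a * finite_functional s c \<eta> N (f a))"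
  by (simp add: finite_functional_def sum_distrib_right mult.assoc moment_functional_sum
      moment_functional_Const_mult sum_divide_distrib)

lemma finite_family_mult_vandermonde:
  assumes "\<nu> \<in> partitions" "length \<nu> \<le> N"
  shows "finite_family s (of_nat N) (of_nat N + c - 1) \<eta> N \<nu> * vandermonde N
    = det (mat N N (\<lambda>(i, j). monic_step s c \<eta> (strict_exponents \<nu> N i) (Var (Suc j))))"
proof -
  have "length \<mu> \<le> N" if "\<mu> \<in> subpartitions \<nu>" for \<mu>
    using length_subpartitions[OF that assms(1)] assms(2) by simp
  then show ?thesis
    unfolding branching_sum_eq_det[OF assms, symmetric] finite_family_def sum_distrib_right expansion_coeff_def
    by (intro sum.cong refl) (simp add: mult.assoc bialternant_mult_vandermonde)
qed

lemma strict_exponents_eq_iff: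
  assumes "\<mu> \<in> partitions" "\<nu> \<in> partitions" "length \<mu> \<le> N" "length \<nu> \<le> N"
  shows "(\<forall>i<N. strict_exponents \<mu> N i = strict_exponents \<nu> N i) \<longleftrightarrow> \<mu> = \<nu>"
proof
  assume *: "\<forall>i<N. strict_exponents \<mu> N i = strict_exponents \<nu> N i"
  show "\<mu> = \<nu>"
  proof (rule partition_eqI[OF assms(1,2)])
    fix i :: nat assume "1 \<le> i"
    show "Defs.row \<mu> i = Defs.row \<nu> i"
    proof (cases "i \<le> N")
      case True
      then have "i - 1 < N" "Suc (i - 1) = i" using \<open>1 \<le> i\<close> by auto
      with *[rule_format, of "i - 1"] True show ?thesis by (simp only: strict_exponents_def) simp
    qed (use assms in \<open>simp add: row_def\<close>)
  qed
qed simp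

text \<open>Passing from exponent N - i to \<nu>_i + N - i adds one recurrence coefficient for each
  box (i, j), at index N - i + j = N + content, so the quotient of norms is a product over the
  boxes.\<close>

lemma prod_monic_norm:
  assumes \<nu>: "\<nu> \<in> partitions" "length \<nu> \<le> N"
  shows "(\<Prod>i<N. monic_norm s c \<eta> (strict_exponents \<nu> N i)) = (\<Prod>i<N. monic_norm s c \<eta> (N - Suc i))
    * ((\<eta> * (\<eta> + s)) ^ sum_list \<nu> * skew_pochhammer (of_nat N) \<nu> [] * skew_pochhammer (of_nat N + c - 1) \<nu> [])"
proof -
  let ?g = "\<lambda>m. \<eta> * (\<eta> + s) * lowering_weight c m"
  have split: "monic_norm s c \<eta> (strict_exponents \<nu> N i) = monic_norm s c \<eta> (N - Suc i)
      * (\<Prod>j\<in>{1..Defs.row \<nu> (Suc i)}. ?g (N - Suc i + j))" if "i < N" for i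
  proof -
    have n: "strict_exponents \<nu> N i = N - Suc i + Defs.row \<nu> (Suc i)" using that by (simp add: strict_exponents_def)
    let ?A = "{0<..N - Suc i}" and ?J = "{1..Defs.row \<nu> (Suc i)}"
    have "{0<..strict_exponents \<nu> N i} = ?A \<union> (\<lambda>j. N - Suc i + j) ` ?J"
      unfolding n image_add_atLeastAtMost by auto
    then have "monic_norm s c \<eta> (strict_exponents \<nu> N i) = prod ?g (?A \<union> (\<lambda>j. N - Suc i + j) ` ?J)"
      by (simp only: monic_norm_def)
    also have "\<dots> = prod ?g ?A * prod ?g ((\<lambda>j. N - Suc i + j) ` ?J)"
      by (rule prod.union_disjoint) auto
    also have "prod ?g ((\<lambda>j. N - Suc i + j) ` ?J) = (\<Prod>j\<in>?J. ?g (N - Suc i + j))"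
      by (subst prod.reindex) (simp_all only: o_def inj_on_add)
    finally show ?thesis by (simp only: monic_norm_def)
  qed
  have "diagram \<nu> = Sigma {1..N} (\<lambda>i. {1..Defs.row \<nu> i})"
    using \<nu>(2) by (auto simp: diagram_def row_def split: if_splits)
  then have "(\<Prod>i\<in>{1..N}. \<Prod>j\<in>{1..Defs.row \<nu> i}. ?g (N - i + j)) = (\<Prod>(i, j)\<in>diagram \<nu>. ?g (N - i + j))"
    by (simp only:) (rule prod.Sigma, auto)
  also have "\<dots> = (\<Prod>b\<in>diagram \<nu>. \<eta> * (\<eta> + s) * ((of_nat N + of_int (content b)) * (of_nat N + c - 1 + of_int (content b))))"
  proof (rule prod.cong)
    fix b assume "b \<in> diagram \<nu>"
    then obtain i j where b: "b = (i, j)" "1 \<le> i" "i \<le> N" "1 \<le> j"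
      using \<nu>(2) by (cases b) (auto simp: diagram_def row_def split: if_splits)
    then have "of_nat (N - i + j) = (of_nat N + of_int (content b) :: 'a)"
      by (simp add: content_def of_nat_diff)
    then show "(case b of (i, j) \<Rightarrow> ?g (N - i + j))
        = \<eta> * (\<eta> + s) * ((of_nat N + of_int (content b)) * (of_nat N + c - 1 + of_int (content b)))"
      by (simp only: b(1) prod.case lowering_weight_def) (simp add: algebra_simps)
  qed simp
  also have "\<dots> = (\<eta> * (\<eta> + s)) ^ sum_list \<nu> * skew_pochhammer (of_nat N) \<nu> [] * skew_pochhammer (of_nat N + c - 1) \<nu> []"
    by (simp add: prod.distrib power_mult_distrib skew_pochhammer_def card_diagram diagram_eq_Sigma[of "[]"] mult.assoc)
  finally have "(\<Prod>i<N. \<Prod>j\<in>{1..Defs.row \<nu> (Suc i)}. ?g (N - Suc i + j))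
      = (\<eta> * (\<eta> + s)) ^ sum_list \<nu> * skew_pochhammer (of_nat N) \<nu> [] * skew_pochhammer (of_nat N + c - 1) \<nu> []"
    by (simp add: prod.atLeast1_atMost_eq)
  moreover have "(\<Prod>i<N. monic_norm s c \<eta> (strict_exponents \<nu> N i))
      = (\<Prod>i<N. monic_norm s c \<eta> (N - Suc i) * (\<Prod>j\<in>{1..Defs.row \<nu> (Suc i)}. ?g (N - Suc i + j)))"
    by (intro prod.cong) (simp_all add: split)
  ultimately show ?thesis by (simp add: prod.distrib)
qed

text \<open>The Vandermonde factors turn both polynomials into determinants. The two nondegeneracy
  hypotheses make the normalizing divisor nonzero.\<close>

lemma finite_family_orthogonal:
  fixes s c \<eta> :: "'a::field_char_0"
  assumes \<mu>: "\<mu> \<in> partitions" "length \<mu> \<le> N" and \<nu>: "\<nu> \<in> partitions" "length \<nu> \<le> N"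
    and ne: "\<eta> * (\<eta> + s) \<noteq> 0" "\<And>m. 1 \<le> m \<Longrightarrow> lowering_weight c m \<noteq> 0"
  defines "F \<equiv> finite_family s (of_nat N) (of_nat N + c - 1) \<eta> N"
  shows "finite_functional s c \<eta> N (F \<mu> * F \<nu>) = (if \<mu> = \<nu> then (\<eta> * (\<eta> + s)) ^ sum_list \<nu>
      * skew_pochhammer (of_nat N) \<nu> [] * skew_pochhammer (of_nat N + c - 1) \<nu> [] else 0)"
proof -
  have norm: "monic_norm s c \<eta> n \<noteq> 0" for n using ne by (auto simp: monic_norm_def Suc_le_eq)
  have "F \<mu> * F \<nu> * (vandermonde N * vandermonde N) = (F \<mu> * vandermonde N) * (F \<nu> * vandermonde N)"
    by (simp only: mult_ac)
  then have "finite_functional s c \<eta> N (F \<mu> * F \<nu>)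
    = (if \<mu> = \<nu> then fact N * (\<Prod>i<N. monic_norm s c \<eta> (strict_exponents \<mu> N i)) else 0)
      / (fact N * (\<Prod>i<N. monic_norm s c \<eta> (N - Suc i)))"
    unfolding finite_functional_def F_def finite_family_mult_vandermonde[OF \<mu>] finite_family_mult_vandermonde[OF \<nu>]
    using moment_functional_det_mult[of N "strict_exponents \<mu> N" "strict_exponents \<nu> N" s c \<eta>]
      strict_exponents_decreasing[OF \<mu>(1)] strict_exponents_decreasing[OF \<nu>(1)]
    by (simp only: strict_exponents_eq_iff[OF \<mu>(1) \<nu>(1) \<mu>(2) \<nu>(2)])
  then show ?thesis using norm by (simp add: prod_monic_norm[OF \<nu>])
qed

lemma finite_family_Nil: "finite_family s z z' \<eta> N [] = 1"
proof -
  have "subpartitions [] = {[]}"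
    using length_subpartitions[of _ "[]"] by (auto simp: partitions_def intro: subpartitions_self)
  moreover have "bialternant (step_power s) [] N = (1 :: 'a mpoly)"
  proof -
    have "strict_exponents [] N = (\<lambda>i. N - Suc i)" by (simp add: strict_exponents_def row_def fun_eq_iff)
    then have "bialternant (step_power s) [] N * vandermonde N = 1 * (vandermonde N :: 'a mpoly)"
      using bialternant_mult_vandermonde[of "[]" N s] by (simp add: alternant_eq_vandermonde)
    then show ?thesis by (simp only: mult_right_cancel vandermonde_nonzero not_False_eq_True)
  qed
  ultimately show ?thesis by (simp add: finite_family_def expansion_coeff_def)
qed

section \<open>Polynomial functions of one parameter and triangular systems\<close>

definition is_polyfun :: "('a::comm_ring_1 \<Rightarrow> 'a) \<Rightarrow> bool" where
  "is_polyfun f \<longleftrightarrow> (\<exists>p. \<forall>t. f t = poly p t)"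

lemma is_polyfun_const: "is_polyfun (\<lambda>t. a)"
  unfolding is_polyfun_def by (intro exI[of _ "[:a:]"]) simp

lemma is_polyfun_ident: "is_polyfun (\<lambda>t. t)"
  unfolding is_polyfun_def by (intro exI[of _ "[:0, 1:]"]) simp

lemma is_polyfun_poly: "is_polyfun (poly p)"
  unfolding is_polyfun_def by blast

lemma is_polyfun_add: "is_polyfun f \<Longrightarrow> is_polyfun g \<Longrightarrow> is_polyfun (\<lambda>t. f t + g t)"
  unfolding is_polyfun_def by (metis poly_add)

lemma is_polyfun_diff: "is_polyfun f \<Longrightarrow> is_polyfun g \<Longrightarrow> is_polyfun (\<lambda>t. f t - g t)"
  unfolding is_polyfun_def by (metis poly_diff)

lemma is_polyfun_mult: "is_polyfun f \<Longrightarrow> is_polyfun g \<Longrightarrow> is_polyfun (\<lambda>t. f t * g t)"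
  unfolding is_polyfun_def by (metis poly_mult)

lemma is_polyfun_sum: "(\<And>a. a \<in> A \<Longrightarrow> is_polyfun (f a)) \<Longrightarrow> is_polyfun (\<lambda>t. \<Sum>a\<in>A. f a t)"
  by (induction A rule: infinite_finite_induct) (simp_all add: is_polyfun_const is_polyfun_add)

lemma is_polyfun_prod: "(\<And>a. a \<in> A \<Longrightarrow> is_polyfun (f a)) \<Longrightarrow> is_polyfun (\<lambda>t. \<Prod>a\<in>A. f a t)"
  by (induction A rule: infinite_finite_induct) (simp_all add: is_polyfun_const is_polyfun_mult)

lemma is_polyfun_power: "is_polyfun f \<Longrightarrow> is_polyfun (\<lambda>t. f t ^ n)"
  by (induction n) (simp_all add: is_polyfun_const is_polyfun_mult)

lemma is_polyfun_uminus: "is_polyfun f \<Longrightarrow> is_polyfun (\<lambda>t. - f t)"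
  using is_polyfun_diff[OF is_polyfun_const[of 0]] by simp

lemma is_polyfun_skew_pochhammer: "is_polyfun f \<Longrightarrow> is_polyfun (\<lambda>t. skew_pochhammer (f t) \<nu> \<mu>)"
  unfolding skew_pochhammer_def by (intro is_polyfun_prod is_polyfun_add is_polyfun_const)

lemma is_polyfun_expansion_coeff:
  "is_polyfun f \<Longrightarrow> is_polyfun g \<Longrightarrow> is_polyfun h \<Longrightarrow> is_polyfun (\<lambda>t. expansion_coeff (f t) (g t) (h t) \<nu> \<mu>)"
  unfolding expansion_coeff_def branching_coeff_def
  by (intro is_polyfun_mult is_polyfun_power is_polyfun_uminus is_polyfun_skew_pochhammer is_polyfun_const)

lemma is_polyfun_eq_0:
  fixes f :: "'a::{comm_ring_1, ring_no_zero_divisors} \<Rightarrow> 'a"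
  assumes "is_polyfun f" "infinite {t. f t = 0}"
  shows "f t = 0"
proof -
  obtain p where p: "\<And>t. f t = poly p t" using assms(1) by (auto simp: is_polyfun_def)
  then have "infinite {t. poly p t = 0}" using assms(2) by simp
  then show ?thesis using poly_roots_finite[of p] p by (metis poly_0)
qed

text \<open>The defining equations of a formal moment functional, written for its values
  \<open>\<psi> \<mu>\<close> on the Schur basis. In this form they make sense for functionals on
  different spaces.\<close>

definition triangular_system :: "'a::field_char_0 \<Rightarrow> 'a \<Rightarrow> 'a \<Rightarrow> (nat list \<Rightarrow> 'a) \<Rightarrow> nat list \<Rightarrow> bool" where
  "triangular_system z z' \<eta> \<psi> \<tau> \<longleftrightarrow>
     (\<Sum>\<mu>\<in>subpartitions \<tau>. expansion_coeff z z' \<eta> \<tau> \<mu> * \<psi> \<mu>) = (if \<tau> = [] then 1 else 0)"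

text \<open>Forward substitution with diagonal coefficient 1. The order of quantifiers is the point:
  one polynomial serves all parameters \<open>t\<close> and all solutions \<psi>, so it links the
  formal functional to the finite ones.\<close>

lemma triangular_system_solution:
  fixes f g h :: "'a::field_char_0 \<Rightarrow> 'a"
  assumes fgh: "is_polyfun f" "is_polyfun g" "is_polyfun h" and "\<kappa> \<in> partitions"
  shows "\<exists>p. \<forall>t \<psi>. (\<forall>\<tau>\<in>subpartitions \<kappa>. triangular_system (f t) (g t) (h t) \<psi> \<tau>) \<longrightarrow> \<psi> \<kappa> = poly p t"
  using assms(4)
proof (induction "sum_list \<kappa>" arbitrary: \<kappa> rule: less_induct)
  case less
  let ?S = "\<lambda>t \<psi> \<kappa>. \<forall>\<tau>\<in>subpartitions \<kappa>. triangular_system (f t) (g t) (h t) \<psi> \<tau>"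
  let ?I = "subpartitions \<kappa> - {\<kappa>}" and ?e = "\<lambda>t. expansion_coeff (f t) (g t) (h t)"
  have "\<exists>p. \<forall>t \<psi>. ?S t \<psi> \<mu> \<longrightarrow> \<psi> \<mu> = poly p t" if \<mu>: "\<mu> \<in> ?I" for \<mu>
  proof (rule less.hyps)
    have "diagram \<mu> \<subset> diagram \<kappa>"
      using \<mu> subpartition_eqI[of \<mu> \<kappa>] less.prems by (auto simp: subpartitions_def)
    from psubset_card_mono[OF finite_diagram this] show "sum_list \<mu> < sum_list \<kappa>" by (simp add: card_diagram)
    show "\<mu> \<in> partitions" using \<mu> by (simp add: subpartitions_def)
  qed
  then obtain p where p: "\<And>\<mu> t \<psi>. \<mu> \<in> ?I \<Longrightarrow> ?S t \<psi> \<mu> \<Longrightarrow> \<psi> \<mu> = poly (p \<mu>) t" by metis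
  have "is_polyfun (\<lambda>t. (if \<kappa> = [] then 1 else 0) - (\<Sum>\<mu>\<in>?I. ?e t \<kappa> \<mu> * poly (p \<mu>) t))"
    by (intro is_polyfun_diff is_polyfun_const is_polyfun_sum is_polyfun_mult is_polyfun_expansion_coeff fgh is_polyfun_poly)
  then obtain q where q: "\<And>t. (if \<kappa> = [] then 1 else 0) - (\<Sum>\<mu>\<in>?I. ?e t \<kappa> \<mu> * poly (p \<mu>) t) = poly q t"
    by (auto simp: is_polyfun_def)
  have "\<psi> \<kappa> = poly q t" if S: "?S t \<psi> \<kappa>" for t \<psi>
  proof -
    have "\<psi> \<mu> = poly (p \<mu>) t" if \<mu>: "\<mu> \<in> ?I" for \<mu>
      using S subpartitions_trans[of _ \<mu> \<kappa>] \<mu> by (intro p) auto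
    then have eq: "(\<Sum>\<mu>\<in>?I. ?e t \<kappa> \<mu> * \<psi> \<mu>) = (\<Sum>\<mu>\<in>?I. ?e t \<kappa> \<mu> * poly (p \<mu>) t)" by simp
    have \<kappa>: "\<kappa> \<in> subpartitions \<kappa>" by (rule subpartitions_self[OF less.prems])
    have "(\<Sum>\<mu>\<in>subpartitions \<kappa>. ?e t \<kappa> \<mu> * \<psi> \<mu>) = ?e t \<kappa> \<kappa> * \<psi> \<kappa> + (\<Sum>\<mu>\<in>?I. ?e t \<kappa> \<mu> * \<psi> \<mu>)"
      by (rule sum.remove[OF finite_subpartitions \<kappa>])
    moreover have "?e t \<kappa> \<kappa> = 1" by (simp add: expansion_coeff_def)
    ultimately have "\<psi> \<kappa> = (\<Sum>\<mu>\<in>subpartitions \<kappa>. ?e t \<kappa> \<mu> * \<psi> \<mu>) - (\<Sum>\<mu>\<in>?I. ?e t \<kappa> \<mu> * \<psi> \<mu>)"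
      by (simp only: mult_1 add_diff_cancel_right')
    also have "(\<Sum>\<mu>\<in>subpartitions \<kappa>. ?e t \<kappa> \<mu> * \<psi> \<mu>) = (if \<kappa> = [] then 1 else 0)"
      using S \<kappa> unfolding triangular_system_def by blast
    finally show ?thesis unfolding eq q .
  qed
  then show ?case by blast
qed

text \<open>The product is expanded in the algebra of stable sequences and each component is
  unshifted afterwards, so the same constants \<open>C\<close> serve every number of
  variables.\<close>

lemma step_schur_mult:
  fixes s :: "'a::field"
  assumes "\<alpha> \<in> partitions" "\<beta> \<in> partitions"
  obtains K C where "finite K" "K \<subseteq> partitions"
    "step_schur s \<alpha> * step_schur s \<beta> = (\<Sum>\<kappa>\<in>K. scale (C \<kappa>) (step_schur s \<kappa>))"
    "\<And>N. bialternant (step_power s) \<alpha> N * bialternant (step_power s) \<beta> N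
       = (\<Sum>\<kappa>\<in>K. Const (C \<kappa>) * bialternant (step_power s) \<kappa> N)"
proof -
  interpret triangular_family s "step_schur s" partition_exponent by (rule triangular_family_step_schur)
  obtain K C where KC: "finite K" "K \<subseteq> partitions"
    "step_schur s \<alpha> * step_schur s \<beta> = (\<Sum>\<kappa>\<in>K. scale (C \<kappa>) (step_schur s \<kappa>))"
    using spans[OF Sym_step_mult[OF step_schur_mem[OF assms(1)] step_schur_mem[OF assms(2)]]]
    by (auto simp: partition_span_def)
  have "bialternant (step_power s) \<alpha> N * bialternant (step_power s) \<beta> N
       = (\<Sum>\<kappa>\<in>K. Const (C \<kappa>) * bialternant (step_power s) \<kappa> N)" for N
  proof -
    have "substitute (shift_var s N) (bialternant (step_power s) \<alpha> N * bialternant (step_power s) \<beta> N)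
        = substitute (shift_var s N) (\<Sum>\<kappa>\<in>K. Const (C \<kappa>) * bialternant (step_power s) \<kappa> N)"
      using fun_cong[OF KC(3), of N]
      by (simp only: times_fun_apply sum_seq_apply scale_apply step_schur_def substitute_simps substitute_Const)
    then show ?thesis by (simp only: substitute_shift_var_eq_iff)
  qed
  then show thesis using KC by (intro that) auto
qed

text \<open>The functional is determined by the triangular system, so the quantity to be computed is a
  polynomial in the parameters. On the line \<open>(z + t, z' + \<i> t, \<eta> + t)\<close> the points with
  \<open>z + t = N\<close> reduce to \<open>N\<close> variables, and all but finitely many of them are nondegenerate.\<close>

lemma step_family_orthogonal:
  fixes s z z' \<eta> :: complex and \<phi> :: "complex mpoly_seq \<Rightarrow> complex"
  assumes add: "\<And>f g. f \<in> Sym_step s \<Longrightarrow> g \<in> Sym_step s \<Longrightarrow> \<phi> (f + g) = \<phi> f + \<phi> g"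
    and scale: "\<And>a f. f \<in> Sym_step s \<Longrightarrow> \<phi> (scale a f) = a * \<phi> f"
    and init: "\<And>\<nu>. \<nu> \<in> partitions \<Longrightarrow> \<phi> (step_family s z z' \<eta> \<nu>) = (if \<nu> = [] then 1 else 0)"
    and \<mu>: "\<mu> \<in> partitions" and \<nu>: "\<nu> \<in> partitions"
  shows "\<phi> (step_family s z z' \<eta> \<mu> * step_family s z z' \<eta> \<nu>)
    = (if \<mu> = \<nu> then (\<eta> * (\<eta> + s)) ^ sum_list \<nu> * skew_pochhammer z \<nu> [] * skew_pochhammer z' \<nu> [] else 0)"
proof -
  let ?S = "step_schur s" and ?B = "\<lambda>N \<kappa>. bialternant (step_power s) \<kappa> N"
  have phi_sum: "\<phi> (\<Sum>a\<in>A. scale (u a) (f a)) = (\<Sum>a\<in>A. u a * \<phi> (f a))"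
    if "finite A" "\<And>a. a \<in> A \<Longrightarrow> f a \<in> Sym_step s" for A :: "'x set" and u f
    using that
  proof (induction A)
    case empty
    show ?case using scale[OF Sym_step_0_mem, of 0] by (simp only: sum.empty scale_0 mult_zero_left)
  next
    case (insert a A)
    have mem: "(\<Sum>a\<in>A. scale (u a) (f a)) \<in> Sym_step s" "f a \<in> Sym_step s"
      by (intro Sym_step_sum Sym_step_scale insert.prems; simp)+
    have "\<phi> (\<Sum>a\<in>A. scale (u a) (f a)) = (\<Sum>a\<in>A. u a * \<phi> (f a))" using insert.IH insert.prems by blast
    then show ?case
      by (simp only: sum.insert[OF insert.hyps] add[OF Sym_step_scale[OF mem(2)] mem(1)] scale[OF mem(2)])
  qed
  define zt where "zt t = z + t" for t
  define zt' where "zt' t = z' + \<i> * t" for t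
  define \<eta>t where "\<eta>t t = \<eta> + t" for t
  have polys: "is_polyfun zt" "is_polyfun zt'" "is_polyfun \<eta>t"
    unfolding zt_def zt'_def \<eta>t_def
    by (intro is_polyfun_add is_polyfun_mult is_polyfun_const is_polyfun_ident)+
  have at_0: "zt 0 = z" "zt' 0 = z'" "\<eta>t 0 = \<eta>" by (simp_all add: zt_def zt'_def \<eta>t_def)
  let ?e = "\<lambda>t. expansion_coeff (zt t) (zt' t) (\<eta>t t)"
  let ?I = "subpartitions \<mu> \<times> subpartitions \<nu>"
  have "\<forall>ab\<in>?I. \<exists>KC. finite (fst KC) \<and> fst KC \<subseteq> partitions
    \<and> ?S (fst ab) * ?S (snd ab) = (\<Sum>\<kappa>\<in>fst KC. scale (snd KC \<kappa>) (?S \<kappa>))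
    \<and> (\<forall>N. ?B N (fst ab) * ?B N (snd ab) = (\<Sum>\<kappa>\<in>fst KC. Const (snd KC \<kappa>) * ?B N \<kappa>))"
  proof
    fix ab assume "ab \<in> ?I"
    then have "fst ab \<in> partitions" "snd ab \<in> partitions" by (auto dest: subpartitions_partitions)
    then obtain K C where "finite K" "K \<subseteq> partitions"
      "?S (fst ab) * ?S (snd ab) = (\<Sum>\<kappa>\<in>K. scale (C \<kappa>) (?S \<kappa>))"
      "\<And>N. ?B N (fst ab) * ?B N (snd ab) = (\<Sum>\<kappa>\<in>K. Const (C \<kappa>) * ?B N \<kappa>)"
      by (rule step_schur_mult[of _ _ s]) (rule that)
    then show "\<exists>KC. finite (fst KC) \<and> fst KC \<subseteq> partitions
      \<and> ?S (fst ab) * ?S (snd ab) = (\<Sum>\<kappa>\<in>fst KC. scale (snd KC \<kappa>) (?S \<kappa>))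
      \<and> (\<forall>N. ?B N (fst ab) * ?B N (snd ab) = (\<Sum>\<kappa>\<in>fst KC. Const (snd KC \<kappa>) * ?B N \<kappa>))"
      by (intro exI[of _ "(K, C)"] conjI allI) (simp_all only: fst_conv snd_conv)
  qed
  from bchoice[OF this] obtain KC where KC: "\<forall>ab\<in>?I. finite (fst (KC ab)) \<and> fst (KC ab) \<subseteq> partitions
    \<and> ?S (fst ab) * ?S (snd ab) = (\<Sum>\<kappa>\<in>fst (KC ab). scale (snd (KC ab) \<kappa>) (?S \<kappa>))
    \<and> (\<forall>N. ?B N (fst ab) * ?B N (snd ab) = (\<Sum>\<kappa>\<in>fst (KC ab). Const (snd (KC ab) \<kappa>) * ?B N \<kappa>))"
    by (rule exE)
  define K where "K ab = fst (KC ab)" for ab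
  define C where "C ab = snd (KC ab)" for ab
  note KC = KC[folded K_def C_def]
  have K: "finite (K ab)" "K ab \<subseteq> partitions" if "ab \<in> ?I" for ab
    using bspec[OF KC that] by blast+
  have S_mult: "?S (fst ab) * ?S (snd ab) = (\<Sum>\<kappa>\<in>K ab. scale (C ab \<kappa>) (?S \<kappa>))" if "ab \<in> ?I" for ab
    using bspec[OF KC that] by blast
  have B_mult: "?B N (fst ab) * ?B N (snd ab) = (\<Sum>\<kappa>\<in>K ab. Const (C ab \<kappa>) * ?B N \<kappa>)" if "ab \<in> ?I" for ab N
    using bspec[OF KC that] by blast
  have "\<forall>\<kappa>\<in>partitions. \<exists>p. \<forall>t \<psi>. (\<forall>\<tau>\<in>subpartitions \<kappa>. triangular_system (zt t) (zt' t) (\<eta>t t) \<psi> \<tau>) \<longrightarrow> \<psi> \<kappa> = poly p t"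
    by (intro ballI triangular_system_solution[OF polys])
  from bchoice[OF this] obtain P where P0: "\<forall>\<kappa>\<in>partitions. \<forall>t \<psi>.
      (\<forall>\<tau>\<in>subpartitions \<kappa>. triangular_system (zt t) (zt' t) (\<eta>t t) \<psi> \<tau>) \<longrightarrow> \<psi> \<kappa> = poly (P \<kappa>) t"
    by (rule exE)
  have P: "\<psi> \<kappa> = poly (P \<kappa>) t" if "\<kappa> \<in> partitions"
    "\<And>\<tau>. \<tau> \<in> subpartitions \<kappa> \<Longrightarrow> triangular_system (zt t) (zt' t) (\<eta>t t) \<psi> \<tau>" for \<kappa> t \<psi>
    using P0 that by blast
  \<comment> \<open>\<open>V \<psi> t\<close> is the value of the product of the two family members
    at parameter \<open>t\<close>, computed from values \<psi> on the Schur basis and from constants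
    \<open>C\<close> that do not involve \<open>t\<close>.\<close>
  define V where "V \<psi> t = (\<Sum>ab\<in>?I. ?e t \<mu> (fst ab) * ?e t \<nu> (snd ab) * (\<Sum>\<kappa>\<in>K ab. C ab \<kappa> * \<psi> \<kappa>))" for \<psi> t
  define R where "R t = (if \<mu> = \<nu> then (\<eta>t t * (\<eta>t t + s)) ^ sum_list \<nu>
      * skew_pochhammer (zt t) \<nu> [] * skew_pochhammer (zt' t) \<nu> [] else 0)" for t
  define Q where "Q t = V (\<lambda>\<kappa>. poly (P \<kappa>) t) t - R t" for t
  have V_eq: "V \<psi> t = V (\<lambda>\<kappa>. poly (P \<kappa>) t) t"
    if "\<And>ab \<kappa>. ab \<in> ?I \<Longrightarrow> \<kappa> \<in> K ab \<Longrightarrow> \<psi> \<kappa> = poly (P \<kappa>) t" for \<psi> t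
    unfolding V_def using that by (intro sum.cong refl arg_cong2[where f = "(*)"]) auto
  have Q_poly: "is_polyfun Q"
  proof -
    have "is_polyfun R"
      unfolding R_def by (cases "\<mu> = \<nu>") (simp_all add: is_polyfun_mult is_polyfun_power is_polyfun_add
        is_polyfun_skew_pochhammer is_polyfun_const polys)
    moreover have "is_polyfun (\<lambda>t. V (\<lambda>\<kappa>. poly (P \<kappa>) t) t)"
      unfolding V_def by (intro is_polyfun_sum is_polyfun_mult is_polyfun_expansion_coeff polys is_polyfun_const is_polyfun_poly)
    ultimately show ?thesis unfolding Q_def by (intro is_polyfun_diff)
  qed
  have prod_expand: "(\<Sum>\<alpha>\<in>subpartitions \<mu>. u \<alpha>) * (\<Sum>\<beta>\<in>subpartitions \<nu>. v \<beta>) = (\<Sum>ab\<in>?I. u (fst ab) * v (snd ab))"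
    for u v :: "nat list \<Rightarrow> 'r::comm_ring_1"
    by (simp add: sum_product sum.cartesian_product case_prod_unfold)
  have phi_V: "\<phi> (step_family s z z' \<eta> \<mu> * step_family s z z' \<eta> \<nu>) = V (\<lambda>\<kappa>. \<phi> (?S \<kappa>)) 0"
  proof -
    have "step_family s z z' \<eta> \<mu> * step_family s z z' \<eta> \<nu>
      = (\<Sum>ab\<in>?I. scale (?e 0 \<mu> (fst ab) * ?e 0 \<nu> (snd ab)) (?S (fst ab) * ?S (snd ab)))"
      unfolding step_family_def prod_expand at_0
      by (intro sum.cong refl) (simp add: fun_eq_iff Const_mult mult_ac)
    then have "\<phi> (step_family s z z' \<eta> \<mu> * step_family s z z' \<eta> \<nu>)
      = (\<Sum>ab\<in>?I. ?e 0 \<mu> (fst ab) * ?e 0 \<nu> (snd ab) * \<phi> (?S (fst ab) * ?S (snd ab)))"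
      by (simp only:) (rule phi_sum, auto intro!: Sym_step_mult step_schur_mem simp: finite_subpartitions
        dest: subpartitions_partitions)
    also have "\<dots> = V (\<lambda>\<kappa>. \<phi> (?S \<kappa>)) 0"
      unfolding V_def
    proof (intro sum.cong refl arg_cong2[where f = "(*)"])
      fix ab assume ab: "ab \<in> ?I"
      show "\<phi> (?S (fst ab) * ?S (snd ab)) = (\<Sum>\<kappa>\<in>K ab. C ab \<kappa> * \<phi> (?S \<kappa>))"
        unfolding S_mult[OF ab] using K[OF ab] by (intro phi_sum step_schur_mem) auto
    qed
    finally show ?thesis .
  qed
  have phi_poly: "\<phi> (?S \<kappa>) = poly (P \<kappa>) 0" if "\<kappa> \<in> partitions" for \<kappa>
  proof (rule P[OF that])
    fix \<tau> assume "\<tau> \<in> subpartitions \<kappa>"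
    then have \<tau>: "\<tau> \<in> partitions" by (rule subpartitions_partitions)
    have "\<phi> (step_family s z z' \<eta> \<tau>) = (\<Sum>\<mu>\<in>subpartitions \<tau>. expansion_coeff z z' \<eta> \<tau> \<mu> * \<phi> (?S \<mu>))"
      unfolding step_family_def
      by (intro phi_sum finite_subpartitions step_schur_mem subpartitions_partitions)
    then show "triangular_system (zt 0) (zt' 0) (\<eta>t 0) (\<lambda>\<kappa>. \<phi> (?S \<kappa>)) \<tau>"
      using init[OF \<tau>] by (simp add: triangular_system_def at_0)
  qed
  \<comment> \<open>Beyond \<open>N0\<close>, every partition occurring in the two family members or
    in the products of their Schur functions fits into N rows.\<close>
  define N0 where "N0 = Max (length ` (insert \<mu> (insert \<nu> (\<Union>ab\<in>?I. K ab))))"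
  have fin_len: "finite (length ` (insert \<mu> (insert \<nu> (\<Union>ab\<in>?I. K ab))))"
    using K(1) by (intro finite_imageI finite.insertI finite_UN_I finite_cartesian_product finite_subpartitions) auto
  have len: "length \<tau> \<le> N0" if "\<tau> = \<mu> \<or> \<tau> = \<nu> \<or> (\<exists>ab\<in>?I. \<tau> \<in> K ab)" for \<tau>
    unfolding N0_def using that by (intro Max_ge[OF fin_len]) auto
  have zero: "Q (of_nat N - z) = 0" if N: "N0 \<le> N"
    "\<eta>t (of_nat N - z) \<noteq> 0" "\<eta>t (of_nat N - z) + s \<noteq> 0" "Im (zt' (of_nat N - z)) \<noteq> 0" for N
  proof -
    define t where "t = of_nat N - z"
    \<comment> \<open>Solves z' = N + c - 1 at the current parameter.\<close>
    define c where "c = zt' t - of_nat N + 1"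
    have zN: "zt t = of_nat N" "zt' t = of_nat N + c - 1" by (simp_all add: zt_def t_def c_def)
    have ne: "\<eta>t t * (\<eta>t t + s) \<noteq> 0" using N by (simp add: t_def)
    have lw: "lowering_weight c m \<noteq> 0" if "1 \<le> m" for m
    proof -
      \<comment> \<open>A non-real second parameter keeps c + m - 1 away from 0 for all m at
        once.\<close>
      have "Im (c + of_nat m - 1) \<noteq> 0" using N(4) by (simp add: c_def t_def)
      then have "c + of_nat m - 1 \<noteq> 0" by (metis zero_complex.simps(2))
      then show ?thesis using that by (simp add: lowering_weight_def)
    qed
    let ?E = "finite_functional s c (\<eta>t t) N"
    let ?F = "finite_family s (of_nat N) (of_nat N + c - 1) (\<eta>t t) N"
    have orth: "?E (?F \<alpha> * ?F \<beta>) = (if \<alpha> = \<beta> then (\<eta>t t * (\<eta>t t + s)) ^ sum_list \<beta>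
        * skew_pochhammer (of_nat N) \<beta> [] * skew_pochhammer (of_nat N + c - 1) \<beta> [] else 0)"
      if "\<alpha> \<in> partitions" "length \<alpha> \<le> N" "\<beta> \<in> partitions" "length \<beta> \<le> N" for \<alpha> \<beta>
      by (rule finite_family_orthogonal[OF that ne lw])
    have sys: "triangular_system (zt t) (zt' t) (\<eta>t t) (\<lambda>\<kappa>. ?E (?B N \<kappa>)) \<tau>"
      if \<tau>: "\<tau> \<in> partitions" "length \<tau> \<le> N" for \<tau>
    proof -
      \<comment> \<open>The member at the empty partition is 1, so orthogonality to it is the
        triangular system.\<close>
      have "?E (?F \<tau> * ?F []) = (if \<tau> = [] then 1 else 0)"
        using orth[OF \<tau>, of "[]"] by (simp add: partitions_def)
      then have "?E (?F \<tau>) = (if \<tau> = [] then 1 else 0)" by (simp only: finite_family_Nil mult_1_right)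
      then show ?thesis unfolding triangular_system_def zN finite_family_def finite_functional_sum .
    qed
    have "?E (?B N \<kappa>) = poly (P \<kappa>) t" if "ab \<in> ?I" "\<kappa> \<in> K ab" for ab \<kappa>
    proof (rule P)
      show \<kappa>: "\<kappa> \<in> partitions" using K(2) that by blast
      fix \<tau> assume \<tau>: "\<tau> \<in> subpartitions \<kappa>"
      have "length \<kappa> \<le> N0" by (rule len) (use that in blast)
      then show "triangular_system (zt t) (zt' t) (\<eta>t t) (\<lambda>\<kappa>. ?E (?B N \<kappa>)) \<tau>"
        using length_subpartitions[OF \<tau> \<kappa>] N(1) by (intro sys subpartitions_partitions[OF \<tau>]) simp
    qed
    then have "V (\<lambda>\<kappa>. poly (P \<kappa>) t) t = V (\<lambda>\<kappa>. ?E (?B N \<kappa>)) t" by (intro V_eq[symmetric])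
    also have "\<dots> = (\<Sum>ab\<in>?I. ?e t \<mu> (fst ab) * ?e t \<nu> (snd ab) * ?E (?B N (fst ab) * ?B N (snd ab)))"
      unfolding V_def by (intro sum.cong refl) (simp only: B_mult finite_functional_sum)
    also have "\<dots> = ?E (?F \<mu> * ?F \<nu>)"
    proof -
      have "?F \<mu> * ?F \<nu> = (\<Sum>ab\<in>?I. Const (?e t \<mu> (fst ab) * ?e t \<nu> (snd ab)) * (?B N (fst ab) * ?B N (snd ab)))"
        unfolding finite_family_def prod_expand zN by (intro sum.cong refl) (simp only: Const_mult mult_ac)
      then show ?thesis by (simp only: finite_functional_sum)
    qed
    also have "\<dots> = R t"
      using orth[OF \<mu> _ \<nu>] len[of \<mu>] len[of \<nu>] N(1) by (simp add: R_def zN)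
    finally show ?thesis by (simp add: Q_def t_def)
  qed
  have "infinite {t. Q t = 0}"
  proof
    assume "finite {t. Q t = 0}"
    \<comment> \<open>Along the line, \<eta> + t = 0, \<eta> + t + s = 0 and a real second parameter
      each occur for at most one N.\<close>
    let ?bad = "\<lambda>a::complex. {N::nat. of_nat N = a}" and ?bad' = "{N::nat. of_nat N = Re z - Im z'}"
    have "finite (?bad a)" for a by (rule finite_subset[of _ "{nat \<lfloor>Re a\<rfloor>}"]) auto
    moreover have "finite ?bad'" by (rule finite_subset[of _ "{nat \<lfloor>Re z - Im z'\<rfloor>}"]) (auto, metis floor_of_nat nat_int)
    moreover have "(UNIV :: nat set) \<subseteq> {..<N0} \<union> ?bad (z - \<eta>) \<union> ?bad (z - \<eta> - s) \<union> ?bad'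
        \<union> (\<lambda>N. of_nat N - z) -` {t. Q t = 0}"
    proof
      fix N :: nat
      show "N \<in> {..<N0} \<union> ?bad (z - \<eta>) \<union> ?bad (z - \<eta> - s) \<union> ?bad' \<union> (\<lambda>N. of_nat N - z) -` {t. Q t = 0}"
      proof (rule ccontr)
        assume *: "N \<notin> {..<N0} \<union> ?bad (z - \<eta>) \<union> ?bad (z - \<eta> - s) \<union> ?bad' \<union> (\<lambda>N. of_nat N - z) -` {t. Q t = 0}"
        then have "\<eta>t (of_nat N - z) \<noteq> 0" "\<eta>t (of_nat N - z) + s \<noteq> 0" "Im (zt' (of_nat N - z)) \<noteq> 0"
          by (auto simp: \<eta>t_def zt'_def algebra_simps)
        then show False using zero[of N] * by auto
      qed
    qed
    moreover have "finite ((\<lambda>N::nat. of_nat N - z) -` {t. Q t = 0})"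
      using \<open>finite {t. Q t = 0}\<close> by (rule finite_vimageI) (simp add: inj_def)
    ultimately have "finite (UNIV :: nat set)" by (meson finite_UnI finite_lessThan finite_subset)
    then show False by simp
  qed
  from is_polyfun_eq_0[OF Q_poly this, of 0] have "V (\<lambda>\<kappa>. poly (P \<kappa>) 0) 0 = R 0" by (simp add: Q_def)
  moreover have "V (\<lambda>\<kappa>. \<phi> (?S \<kappa>)) 0 = V (\<lambda>\<kappa>. poly (P \<kappa>) 0) 0"
    using K(2) by (intro V_eq phi_poly) blast
  ultimately show ?thesis unfolding phi_V by (simp add: R_def at_0)
qed

section \<open>Specialization to the Laguerre and Meixner functions\<close>

lemma laguerre_eq_step_family: "laguerre z z' \<nu> = step_family 0 z z' 1 \<nu>"
  by (simp add: laguerre_def step_family_def expansion_coeff_def branching_coeff_def step_schur_0 mult.assoc)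

lemma star_iso_simps:
  fixes f g :: "'a::field_char_0 mpoly_seq"
  shows "f \<in> Sym_star \<Longrightarrow> star_iso f \<in> Sym"
    "f \<in> Sym_star \<Longrightarrow> g \<in> Sym_star \<Longrightarrow> star_iso (f + g) = star_iso f + star_iso g"
    "f \<in> Sym_star \<Longrightarrow> g \<in> Sym_star \<Longrightarrow> star_iso (f * g) = star_iso f * star_iso g"
    "f \<in> Sym_star \<Longrightarrow> star_iso (scale c f) = scale c (star_iso f)"
  using star_iso_algebra_iso[where 'a = 'a] unfolding algebra_iso_def by (auto dest: bij_betwE)

lemma meixner_eq_star_iso:
  assumes "\<nu> \<in> partitions"
  shows "meixner z z' \<xi> \<nu> = star_iso (step_family 1 z z' (\<xi> / (1 - \<xi>)) \<nu>)"
proof -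
  have star_iso_sum: "star_iso (\<Sum>a\<in>A. scale (u a) (f a)) = (\<Sum>a\<in>A. scale (u a) (star_iso (f a)))"
    if "finite A" "\<And>a. a \<in> A \<Longrightarrow> f a \<in> Sym_star" for A :: "nat list set" and u and f :: "nat list \<Rightarrow> complex mpoly_seq"
    using that
  proof (induction A)
    case empty
    have "(0 :: complex mpoly_seq) \<in> Sym_star" unfolding Sym_step_1[symmetric] by (rule Sym_step_0_mem)
    from star_iso_simps(4)[OF this, of 0] show ?case by (simp only: sum.empty scale_0)
  next
    case (insert a A)
    have mem: "(\<Sum>a\<in>A. scale (u a) (f a)) \<in> Sym_star" "scale (u a) (f a) \<in> Sym_star" "f a \<in> Sym_star"
      unfolding Sym_step_1[symmetric]
      by (intro Sym_step_sum Sym_step_scale insert.prems[folded Sym_step_1]; simp)+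
    have "star_iso (\<Sum>a\<in>A. scale (u a) (f a)) = (\<Sum>a\<in>A. scale (u a) (star_iso (f a)))"
      using insert.IH insert.prems by blast
    then show ?case
      by (simp only: sum.insert[OF insert.hyps] star_iso_simps(2)[OF mem(2,1)] star_iso_simps(4)[OF mem(3)])
  qed
  have "star_iso (step_family 1 z z' (\<xi> / (1 - \<xi>)) \<nu>)
    = (\<Sum>\<mu>\<in>subpartitions \<nu>. scale (expansion_coeff z z' (\<xi> / (1 - \<xi>)) \<nu> \<mu>) (frobenius_schur \<mu>))"
    unfolding step_family_def frobenius_schur_def step_schur_1[symmetric]
    by (intro star_iso_sum finite_subpartitions) (auto simp: Sym_step_1[symmetric] intro: step_schur_mem subpartitions_partitions)
  also have "\<dots> = meixner z z' \<xi> \<nu>"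
    unfolding meixner_def expansion_coeff_def branching_coeff_def
    by (simp only: power_minus[of "\<xi> / (1 - \<xi>)"] mult.assoc)
  finally show ?thesis ..
qed

theorem theorem5p4:
  fixes z z' \<xi> :: complex
    and \<phi>L \<phi>M :: "complex mpoly_seq \<Rightarrow> complex"
    and \<mu> \<nu> :: "nat list"
  assumes "\<xi> \<noteq> 1"
    and "formal_moment_functional (laguerre z z') \<phi>L"
    and "formal_moment_functional (meixner z z' \<xi>) \<phi>M"
    and "\<mu> \<in> partitions" and "\<nu> \<in> partitions"
  shows "\<phi>L (laguerre z z' \<mu> * laguerre z z' \<nu>) =
           (if \<mu> = \<nu> then skew_pochhammer z \<nu> [] * skew_pochhammer z' \<nu> [] else 0)
       \<and> \<phi>M (meixner z z' \<xi> \<mu> * meixner z z' \<xi> \<nu>) =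
           (if \<mu> = \<nu> then \<xi> ^ sum_list \<nu> / (1 - \<xi>) ^ (2 * sum_list \<nu>)
                            * skew_pochhammer z \<nu> [] * skew_pochhammer z' \<nu> [] else 0)"
proof
  show "\<phi>L (laguerre z z' \<mu> * laguerre z z' \<nu>)
    = (if \<mu> = \<nu> then skew_pochhammer z \<nu> [] * skew_pochhammer z' \<nu> [] else 0)"
    using step_family_orthogonal[of 0 \<phi>L z z' 1 \<mu> \<nu>] assms(2,4,5)
    by (simp add: formal_moment_functional_def Sym_step_0 flip: laguerre_eq_step_family)
next
  let ?\<eta> = "\<xi> / (1 - \<xi>)" and ?\<phi> = "\<lambda>f. \<phi>M (star_iso f)"
  have mem: "step_family 1 z z' ?\<eta> \<kappa> \<in> Sym_star" for \<kappa>
    unfolding step_family_def Sym_step_1[symmetric]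
    by (intro Sym_step_sum Sym_step_scale step_schur_mem subpartitions_partitions)
  note M = assms(3)[unfolded formal_moment_functional_def]
  \<comment> \<open>Composing the Meixner functional with \<open>star_iso\<close> gives a functional
    on \<open>Sym_star\<close>, to which the case s = 1 applies.\<close>
  have "?\<phi> (step_family 1 z z' ?\<eta> \<mu> * step_family 1 z z' ?\<eta> \<nu>)
    = (if \<mu> = \<nu> then (?\<eta> * (?\<eta> + 1)) ^ sum_list \<nu> * skew_pochhammer z \<nu> [] * skew_pochhammer z' \<nu> [] else 0)"
  proof (rule step_family_orthogonal[where \<phi> = ?\<phi>, OF _ _ _ assms(4,5)], unfold Sym_step_1)
    show "?\<phi> (f + g) = ?\<phi> f + ?\<phi> g" if "f \<in> Sym_star" "g \<in> Sym_star" for f g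
      using M star_iso_simps(1)[OF that(1)] star_iso_simps(1)[OF that(2)] unfolding star_iso_simps(2)[OF that] by blast
    show "?\<phi> (scale a f) = a * ?\<phi> f" if "f \<in> Sym_star" for a f
      using M star_iso_simps(1)[OF that] unfolding star_iso_simps(4)[OF that] by blast
    show "?\<phi> (step_family 1 z z' ?\<eta> \<kappa>) = (if \<kappa> = [] then 1 else 0)" if "\<kappa> \<in> partitions" for \<kappa>
      using M that unfolding meixner_eq_star_iso[OF that, symmetric] by blast
  qed
  \<comment> \<open>Here \<eta> + 1 = 1 / (1 - \<xi>), which uses \<xi> \<noteq> 1.\<close>
  moreover have "?\<eta> * (?\<eta> + 1) = \<xi> / (1 - \<xi>)\<^sup>2"
    using assms(1) by (simp add: field_simps power2_eq_square)
  ultimately show "\<phi>M (meixner z z' \<xi> \<mu> * meixner z z' \<xi> \<nu>)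
    = (if \<mu> = \<nu> then \<xi> ^ sum_list \<nu> / (1 - \<xi>) ^ (2 * sum_list \<nu>)
        * skew_pochhammer z \<nu> [] * skew_pochhammer z' \<nu> [] else 0)"
    unfolding meixner_eq_star_iso[OF assms(4)] meixner_eq_star_iso[OF assms(5)] star_iso_simps(3)[OF mem mem, symmetric]
    by (simp add: power_divide flip: power_mult)
qed

end
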